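(* Let $k,m\ge1$ and $r\ge2$ be integers, $q=2r-1>1$, $R=\mathbb Q[x,y]$, and let $I=E_2(L)\cap R$ be the contracted second elementary ideal of the oriented ordered two-component pretzel link $L=P(2k,2r-1,2m)$, so that $I=\langle A_q(x),G_k(x,y),H_m(x,y)\rangle$. Let $g=\gcd(m,k)$, choose $u,v\in\mathbb Z$ with $um+vk=g$, and put $e=um-vk$. For every divisor $\delta\mid q$ with $\delta>1$, let $p_\delta(y)\in\mathcal K_\delta[y]$ be the monic greatest common divisor of $G_k(x_\delta,y)$ and $H_m(x_\delta,y)$, and $d_\delta=\deg_y p_\delta$. Then $$p_\delta(y)=\begin{cases}1,&\delta\nmid\operatorname{lcm}(m,k),\\[4pt] \dfrac{y^g-x_\delta^e}{(y-x_\delta)^{\mathbf 1_{\delta\mid k}}(y-x_\delta^{-1})^{\mathbf 1_{\delta\mid m}}},&\delta\mid\operatorname{lcm}(m,k).\end{cases}$$ In particular, $$d_\delta=\begin{cases}0,&\delta\nmid\operatorname{lcm}(m,k),\\ g-\mathbf 1_{\delta\mid m}-\mathbf 1_{\delta\mid k},&\delta\mid\operatorname{lcm}(m,k).\end{cases}$$ Let $\mathcal D:=\{\delta>1:\ \delta\mid q,\ d_\delta>0\}$. If $\mathcal D=\varnothing$, then $I=R$. If $\mathcal D\neq\varnothing$, then $$R/I\cong\prod_{\delta\in\mathcal D}\mathcal K_\delta[y]/(p_\delta(y)),\qquad \dim_{\mathbb Q}(R/I)=\sum_{\delta\in\mathcal D}d_\delta\deg\Phi_{2\delta}.$$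
   Context: $A_q(x)=\frac{1+x^q}{1+x}$, $G_k(x,y)=\frac{1-(xy)^k}{1-xy}$, $H_m(x,y)=\frac{x^m-y^m}{x-y}$ are polynomials in $R=\mathbb Q[x,y]$. $\Phi_n(x)$ is the $n$th cyclotomic polynomial. For $\delta\mid q$, $\delta>1$, put $\mathcal K_\delta=\mathbb Q[x]/(\Phi_{2\delta}(x))$ (a cyclotomic field) and let $x_\delta$ be the class of $x$. $\mathbf 1_{\mathsf C}\in\{0,1\}$ is the indicator of a condition $\mathsf C$. When $\delta\mid\operatorname{lcm}(m,k)$, $x_\delta^e$ does not depend on the chosen Bézout pair $(u,v)$. Origin of $I$ (for reference): for a two-component oriented ordered link $L$, $E_2(L)\subset\mathbb Q[x^{\pm1},y^{\pm1}]$ (with $y=t_1$, $x=t_2$) is the second elementary ideal of the link group with $\phi$ sending the positive meridian of the $i$th component to the $i$th standard basis vector of $\mathbb Z^2$, i.e. for a presentation with $n$ generators it is generated by the $(n-2)\times(n-2)$ minors of the Fox matrix evaluated under $\phi$. For $L=P(2k,2r-1,2m)$ the link group is $\langle a,b,c\mid r_1,r_2\rangle$, $r_1=(cb)^r b^{-1}(cb)^{-r}(ac^{-1})^m c(ca^{-1})^m$, $r_2=(ab)^{-k}b(ab)^k(cb)^{r-1}c^{-1}(cb)^{-(r-1)}$, with $a\mapsto y$, $b,c\mapsto x$; one has $I:=E_2(L)\cap R=\langle A_q,G_k,H_m\rangle$. *)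

theory Defs
  imports
    "HOL-Computational_Algebra.Polynomial"
    "HOL-Library.Poly_Mapping"
    "HOL-Library.Product_Plus"
    "HOL-Algebra.Algebra"
    "HOL-Algebra.UnivPoly"
    "HOL-Algebra.Chinese_Remainder"
    "HOL-Algebra.Algebraic_Closure_Type"
    "Jordan_Normal_Form.Determinant"
    "Jordan_Normal_Form.DL_Submatrix"
begin

section \<open>The polynomial ring \<open>\<rat>[x,y]\<close>\<close>

text \<open>\<open>\<rat>[x,y]\<close> is \<open>rat poly poly\<close>: the outer variable is \<open>y\<close>, the coefficients are polynomials in \<open>x\<close>.\<close>

abbreviation Rxy :: "rat poly poly ring" where
  "Rxy \<equiv> ring_of_type_algebra"

definition x_var :: "rat poly poly" where "x_var = [:[:0, 1:]:]"
definition y_var :: "rat poly poly" where "y_var = [:0, 1:]"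

text \<open>The divisions below are exact (for \<open>A_poly\<close>: when \<open>q\<close> is odd).\<close>

definition A_poly :: "nat \<Rightarrow> rat poly poly" where
  "A_poly q = (1 + x_var ^ q) div (1 + x_var)"

definition G_poly :: "nat \<Rightarrow> rat poly poly" where
  "G_poly k = (1 - (x_var * y_var) ^ k) div (1 - x_var * y_var)"

definition H_poly :: "nat \<Rightarrow> rat poly poly" where
  "H_poly m = (x_var ^ m - y_var ^ m) div (x_var - y_var)"


section \<open>Fox calculus and elementary ideals\<close>

text \<open>A word in the generators \<open>0, 1, \<dots>\<close> and their inverses; \<open>(i, True)\<close> is the generator \<open>i\<close>
  and \<open>(i, False)\<close> its inverse.\<close>

type_synonym word = "(nat \<times> bool) list"

definition gen :: "nat \<Rightarrow> word" where
  "gen i = [(i, True)]"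

definition winv :: "word \<Rightarrow> word" where
  "winv w = rev (map (\<lambda>(i, s). (i, \<not> s)) w)"

definition wpow :: "word \<Rightarrow> nat \<Rightarrow> word" where
  "wpow w n = concat (replicate n w)"

text \<open>The Laurent polynomial ring \<open>\<rat>[x\<^sup>\<plusminus>\<^sup>1, y\<^sup>\<plusminus>\<^sup>1]\<close> as the group ring of \<open>\<int>\<^sup>2\<close>; the exponent pair
  \<open>(i, j)\<close> stands for \<open>t\<^sub>1\<^sup>i t\<^sub>2\<^sup>j\<close> with \<open>t\<^sub>1 = y\<close> and \<open>t\<^sub>2 = x\<close>.\<close>

type_synonym laurent = "(int \<times> int) \<Rightarrow>\<^sub>0 rat"

abbreviation Laurent :: "laurent ring" where
  "Laurent \<equiv> ring_of_type_algebra"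

text \<open>\<open>fox \<phi> j w\<close> is the image in the group ring of \<open>\<int>\<^sup>2\<close> of the Fox derivative of \<open>w\<close> with respect
  to the generator \<open>j\<close>; the recursion is \<open>\<partial>(u v) = \<partial>u + u \<partial>v\<close> with \<open>u\<close> a single letter, where
  \<open>\<partial>\<^sub>j g\<^sub>j = 1\<close> and \<open>\<partial>\<^sub>j g\<^sub>j\<inverse> = - g\<^sub>j\<inverse>\<close>.\<close>

fun fox :: "(nat \<Rightarrow> int \<times> int) \<Rightarrow> nat \<Rightarrow> word \<Rightarrow> laurent" where
  "fox \<phi> j [] = 0"
| "fox \<phi> j ((i, True) # w) =
     (if i = j then 1 else 0) + Poly_Mapping.single (\<phi> i) 1 * fox \<phi> j w"
| "fox \<phi> j ((i, False) # w) =
     (if i = j then - Poly_Mapping.single (- \<phi> i) 1 else 0)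
       + Poly_Mapping.single (- \<phi> i) 1 * fox \<phi> j w"

definition fox_matrix :: "(nat \<Rightarrow> int \<times> int) \<Rightarrow> nat \<Rightarrow> word list \<Rightarrow> laurent mat" where
  "fox_matrix \<phi> n rs = mat (length rs) n (\<lambda>(i, j). fox \<phi> j (rs ! i))"

text \<open>The \<open>d\<close>-th elementary ideal of the presentation with generators \<open>0, \<dots>, n - 1\<close> and
  relators \<open>rs\<close> (for \<open>d \<le> n\<close>).\<close>

definition elementary_ideal ::
    "nat \<Rightarrow> (nat \<Rightarrow> int \<times> int) \<Rightarrow> nat \<Rightarrow> word list \<Rightarrow> laurent set" where
  "elementary_ideal d \<phi> n rs =
     Idl\<^bsub>Laurent\<^esub> {det (submatrix (fox_matrix \<phi> n rs) S T) | S T.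
        S \<subseteq> {..<length rs} \<and> T \<subseteq> {..<n} \<and> card S = n - d \<and> card T = n - d}"

text \<open>The group of the oriented ordered link \<open>P(2k, 2r-1, 2m)\<close>: generators \<open>a, b, c = 0, 1, 2\<close>;
  \<open>a\<close> is a meridian of the first component, \<open>b\<close> and \<open>c\<close> are meridians of the second one.\<close>

definition pretzel_relators :: "nat \<Rightarrow> nat \<Rightarrow> nat \<Rightarrow> word list" where
  "pretzel_relators k m r =
    (let a = gen 0; b = gen 1; c = gen 2 in
      [wpow (c @ b) r @ winv b @ winv (wpow (c @ b) r) @ wpow (a @ winv c) m @ c @
         wpow (c @ winv a) m,
       winv (wpow (a @ b) k) @ b @ wpow (a @ b) k @ wpow (c @ b) (r - 1) @ winv c @
         winv (wpow (c @ b) (r - 1))])"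

definition pretzel_phi :: "nat \<Rightarrow> int \<times> int" where
  "pretzel_phi i = (if i = 0 then (1, 0) else (0, 1))"

definition pretzel_E2 :: "nat \<Rightarrow> nat \<Rightarrow> nat \<Rightarrow> laurent set" where
  "pretzel_E2 k m r = elementary_ideal 2 pretzel_phi 3 (pretzel_relators k m r)"

text \<open>The inclusion of \<open>\<rat>[x,y]\<close> into the Laurent polynomial ring, and the contraction
  \<open>E\<^sub>2(L) \<inter> R\<close>.\<close>

definition to_laurent :: "rat poly poly \<Rightarrow> laurent" where
  "to_laurent f = (\<Sum>j\<le>Polynomial.degree f. \<Sum>i\<le>Polynomial.degree (Polynomial.coeff f j).
     Poly_Mapping.single (int j, int i) (Polynomial.coeff (Polynomial.coeff f j) i))"

definition pretzel_I :: "nat \<Rightarrow> nat \<Rightarrow> nat \<Rightarrow> rat poly poly set" where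
  "pretzel_I k m r = {f. to_laurent f \<in> pretzel_E2 k m r}"


section \<open>The cyclotomic fields \<open>\<K>\<^sub>\<delta>\<close> and the polynomials \<open>p\<^sub>\<delta>\<close>\<close>

text \<open>The polynomial over \<open>\<rat>\<close> whose complex roots are the primitive \<open>n\<close>-th roots of unity, all
  simple.\<close>

definition cyclotomic :: "nat \<Rightarrow> rat poly" where
  "cyclotomic n = (THE p. map_poly of_rat p =
     (\<Prod>\<omega> | \<omega> ^ n = 1 \<and> (\<forall>d. 0 < d \<and> d < n \<longrightarrow> \<omega> ^ d \<noteq> 1). [:- \<omega>, 1 :: complex:]))"

definition cyc_ideal :: "nat \<Rightarrow> rat poly set" where
  "cyc_ideal \<delta> = PIdl\<^bsub>ring_of_type_algebra\<^esub> (cyclotomic (2 * \<delta>))"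

definition cyc_class :: "nat \<Rightarrow> rat poly \<Rightarrow> rat poly set" where
  "cyc_class \<delta> f = cyc_ideal \<delta> +>\<^bsub>ring_of_type_algebra\<^esub> f"

definition K_cyc :: "nat \<Rightarrow> rat poly set ring" where
  "K_cyc \<delta> = ring_of_type_algebra Quot cyc_ideal \<delta>"

definition x_cls :: "nat \<Rightarrow> rat poly set" where
  "x_cls \<delta> = cyc_class \<delta> [:0, 1:]"

text \<open>\<open>f(x\<^sub>\<delta>, y)\<close> as an element of \<open>UP (K_cyc \<delta>)\<close>; elements of \<open>UP\<close> are coefficient functions.\<close>

definition subst_x :: "nat \<Rightarrow> rat poly poly \<Rightarrow> nat \<Rightarrow> rat poly set" where
  "subst_x \<delta> f = (\<lambda>n. cyc_class \<delta> (Polynomial.coeff f n))"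

definition monic_gcd ::
    "('a, 'b) ring_scheme \<Rightarrow> (nat \<Rightarrow> 'a) \<Rightarrow> (nat \<Rightarrow> 'a) \<Rightarrow> (nat \<Rightarrow> 'a) \<Rightarrow> bool" where
  "monic_gcd F p a b \<longleftrightarrow>
     p \<in> carrier (UP F) \<and> up_ring.coeff (UP F) p (deg F p) = \<one>\<^bsub>F\<^esub> \<and> p gcdof\<^bsub>UP F\<^esub> a b"

definition p_gcd :: "nat \<Rightarrow> nat \<Rightarrow> nat \<Rightarrow> nat \<Rightarrow> rat poly set" where
  "p_gcd k m \<delta> = (THE p. monic_gcd (K_cyc \<delta>) p (subst_x \<delta> (G_poly k)) (subst_x \<delta> (H_poly m)))"

definition d_gcd :: "nat \<Rightarrow> nat \<Rightarrow> nat \<Rightarrow> nat" where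
  "d_gcd k m \<delta> = deg (K_cyc \<delta>) (p_gcd k m \<delta>)"

abbreviation up_y :: "nat \<Rightarrow> nat \<Rightarrow> rat poly set" where
  "up_y \<delta> \<equiv> up_ring.monom (UP (K_cyc \<delta>)) \<one>\<^bsub>K_cyc \<delta>\<^esub> 1"

abbreviation up_const :: "nat \<Rightarrow> rat poly set \<Rightarrow> nat \<Rightarrow> rat poly set" where
  "up_const \<delta> c \<equiv> up_ring.monom (UP (K_cyc \<delta>)) c 0"

definition D_set :: "nat \<Rightarrow> nat \<Rightarrow> nat \<Rightarrow> nat set" where
  "D_set k m q = {\<delta>. \<delta> > 1 \<and> \<delta> dvd q \<and> d_gcd k m \<delta> > 0}"

text \<open>The image of \<open>\<rat>\<close> in \<open>R/I\<close>, which serves as the field of scalars.\<close>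

definition rat_scalars :: "rat poly poly set \<Rightarrow> rat poly poly set set" where
  "rat_scalars I = range (\<lambda>c. I +>\<^bsub>Rxy\<^esub> [:[:c:]:])"

end

theory Submission
  imports Defs "Jordan_Normal_Form.Char_Poly"
begin

text \<open>The six entries of the Fox matrix generate \<open>E\<^sub>2(L)\<close>, and up to units and multiples of one another
they are \<open>A\<close>, \<open>(x - 1) G\<close> and \<open>(x - 1) H\<close>, together with combinations of \<open>A\<close>, \<open>G\<close> and \<open>H\<close>. Since
\<open>A \<equiv> 1\<close> modulo \<open>x - 1\<close>, the factor \<open>x - 1\<close> is a unit modulo \<open>A\<close> and can be dropped
(\<open>pretzel_entries_ideal\<close>). The contraction to \<open>\<rat>[x,y]\<close> adds nothing, because \<open>xy\<close> is already a unit
modulo \<open>G\<close> (\<open>contract_laurent_genideal\<close>). This gives \<open>I = \<langle>A, G, H\<rangle>\<close>.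

The polynomial \<open>A = (x\<^sup>q + 1) / (x + 1)\<close> is the product of the \<open>\<Phi>\<^bsub>2\<delta>\<^esub>(x)\<close> over the divisors \<open>\<delta> > 1\<close> of
\<open>q\<close>, and these are pairwise comaximal. So \<open>I\<close> is the intersection of the pairwise comaximal ideals
\<open>J \<delta> = \<langle>\<Phi>\<^bsub>2\<delta>\<^esub>, G, H\<rangle>\<close>, and everything reduces to one \<open>\<delta>\<close>.

Fix \<open>\<delta>\<close> and compute modulo \<open>\<Phi>\<^bsub>2\<delta>\<^esub>\<close>. The only arithmetic input is that \<open>x\<^bsup>2N\<^esup> - 1\<close> vanishes if \<open>\<delta>\<close>
divides \<open>N\<close> and is a unit otherwise. In \<open>\<langle>\<Phi>\<^bsub>2\<delta>\<^esub>, G, H\<rangle>\<close> one has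
\<open>(xy)\<^sup>k = 1\<close> and \<open>y\<^sup>m = x\<^sup>m\<close>, and the Bezout relation turns this into \<open>y\<^sup>g = x\<^sup>e\<close>
(\<open>bezout_power_cong\<close>). Raising the latter to the powers \<open>m/g\<close> and \<open>k/g\<close> and comparing gives
\<open>x\<^bsup>2 lcm(m,k)\<^esup> = 1\<close>, which forces the unit ideal when \<open>\<delta>\<close> does not divide \<open>lcm(m,k)\<close>. When it does
divide, the same computation shows that \<open>y\<^sup>g - x\<^sup>e\<close> divides both \<open>y\<^sup>m - x\<^sup>m = (y - x) H\<close> and
\<open>(xy)\<^sup>k - 1\<close>, which is \<open>(y - x\<inverse>) G\<close> up to the unit \<open>x\<close>. It remains to take away the linear factors:
\<open>x\<close> is a root of \<open>y\<^sup>g - x\<^sup>e\<close> if \<open>\<delta>\<close> divides \<open>k\<close>, and otherwise the value there is a unit; likewise for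
\<open>x\<inverse>\<close> and \<open>m\<close>. As \<open>H(x,x) = m x\<^bsup>m-1\<^esup>\<close> and \<open>G(x,x\<inverse>) = k\<close> are units, \<open>y - x\<close> is comaximal to \<open>H\<close> and
\<open>y - x\<inverse>\<close> to \<open>G\<close>, so the quotient \<open>p\<close> satisfies \<open>J \<delta> = \<langle>\<Phi>\<^bsub>2\<delta>\<^esub>, p\<rangle>\<close> (\<open>mem_iff_monic_factor_mem\<close>).
Being monic, \<open>p\<close> is the gcd over \<open>\<K>\<^sub>\<delta>\<close>.

The Chinese remainder theorem now describes \<open>R/I\<close>. For the dimension, the monomials \<open>x\<^sup>i y\<^sup>j\<close> with
\<open>i < deg \<Phi>\<^bsub>2\<delta>\<^esub>\<close> and \<open>j < deg p\<close> lead from \<open>J \<delta>\<close> to \<open>R\<close> in steps of codimension one, and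
codimensions of comaximal ideals add up under intersection.\<close>

section \<open>Cyclotomic polynomials over the rationals\<close>

interpretation of_rat_poly: map_poly_inj_comm_ring_hom "of_rat :: rat \<Rightarrow> complex" ..

definition prim_roots :: "nat \<Rightarrow> complex set" where
  "prim_roots n = {\<omega>. \<omega> ^ n = 1 \<and> (\<forall>d. 0 < d \<and> d < n \<longrightarrow> \<omega> ^ d \<noteq> 1)}"

text \<open>The cyclotomic polynomial with complex coefficients. It is studied separately because \<open>cyclotomic\<close>
is a description that says nothing until this product is known to have rational coefficients.\<close>

definition prim_poly :: "nat \<Rightarrow> complex poly" where
  "prim_poly n = (\<Prod>\<omega>\<in>prim_roots n. [:- \<omega>, 1:])"

lemma prim_root_power_eq_1_iff:
  assumes "\<omega> \<in> prim_roots n" "n > 0"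
  shows "\<omega> ^ N = 1 \<longleftrightarrow> n dvd N"
proof -
  have "\<omega> ^ N = \<omega> ^ (n * (N div n) + N mod n)" by simp
  also have "\<dots> = \<omega> ^ (N mod n)"
    using assms(1) by (simp only: power_add power_mult) (simp add: prim_roots_def)
  finally have eq: "\<omega> ^ N = \<omega> ^ (N mod n)" .
  have "N mod n < n" using assms(2) by simp
  then have "\<omega> ^ (N mod n) = 1 \<longleftrightarrow> N mod n = 0"
    using assms(1) unfolding prim_roots_def by (cases "N mod n = 0") auto
  then show ?thesis using eq by (simp add: dvd_eq_mod_eq_0)
qed

lemma roots_unity_Union_prim_roots:
  assumes "n > 0"
  shows "{\<omega>. \<omega> ^ n = 1} = (\<Union>d\<in>{d. d dvd n}. prim_roots d)"
proof (intro equalityI subsetI)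
  fix \<omega> :: complex assume "\<omega> \<in> {\<omega>. \<omega> ^ n = 1}"
  then have 1: "0 < n \<and> \<omega> ^ n = 1" using assms by simp
  define d where "d = (LEAST d. 0 < d \<and> \<omega> ^ d = 1)"
  have d: "0 < d \<and> \<omega> ^ d = 1" unfolding d_def by (rule LeastI) (rule 1)
  have "\<omega> ^ j \<noteq> 1" if "0 < j" "j < d" for j
    using not_less_Least[of j "\<lambda>d. 0 < d \<and> \<omega> ^ d = 1"] that unfolding d_def by blast
  then have "\<omega> \<in> prim_roots d" using d by (auto simp: prim_roots_def)
  moreover from this have "d dvd n" using prim_root_power_eq_1_iff d 1 by blast
  ultimately show "\<omega> \<in> (\<Union>d\<in>{d. d dvd n}. prim_roots d)" by auto
next
  fix \<omega> :: complex assume "\<omega> \<in> (\<Union>d\<in>{d. d dvd n}. prim_roots d)"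
  then obtain d where "d dvd n" "\<omega> \<in> prim_roots d" by auto
  moreover from this assms have "d > 0" by (auto intro: Nat.gr0I)
  ultimately show "\<omega> \<in> {\<omega>. \<omega> ^ n = 1}" using prim_root_power_eq_1_iff by blast
qed

lemma finite_prim_roots: "n > 0 \<Longrightarrow> finite (prim_roots n)"
  by (rule finite_subset[OF _ finite_roots_unity[of n]]) (auto simp: prim_roots_def)

lemma prim_roots_disjoint:
  assumes "a > 0" "b > 0" "a \<noteq> b"
  shows "prim_roots a \<inter> prim_roots b = {}"
proof -
  have False if "\<omega> \<in> prim_roots a" "\<omega> \<in> prim_roots b" for \<omega>
  proof -
    have "\<omega> ^ a = 1" "\<omega> ^ b = 1" using that by (simp_all add: prim_roots_def)
    then have "a dvd b" "b dvd a"
      using prim_root_power_eq_1_iff[OF that(1) assms(1)] prim_root_power_eq_1_iff[OF that(2) assms(2)]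
      by simp_all
    then show False using assms(3) dvd_antisym by blast
  qed
  then show ?thesis by auto
qed

lemma prim_roots_nonempty:
  assumes "n > 0"
  shows "prim_roots n \<noteq> {}"
proof -
  let ?w = "cis (2 * pi / real n)"
  have w: "?w ^ d = cis (2 * pi * real d / real n)" for d
    by (simp add: DeMoivre mult.commute)
  have inj: "inj_on (\<lambda>k. cis (2 * pi * real k / real n)) {..<n}"
    using bij_betw_roots_unity[OF assms] by (auto simp: bij_betw_def)
  have "?w ^ n = 1" using assms by (simp add: w del: of_nat_power)
  moreover have "?w ^ d \<noteq> 1" if "0 < d" "d < n" for d
    using inj_onD[OF inj, of d 0] that assms by (auto simp: w)
  ultimately have "?w \<in> prim_roots n" by (auto simp: prim_roots_def)
  then show ?thesis by blast
qed

lemma degree_power_X_minus_1: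
  "n > 0 \<Longrightarrow> Polynomial.degree ([:0, 1:] ^ n - 1 :: 'a::idom poly) = n"
  using Polynomial.degree_add_eq_left[of "- 1" "[:0, 1:] ^ n :: 'a poly"]
  by (simp add: Polynomial.degree_power_eq)

lemma prod_roots_unity:
  assumes "n > 0"
  shows "(\<Prod>\<omega> | \<omega> ^ n = 1. [:- \<omega>, 1 :: complex:]) = [:0, 1:] ^ n - 1"
proof (rule poly_eqI_degree_lead_coeff[where n = n and A = "{\<omega>. \<omega> ^ n = 1}"])
  have card: "card {\<omega>::complex. \<omega> ^ n = 1} = n" using assms by (rule card_roots_unity_eq)
  have fin: "finite {\<omega>::complex. \<omega> ^ n = 1}" using assms by (simp add: finite_roots_unity)
  have deg: "Polynomial.degree (\<Prod>\<omega> | \<omega> ^ n = 1. [:- \<omega>, 1 :: complex:]) = n"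
    using card by (subst degree_prod_sum_eq) auto
  show "n \<le> card {\<omega>::complex. \<omega> ^ n = 1}" using card by simp
  show "Polynomial.degree (\<Prod>\<omega> | \<omega> ^ n = 1. [:- \<omega>, 1 :: complex:]) \<le> n" using deg by simp
  show d2: "Polynomial.degree ([:0, 1:] ^ n - 1 :: complex poly) \<le> n"
    using degree_power_X_minus_1[OF assms, where 'a = complex] by simp
  have "Polynomial.lead_coeff (\<Prod>\<omega> | \<omega> ^ n = 1. [:- \<omega>, 1 :: complex:]) = 1"
    by (simp add: lead_coeff_prod)
  moreover have "Polynomial.coeff ([:0, 1:] ^ n - 1 :: complex poly) n = 1"
    using assms by (simp add: x_as_monom monom_power)
  ultimately show "Polynomial.coeff (\<Prod>\<omega> | \<omega> ^ n = 1. [:- \<omega>, 1 :: complex:]) n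
      = Polynomial.coeff ([:0, 1:] ^ n - 1) n" using deg by simp
  show "poly (\<Prod>\<omega> | \<omega> ^ n = 1. [:- \<omega>, 1:]) z = poly ([:0, 1:] ^ n - 1) z"
    if "z \<in> {\<omega>. \<omega> ^ n = 1}" for z :: complex
    using that fin by (auto simp: poly_prod)
qed

lemma prod_prim_poly:
  assumes "n > 0"
  shows "(\<Prod>d | d dvd n. prim_poly d) = [:0, 1:] ^ n - 1"
proof -
  have "(\<Prod>d | d dvd n. prim_poly d) = (\<Prod>\<omega>\<in>(\<Union>d\<in>{d. d dvd n}. prim_roots d). [:- \<omega>, 1:])"
    unfolding prim_poly_def
  proof (rule prod.UNION_disjoint[symmetric])
    show "\<forall>d\<in>{d. d dvd n}. finite (prim_roots d)"
      using assms by (auto intro!: finite_prim_roots intro: Nat.gr0I)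
    show "\<forall>i\<in>{d. d dvd n}. \<forall>j\<in>{d. d dvd n}. i \<noteq> j \<longrightarrow> prim_roots i \<inter> prim_roots j = {}"
      using assms prim_roots_disjoint by (metis dvd_pos_nat mem_Collect_eq)
  qed (use assms in simp)
  also have "\<dots> = [:0, 1:] ^ n - 1"
    using prod_roots_unity[OF assms] roots_unity_Union_prim_roots[OF assms] by simp
  finally show ?thesis .
qed

lemma map_poly_of_rat_power_X_minus_1:
  "map_poly of_rat ([:0, 1:] ^ n - 1 :: rat poly) = ([:0, 1:] ^ n - 1 :: complex poly)"
  by (simp add: of_rat_poly.hom_power hom_distribs)

lemma prim_poly_nonzero: "prim_poly n \<noteq> 0"
proof (cases "finite (prim_roots n)")
  case True then show ?thesis by (simp add: prim_poly_def)
qed (simp add: prim_poly_def)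

text \<open>By strong induction: \<open>x\<^sup>n - 1\<close> is the product of all \<open>prim_poly d\<close> with \<open>d\<close> dividing \<open>n\<close>, so \<open>prim_poly n\<close>
is a quotient of rational polynomials, and polynomial division commutes with the inclusion of the
rationals in the complex numbers.\<close>

lemma prim_poly_rational:
  "n > 0 \<Longrightarrow> \<exists>p :: rat poly. map_poly of_rat p = prim_poly n"
proof (induction n rule: less_induct)
  case (less n)
  have "\<forall>d\<in>{d. d dvd n} - {n}. \<exists>p :: rat poly. map_poly of_rat p = prim_poly d"
  proof
    fix d assume "d \<in> {d. d dvd n} - {n}"
    then have "d < n" "d > 0" using less.prems by (auto intro: Nat.gr0I dest: dvd_imp_le)
    then show "\<exists>p :: rat poly. map_poly of_rat p = prim_poly d" using less.IH by blast
  qed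
  then obtain P :: "nat \<Rightarrow> rat poly"
    where P: "\<And>d. d \<in> {d. d dvd n} - {n} \<Longrightarrow> map_poly of_rat (P d) = prim_poly d"
    by metis
  define Q where "Q = (\<Prod>d\<in>{d. d dvd n} - {n}. P d)"
  have Q: "map_poly of_rat Q = (\<Prod>d\<in>{d. d dvd n} - {n}. prim_poly d)"
    unfolding Q_def by (simp add: of_rat_poly.hom_prod P)
  have "[:0, 1:] ^ n - 1 = prim_poly n * (map_poly of_rat Q :: complex poly)"
    using prod_prim_poly[OF less.prems] less.prems unfolding Q
    by (subst (asm) prod.remove[of _ n]) auto
  moreover have "(map_poly of_rat Q :: complex poly) \<noteq> 0"
    unfolding Q using less.prems prim_poly_nonzero by simp
  ultimately have "prim_poly n = map_poly of_rat ([:0, 1:] ^ n - 1) div map_poly of_rat Q"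
    by (simp add: map_poly_of_rat_power_X_minus_1)
  also have "\<dots> = map_poly of_rat (([:0, 1:] ^ n - 1) div Q)"
    by (simp add: of_rat_hom.map_poly_div)
  finally show ?case by metis
qed

lemma map_poly_of_rat_inj: "map_poly of_rat p = (map_poly of_rat q :: complex poly) \<Longrightarrow> p = q"
  by (simp add: poly_eq_iff)

lemma map_poly_cyclotomic:
  assumes "n > 0"
  shows "map_poly of_rat (cyclotomic n) = prim_poly n"
proof -
  obtain p :: "rat poly" where p: "map_poly of_rat p = prim_poly n"
    using prim_poly_rational[OF assms] by blast
  show ?thesis
    unfolding cyclotomic_def prim_poly_def[unfolded prim_roots_def, symmetric]
  proof (rule theI[of _ p])
    show "map_poly of_rat p = prim_poly n" by (rule p)
    show "x = p" if "map_poly of_rat x = prim_poly n" for x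
      using that p by (intro map_poly_of_rat_inj) simp
  qed
qed

lemma degree_cyclotomic_pos:
  assumes "n > 0"
  shows "Polynomial.degree (cyclotomic n) > 0"
proof -
  have "Polynomial.degree (cyclotomic n) = Polynomial.degree (prim_poly n)"
    unfolding map_poly_cyclotomic[OF assms, symmetric] by simp
  also have "\<dots> = card (prim_roots n)"
    unfolding prim_poly_def by (subst degree_prod_sum_eq) auto
  finally show ?thesis
    using prim_roots_nonempty[OF assms] finite_prim_roots[OF assms] by (simp add: card_gt_0_iff)
qed

lemma prod_cyclotomic:
  assumes "n > 0"
  shows "(\<Prod>d | d dvd n. cyclotomic d) = [:0, 1:] ^ n - 1"
proof (rule map_poly_of_rat_inj)
  have "map_poly of_rat (\<Prod>d | d dvd n. cyclotomic d) = (\<Prod>d | d dvd n. prim_poly d)"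
    using assms by (auto simp add: of_rat_poly.hom_prod intro!: prod.cong map_poly_cyclotomic intro: Nat.gr0I)
  then show "map_poly of_rat (\<Prod>d | d dvd n. cyclotomic d)
      = (map_poly of_rat ([:0, 1:] ^ n - 1) :: complex poly)"
    using prod_prim_poly[OF assms] by (simp add: map_poly_of_rat_power_X_minus_1)
qed

lemma cyclotomic_dvd_power_minus_1:
  assumes "n > 0" "n dvd N"
  shows "cyclotomic n dvd [:0, 1:] ^ N - 1"
proof (cases "N = 0")
  case False
  then have "(\<Prod>d | d dvd N. cyclotomic d) = [:0, 1:] ^ N - 1" by (simp add: prod_cyclotomic)
  moreover have "cyclotomic n dvd (\<Prod>d | d dvd N. cyclotomic d)"
    using assms False by (intro dvd_prodI) auto
  ultimately show ?thesis by simp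
qed simp

text \<open>A nonconstant gcd over the rationals would have a complex root, which would be a common root. This is
how coprimality over the rationals is read off from roots of unity.\<close>

lemma bezout_rat_poly:
  fixes p q :: "rat poly"
  assumes "\<And>z :: complex. poly (map_poly of_rat p) z = 0 \<Longrightarrow> poly (map_poly of_rat q) z = 0 \<Longrightarrow> False"
    and "p \<noteq> 0"
  shows "\<exists>a b. a * p + b * q = 1"
proof -
  let ?g = "gcd p q"
  have "Polynomial.degree ?g = 0"
  proof (rule ccontr)
    assume "Polynomial.degree ?g \<noteq> 0"
    then have "Polynomial.degree (map_poly of_rat ?g :: complex poly) \<noteq> 0" by simp
    then have "\<not> constant (poly (map_poly of_rat ?g :: complex poly))"
      by (simp only: constant_degree not_False_eq_True)
    then obtain z :: complex where z: "poly (map_poly of_rat ?g) z = 0"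
      using fundamental_theorem_of_algebra by blast
    have "poly (map_poly of_rat r) z = 0" if "?g dvd r" for r
    proof -
      obtain s where "r = ?g * s" using \<open>?g dvd r\<close> by blast
      then show ?thesis using z by (simp add: of_rat_poly.hom_mult)
    qed
    then show False using assms(1)[of z] by simp
  qed
  moreover have "?g \<noteq> 0" using assms(2) by simp
  ultimately have "is_unit ?g" by (simp add: is_unit_iff_degree)
  then have "?g = 1" by (metis is_unit_gcd_iff)
  then show ?thesis by (metis bezout_coefficients_fst_snd)
qed

lemma cyclotomic_coprime_power_minus_1:
  assumes "n > 0" "\<not> n dvd N"
  shows "\<exists>a b. a * cyclotomic n + b * ([:0, 1:] ^ N - 1) = 1"
proof (rule bezout_rat_poly)
  fix z :: complex
  assume "poly (map_poly of_rat (cyclotomic n)) z = 0"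
    and *: "poly (map_poly of_rat ([:0, 1:] ^ N - 1)) z = 0"
  then have "z \<in> prim_roots n"
    using finite_prim_roots[OF assms(1)]
    by (auto simp: map_poly_cyclotomic[OF assms(1)] prim_poly_def poly_prod)
  moreover have "z ^ N = 1" using * by (simp add: map_poly_of_rat_power_X_minus_1)
  ultimately show False using prim_root_power_eq_1_iff assms by blast
next
  show "cyclotomic n \<noteq> 0" using degree_cyclotomic_pos[OF assms(1)] by auto
qed

lemma cyclotomic_coprime:
  assumes "a > 0" "b > 0" "a \<noteq> b"
  shows "\<exists>s t. s * cyclotomic a + t * cyclotomic b = 1"
proof (rule bezout_rat_poly)
  fix z :: complex
  assume "poly (map_poly of_rat (cyclotomic a)) z = 0" "poly (map_poly of_rat (cyclotomic b)) z = 0"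
  then have "z \<in> prim_roots a \<inter> prim_roots b"
    using finite_prim_roots[OF assms(1)] finite_prim_roots[OF assms(2)]
    by (auto simp: map_poly_cyclotomic assms prim_poly_def poly_prod)
  then show False using prim_roots_disjoint[OF assms] by simp
next
  show "cyclotomic a \<noteq> 0" using degree_cyclotomic_pos[OF assms(1)] by auto
qed

text \<open>For odd \<open>q\<close> the even divisors of \<open>2q\<close> are the \<open>2d\<close> with \<open>d\<close> dividing \<open>q\<close>, so their factors in
\<open>x\<^bsup>2q\<^esup> - 1 = (x\<^sup>q - 1) (x\<^sup>q + 1)\<close> make up \<open>x\<^sup>q + 1\<close>. The divisor \<open>d = 1\<close> contributes \<open>x + 1\<close>.\<close>

lemma prod_cyclotomic_double:
  assumes "odd q"
  shows "(\<Prod>d | d dvd q \<and> d > 1. cyclotomic (2 * d)) * [:1, 1:] = [:0, 1:] ^ q + 1"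
proof -
  have q: "q > 0" using assms by (auto intro: Nat.gr0I)
  have inj: "inj_on (\<lambda>d::nat. 2 * d) A" for A by (auto simp: inj_on_def)
  have un: "{d. d dvd 2 * q} = {d. d dvd q} \<union> (\<lambda>d. 2 * d) ` {d. d dvd q}"
  proof (intro equalityI subsetI)
    fix d assume "d \<in> {d. d dvd 2 * q}"
    then have d: "d dvd 2 * q" by simp
    show "d \<in> {d. d dvd q} \<union> (\<lambda>d. 2 * d) ` {d. d dvd q}"
    proof (cases "even d")
      case True then obtain c where "d = 2 * c" by blast
      then show ?thesis using d by auto
    next
      case False
      then have "coprime d 2" by simp
      then show ?thesis using d by (simp add: coprime_dvd_mult_right_iff)
    qed
  qed auto
  have disj: "{d. d dvd q} \<inter> (\<lambda>d. 2 * d) ` {d. d dvd q} = {}"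
  proof -
    have "\<not> 2 * c dvd q" for c using assms by (metis dvd_mult_left)
    then show ?thesis by auto
  qed
  have "[:0, 1:] ^ (2 * q) - 1 = (\<Prod>d | d dvd 2 * q. cyclotomic d)"
    using prod_cyclotomic[of "2 * q"] q by simp
  also have "\<dots> = (\<Prod>d | d dvd q. cyclotomic d) * (\<Prod>d | d dvd q. cyclotomic (2 * d))"
    unfolding un using q disj by (subst prod.union_disjoint) (auto simp: prod.reindex[OF inj])
  also have "\<dots> = ([:0, 1:] ^ q - 1) * (\<Prod>d | d dvd q. cyclotomic (2 * d))"
    using prod_cyclotomic[OF q] by simp
  finally have "([:0, 1:] ^ q - 1) * (\<Prod>d | d dvd q. cyclotomic (2 * d)) =
      ([:0, 1:] ^ q - 1) * ([:0, 1:] ^ q + 1)"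
    by (metis (no_types, lifting) power_even_eq square_diff_one_factored mult.commute power2_eq_square)
  moreover have "[:0, 1:] ^ q - 1 \<noteq> (0 :: rat poly)"
    using degree_power_X_minus_1[OF q, where 'a = rat] q by auto
  ultimately have 1: "(\<Prod>d | d dvd q. cyclotomic (2 * d)) = [:0, 1:] ^ q + 1" by simp
  have "(\<Prod>d | d dvd q. cyclotomic (2 * d)) = cyclotomic (2 * 1) * (\<Prod>d | d dvd q \<and> d > 1. cyclotomic (2 * d))"
  proof -
    have "{d. d dvd q} - {1} = {d. d dvd q \<and> d > 1}" using q by (auto intro: Nat.gr0I simp: neq_iff)
    then show ?thesis using q by (subst prod.remove[of _ 1]) auto
  qed
  moreover have "cyclotomic 2 = [:1, 1:]"
  proof -
    have "d dvd 2 \<longleftrightarrow> d = 1 \<or> d = 2" for d :: nat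
      using two_is_prime_nat by (metis dvd_refl one_dvd prime_nat_iff)
    then have "{d::nat. d dvd 2} = {1, 2}" by auto
    then have "cyclotomic 1 * cyclotomic 2 = [:0, 1:] ^ 2 - 1" using prod_cyclotomic[of 2] by simp
    moreover have "cyclotomic 1 = [:0, 1:] - 1" using prod_cyclotomic[of 1] by simp
    ultimately have "([:0, 1:] - 1) * cyclotomic 2 = ([:0, 1:] - 1) * [:1, 1:]"
      by (simp add: power2_eq_square one_pCons)
    moreover have "[:0, 1:] - 1 \<noteq> (0 :: rat poly)" by (simp add: one_pCons)
    ultimately show ?thesis by (metis mult_cancel_left)
  qed
  ultimately show ?thesis using 1 by (metis mult.commute nat_mult_1_right)
qed

section \<open>Monic division modulo a constant, and congruences modulo an ideal\<close>

text \<open>Uniqueness of division with remainder by a monic polynomial, modulo the constant \<open>c\<close>: if the remainder \<open>r\<close>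
has small degree, the top coefficient of \<open>b * p + r\<close> is that of \<open>b\<close>, so \<open>c\<close> divides it; subtracting
the leading term lowers the degree of \<open>b\<close>.\<close>

lemma const_dvd_monic_mult_add:
  fixes p r b :: "'a::idom poly"
  assumes "Polynomial.lead_coeff p = 1" "r = 0 \<or> Polynomial.degree r < Polynomial.degree p"
    and "[:c:] dvd b * p + r"
  shows "[:c:] dvd b"
  using assms(3)
proof (induction "Polynomial.degree b" arbitrary: b rule: less_induct)
  case less
  let ?n = "Polynomial.degree b"
  have "Polynomial.coeff r (?n + Polynomial.degree p) = 0"
    using assms(2) by (auto intro: coeff_eq_0)
  then have "Polynomial.coeff (b * p + r) (?n + Polynomial.degree p) = Polynomial.lead_coeff b"
    using assms(1) by (simp add: coeff_mult_degree_sum)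
  then have c: "c dvd Polynomial.lead_coeff b"
    using less.prems by (metis const_poly_dvd_iff)
  show ?case
  proof (cases "?n = 0")
    case True
    then obtain b0 where "b = [:b0:]" by (rule degree_eq_zeroE)
    then show ?thesis using c by simp
  next
    case False
    define t where "t = Polynomial.monom (Polynomial.lead_coeff b) ?n"
    have t: "[:c:] dvd t" using c by (simp add: t_def const_poly_dvd_iff coeff_monom)
    have "Polynomial.degree (b - t) < ?n"
    proof (rule degree_lessI)
      show "b - t \<noteq> 0 \<or> 0 < ?n" using False by simp
      show "\<forall>k\<ge>?n. Polynomial.coeff (b - t) k = 0" by (auto simp: t_def coeff_eq_0)
    qed
    moreover have "[:c:] dvd (b - t) * p + r"
      using dvd_diff[OF less.prems dvd_mult2[OF t, of p]] by (simp add: algebra_simps)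
    ultimately have "[:c:] dvd b - t" using less.hyps by blast
    then show ?thesis using t by (metis dvd_add diff_add_cancel)
  qed
qed

lemma const_dvd_monic_cancel:
  fixes p b :: "'a::idom poly"
  assumes "Polynomial.lead_coeff p = 1" "[:c:] dvd p * b"
  shows "[:c:] dvd b"
  using const_dvd_monic_mult_add[of p 0 c b] assms by (simp add: mult.commute)

lemma ring_of_type_algebra_simps [simp]:
  "carrier ring_of_type_algebra = UNIV"
  "x \<otimes>\<^bsub>ring_of_type_algebra\<^esub> y = x * y"
  "x \<oplus>\<^bsub>ring_of_type_algebra\<^esub> y = x + y"
  "\<one>\<^bsub>ring_of_type_algebra\<^esub> = 1"
  "\<zero>\<^bsub>ring_of_type_algebra\<^esub> = 0"
  by (simp_all add: ring_of_type_algebra_def)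

lemma ring_of_type_algebra_minus [simp]:
  fixes x y :: "'a::comm_ring_1"
  shows "\<ominus>\<^bsub>ring_of_type_algebra\<^esub> x = - x" "x \<ominus>\<^bsub>ring_of_type_algebra\<^esub> y = x - y"
proof -
  interpret cring "ring_of_type_algebra :: 'a ring" by (rule cring_from_type_algebra)
  show 1: "\<ominus>\<^bsub>ring_of_type_algebra\<^esub> x = - x" for x :: 'a by (rule minus_equality) auto
  show "x \<ominus>\<^bsub>ring_of_type_algebra\<^esub> y = x - y" unfolding a_minus_def by (simp add: 1)
qed

text \<open>Ideals are sets of elements of a type, so that their members are handled with type class arithmetic.
Computing modulo \<open>\<Phi>\<close> in \<open>\<rat>[x,y]\<close> below means computing modulo an arbitrary such ideal that contains the
constant polynomial \<open>[:\<Phi>:]\<close>.\<close>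

abbreviation type_ideal :: "'a::comm_ring_1 set \<Rightarrow> bool" where
  "type_ideal S \<equiv> ideal S ring_of_type_algebra"

lemma type_idealI:
  fixes S :: "'a::comm_ring_1 set"
  assumes "0 \<in> S" "\<And>a b. a \<in> S \<Longrightarrow> b \<in> S \<Longrightarrow> a + b \<in> S" "\<And>r a. a \<in> S \<Longrightarrow> r * a \<in> S"
  shows "type_ideal S"
proof (rule idealI)
  interpret cring "ring_of_type_algebra :: 'a ring" by (rule cring_from_type_algebra)
  show "ring (ring_of_type_algebra :: 'a ring)" by (rule ring_axioms)
  show "subgroup S (add_monoid ring_of_type_algebra)"
  proof (rule add.subgroupI)
    show "\<ominus>\<^bsub>ring_of_type_algebra\<^esub> a \<in> S" if "a \<in> S" for a using assms(3)[OF that, of "- 1"] by simp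
  qed (use assms in auto)
  show "a \<otimes>\<^bsub>ring_of_type_algebra\<^esub> x \<in> S" if "a \<in> S" for a x :: 'a
    using assms(3)[OF that, of x] by (simp add: mult.commute)
qed (use assms in auto)

lemma
  fixes S :: "'a::comm_ring_1 set"
  assumes "type_ideal S"
  shows type_ideal_0: "0 \<in> S"
    and type_ideal_add: "a \<in> S \<Longrightarrow> b \<in> S \<Longrightarrow> a + b \<in> S"
    and type_ideal_mult: "a \<in> S \<Longrightarrow> r * a \<in> S"
    and type_ideal_mult2: "a \<in> S \<Longrightarrow> a * r \<in> S"
    and type_ideal_uminus: "a \<in> S \<Longrightarrow> - a \<in> S"
    and type_ideal_diff: "a \<in> S \<Longrightarrow> b \<in> S \<Longrightarrow> a - b \<in> S"
    and type_ideal_dvd: "a \<in> S \<Longrightarrow> a dvd b \<Longrightarrow> b \<in> S"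
    and type_ideal_cong: "a - b \<in> S \<Longrightarrow> a \<in> S \<longleftrightarrow> b \<in> S"
proof -
  interpret ideal S "ring_of_type_algebra :: 'a ring" by (rule assms)
  show z: "0 \<in> S" using additive_subgroup.zero_closed[OF additive_subgroup_axioms] by simp
  show add: "a \<in> S \<Longrightarrow> b \<in> S \<Longrightarrow> a + b \<in> S" for a b
    using additive_subgroup.a_closed[OF additive_subgroup_axioms] by simp
  show mult: "a \<in> S \<Longrightarrow> r * a \<in> S" for a r using I_l_closed[of a r] by simp
  then show "a \<in> S \<Longrightarrow> a * r \<in> S" for a r by (metis mult.commute)
  show um: "a \<in> S \<Longrightarrow> - a \<in> S" for a using mult[of a "- 1"] by simp
  show diff: "a \<in> S \<Longrightarrow> b \<in> S \<Longrightarrow> a - b \<in> S" for a b using add[of a "- b"] um by simp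
  show "a \<in> S \<Longrightarrow> a dvd b \<Longrightarrow> b \<in> S" using mult by (auto simp: dvd_def mult.commute[of a])
  show "a - b \<in> S \<Longrightarrow> a \<in> S \<longleftrightarrow> b \<in> S" using add[of "a - b" b] diff[of a "a - b"] by auto
qed

lemma type_ideal_cong_mult:
  assumes "type_ideal S" "a - b \<in> S" "c - d \<in> S"
  shows "a * c - b * d \<in> S"
proof -
  have "a * c - b * d = c * (a - b) + b * (c - d)" by (simp add: algebra_simps)
  then show ?thesis
    using assms by (metis type_ideal_add type_ideal_mult)
qed

lemma type_ideal_cong_power:
  assumes "type_ideal S" "a - b \<in> S"
  shows "a ^ n - b ^ n \<in> S"
  by (induction n) (use assms in \<open>auto intro: type_ideal_cong_mult simp: type_ideal_0\<close>)

text \<open>Multiply \<open>y\<^bsup>um\<^esup> \<equiv> x\<^bsup>um\<^esup>\<close> by \<open>x\<^bsup>wk\<^esup>\<close>, and remove \<open>(xy)\<^bsup>wk\<^esup> \<equiv> 1\<close> from the left-hand side. The Bezout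
relation has the form \<open>um = g + wk\<close>, that is \<open>v = -w\<close>, so that all exponents are natural numbers.\<close>

lemma bezout_power_cong:
  fixes x y :: "'a::comm_ring_1"
  assumes S: "type_ideal S" and k: "(x * y) ^ k - 1 \<in> S" and m: "y ^ m - x ^ m \<in> S"
    and bez: "u * m = g + w * k"
  shows "y ^ g - x ^ (u * m + w * k) \<in> S"
proof -
  have "y ^ (m * u) - x ^ (m * u) \<in> S"
    unfolding power_mult by (rule type_ideal_cong_power[OF S m])
  then have "(y ^ (m * u) - x ^ (m * u)) * x ^ (w * k) \<in> S"
    by (rule type_ideal_mult2[OF S])
  then have 1: "y ^ g * (x * y) ^ (k * w) - x ^ (u * m + w * k) \<in> S"
    unfolding mult.commute[of m u] mult.commute[of k w] bez power_add power_mult_distrib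
    by (simp only: left_diff_distrib right_diff_distrib ac_simps)
  have "((x * y) ^ k) ^ w - 1 ^ w \<in> S" by (rule type_ideal_cong_power[OF S k])
  then have "y ^ g * ((x * y) ^ (k * w) - 1) \<in> S"
    by (intro type_ideal_mult[OF S]) (simp add: power_mult)
  from type_ideal_diff[OF S 1 this] show ?thesis by (simp add: algebra_simps)
qed

text \<open>The last two equations compute the exponent \<open>e = um + wk\<close> times \<open>m/g\<close> and \<open>k/g\<close>; modulo twice the lcm they
are \<open>m\<close> and \<open>-k\<close>. They are the reason why \<open>y\<^sup>g = x\<^sup>e\<close> implies \<open>y\<^sup>m = x\<^sup>m\<close> and \<open>(xy)\<^sup>k = 1\<close> as soon
as \<open>x\<^bsup>2 lcm(m,k)\<^esup> = 1\<close>.\<close>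

lemma bezout_quotients:
  fixes u m g w k :: nat
  assumes g: "g = gcd m k" "g > 0" and bez: "u * m = g + w * k"
  obtains m' k' where "m = g * m'" "k = g * k'" "u * m' = 1 + w * k'" "lcm m k = k * m'"
    "(u * m + w * k) * m' = m + 2 * (w * lcm m k)" "(u * m + w * k) * k' + k = 2 * (u * lcm m k)"
proof -
  obtain m' k' where m': "m = g * m'" and k': "k = g * k'"
    using g(1) by (metis gcd_dvd1 gcd_dvd2 dvdE)
  have L: "lcm m k = k * m'"
  proof -
    have "g * lcm m k = g * (k * m')"
      using prod_gcd_lcm_nat[of m k] m' unfolding g(1)[symmetric] by (metis mult.assoc mult.commute)
    then show ?thesis using g(2) by (metis mult_left_cancel neq0_conv)
  qed
  have b: "u * m' = 1 + w * k'"
  proof -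
    have "g * (u * m') = g * (1 + w * k')"
      using bez m' k' by (metis distrib_left mult.left_commute mult.right_neutral)
    then show ?thesis using g(2) by (metis mult_left_cancel neq0_conv)
  qed
  have L2: "lcm m k = m * k'" unfolding L using m' k' by (metis mult.assoc mult.commute)
  have em: "(u * m + w * k) * m' = m + 2 * (w * lcm m k)"
  proof -
    have "(u * m + w * k) * m' = m * (u * m') + w * (k * m')" by (simp add: algebra_simps)
    also have "\<dots> = m + w * (m * k') + w * (k * m')" unfolding b by (simp add: algebra_simps)
    finally show ?thesis unfolding L[symmetric] L2[symmetric] by simp
  qed
  have ek: "(u * m + w * k) * k' + k = 2 * (u * lcm m k)"
  proof -
    have "(u * m + w * k) * k' + k = u * (m * k') + k * (1 + w * k')" by (simp add: algebra_simps)
    also have "\<dots> = u * (m * k') + u * (k * m')" unfolding b[symmetric] by (simp add: algebra_simps)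
    finally show ?thesis unfolding L[symmetric] L2[symmetric] by simp
  qed
  show ?thesis by (rule that[OF m' k' b L em ek])
qed

text \<open>Raising \<open>y\<^sup>g \<equiv> x\<^sup>e\<close> to the powers \<open>m/g\<close> and \<open>k/g\<close> and comparing with the two hypotheses gives
\<open>x\<^bsup>2wL\<^esup> \<equiv> 1\<close> and \<open>x\<^bsup>2uL\<^esup> \<equiv> 1\<close> for \<open>L = lcm m k\<close>; now use \<open>u (m/g) - w (k/g) = 1\<close>. The power
\<open>x\<^sup>m\<close> is cancelled on the way, which is allowed because \<open>x\<close> has finite order.\<close>

lemma bezout_power_cong_lcm:
  fixes x y :: "'a::comm_ring_1"
  assumes S: "type_ideal S" and k: "(x * y) ^ k - 1 \<in> S" and m: "y ^ m - x ^ m \<in> S"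
    and bez: "u * m = g + w * k" and g: "g = gcd m k" "g > 0"
    and inv: "x ^ N - 1 \<in> S" "N > 0"
  shows "x ^ (2 * lcm m k) - 1 \<in> S"
proof -
  let ?L = "lcm m k" and ?e = "u * m + w * k"
  obtain m' k' where m': "m = g * m'" and k': "k = g * k'" and b: "u * m' = 1 + w * k'"
    and em: "?e * m' = m + 2 * (w * ?L)" and ek: "?e * k' + k = 2 * (u * ?L)"
    by (rule bezout_quotients[OF g bez])
  have P: "y ^ g - x ^ ?e \<in> S" by (rule bezout_power_cong[OF S k m bez])
  have "(y ^ g) ^ m' - (x ^ ?e) ^ m' \<in> S" by (rule type_ideal_cong_power[OF S P])
  then have "y ^ m - x ^ (?e * m') \<in> S" by (simp only: power_mult[symmetric] m'[symmetric])
  from type_ideal_diff[OF S m this] have "x ^ (?e * m') - x ^ m \<in> S" by simp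
  then have 1: "x ^ m * (x ^ (2 * (w * ?L)) - 1) \<in> S" unfolding em by (simp add: power_add algebra_simps)
  have "x ^ (N * m) - 1 \<in> S"
    using type_ideal_cong_power[OF S inv(1), of m] by (simp add: power_mult)
  moreover have "x ^ (N * m) = x ^ ((N - 1) * m) * x ^ m" using inv(2)
    by (metis (no_types, lifting) Suc_diff_1 mult_Suc power_add mult.commute)
  ultimately have inv': "x ^ ((N - 1) * m) * x ^ m - 1 \<in> S" by simp
  have "x ^ ((N - 1) * m) * (x ^ m * (x ^ (2 * (w * ?L)) - 1)) - (x ^ (2 * (w * ?L)) - 1)
     = (x ^ ((N - 1) * m) * x ^ m - 1) * (x ^ (2 * (w * ?L)) - 1)" by (simp add: algebra_simps)
  then have w: "x ^ (2 * (w * ?L)) - 1 \<in> S"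
    using type_ideal_mult[OF S 1] type_ideal_mult2[OF S inv'] type_ideal_cong[OF S] by metis
  have "(y ^ g) ^ k' - (x ^ ?e) ^ k' \<in> S" by (rule type_ideal_cong_power[OF S P])
  then have "y ^ k - x ^ (?e * k') \<in> S" by (simp only: power_mult[symmetric] k'[symmetric])
  then have "x ^ k * (y ^ k - x ^ (?e * k')) \<in> S" by (rule type_ideal_mult[OF S])
  then have "(x * y) ^ k - x ^ (?e * k' + k) \<in> S" by (simp add: algebra_simps power_add power_mult_distrib)
  from type_ideal_diff[OF S k this] have u: "x ^ (2 * (u * ?L)) - 1 \<in> S" unfolding ek by simp
  have "x ^ (2 * (u * ?L) * m') - 1 \<in> S" "x ^ (2 * (w * ?L) * k') - 1 \<in> S"
    using type_ideal_cong_power[OF S u, of m'] type_ideal_cong_power[OF S w, of k']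
    by (simp_all add: power_mult)
  moreover have "2 * (u * ?L) * m' = 2 * ?L + 2 * (w * ?L) * k'"
  proof -
    have "2 * (u * ?L) * m' = 2 * ?L * (u * m')" by (simp add: algebra_simps)
    then show ?thesis unfolding b by (simp add: algebra_simps)
  qed
  ultimately have 2: "x ^ (2 * ?L) * x ^ (2 * (w * ?L) * k') - 1 \<in> S" "x ^ (2 * (w * ?L) * k') - 1 \<in> S"
    by (simp_all add: power_add)
  have "x ^ (2 * ?L) - 1 = (x ^ (2 * ?L) * x ^ (2 * (w * ?L) * k') - 1) - x ^ (2 * ?L) * (x ^ (2 * (w * ?L) * k') - 1)"
    by (simp add: algebra_simps)
  also have "\<dots> \<in> S" by (intro type_ideal_diff[OF S] type_ideal_mult[OF S] 2)
  finally show ?thesis .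
qed

section \<open>The polynomials A, G and H\<close>

lemma x_var_power: "x_var ^ n = [:[:0, 1:] ^ n:]"
  by (simp add: x_var_def poly_const_pow)

lemma G_poly_sum: "G_poly k = (\<Sum>i<k. (x_var * y_var) ^ i)"
proof -
  have "1 - x_var * y_var \<noteq> 0" by (simp add: x_var_def y_var_def one_pCons)
  then show ?thesis
    unfolding G_poly_def one_diff_power_eq by (rule nonzero_mult_div_cancel_left)
qed

lemma H_poly_sum: "H_poly m = (\<Sum>i<m. y_var ^ (m - Suc i) * x_var ^ i)"
proof -
  have "x_var - y_var \<noteq> 0" by (simp add: x_var_def y_var_def)
  then show ?thesis
    unfolding H_poly_def power_diff_sumr2 by (rule nonzero_mult_div_cancel_left)
qed

lemma G_poly_mult: "(1 - x_var * y_var) * G_poly k = 1 - (x_var * y_var) ^ k"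
  unfolding G_poly_sum by (rule one_diff_power_eq[symmetric])

lemma H_poly_mult: "(x_var - y_var) * H_poly m = x_var ^ m - y_var ^ m"
  unfolding H_poly_sum by (rule power_diff_sumr2[symmetric])

lemma A_poly_eq_prod_cyclotomic:
  assumes "odd q"
  shows "A_poly q = [:\<Prod>d | d dvd q \<and> d > 1. cyclotomic (2 * d):]"
proof -
  have "1 + x_var ^ q = [:(\<Prod>d | d dvd q \<and> d > 1. cyclotomic (2 * d)) * [:1, 1:]:]"
    unfolding prod_cyclotomic_double[OF assms] by (simp add: x_var_power one_pCons add.commute)
  also have "\<dots> = [:\<Prod>d | d dvd q \<and> d > 1. cyclotomic (2 * d):] * (1 + x_var)"
    by (simp add: x_var_def one_pCons)
  finally have "1 + x_var ^ q = [:\<Prod>d | d dvd q \<and> d > 1. cyclotomic (2 * d):] * (1 + x_var)" .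
  moreover have "1 + x_var \<noteq> 0" by (simp add: x_var_def one_pCons)
  ultimately show ?thesis unfolding A_poly_def by (metis nonzero_mult_div_cancel_right)
qed

section \<open>Units and roots modulo a constant polynomial\<close>

definition unit_mod :: "'a::comm_ring_1 \<Rightarrow> 'a \<Rightarrow> bool" where
  "unit_mod c t \<longleftrightarrow> (\<exists>a. c dvd a * t - 1)"

lemma unit_mod_mult:
  assumes "unit_mod c s" "unit_mod c t"
  shows "unit_mod c (s * t)"
proof -
  obtain a b where "c dvd a * s - 1" "c dvd b * t - 1" using assms by (auto simp: unit_mod_def)
  then have "c dvd (a * s - 1) * (b * t) + (b * t - 1)" by simp
  then have "c dvd (a * b) * (s * t) - 1" by (simp add: algebra_simps)
  then show ?thesis unfolding unit_mod_def by blast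
qed

lemma unit_mod_1: "unit_mod c 1"
  unfolding unit_mod_def by (rule exI[of _ 1]) simp

lemma unit_mod_power: "unit_mod c s \<Longrightarrow> unit_mod c (s ^ n)"
  by (induction n) (auto intro: unit_mod_mult unit_mod_1)

lemma unit_mod_cong:
  assumes "c dvd s - t" "unit_mod c s"
  shows "unit_mod c t"
proof -
  obtain a where a: "c dvd a * s - 1" using assms by (auto simp: unit_mod_def)
  have "a * t - 1 = (a * s - 1) - a * (s - t)" by (simp add: algebra_simps)
  then have "c dvd a * t - 1" using dvd_diff[OF a dvd_mult[OF assms(1), of a]] by metis
  then show ?thesis unfolding unit_mod_def by blast
qed

lemma unit_mod_uminus: "unit_mod c (- s) \<longleftrightarrow> unit_mod c s"
  unfolding unit_mod_def by (metis minus_mult_minus add.inverse_inverse)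

lemma unit_mod_right: "unit_mod c (s * t) \<Longrightarrow> unit_mod c t"
  unfolding unit_mod_def by (metis mult.assoc)

lemma unit_mod_dvd_cancel:
  assumes "unit_mod c s" "c dvd s * t"
  shows "c dvd t"
proof -
  obtain a where "c dvd a * s - 1" using assms by (auto simp: unit_mod_def)
  then have "c dvd a * (s * t) - (a * s - 1) * t" using assms(2) by simp
  then show ?thesis by (simp add: algebra_simps)
qed

text \<open>If \<open>Q(z)\<close> is a unit then \<open>y - z\<close> and \<open>Q\<close> are comaximal, because \<open>Q - Q(z)\<close> is a multiple of \<open>y - z\<close>. Hence
\<open>f\<close> lies in the ideal generated by \<open>(y - z) f\<close> and \<open>Q f\<close>.\<close>

lemma type_ideal_root_comaximal:
  fixes f Q :: "'a::idom poly"
  assumes S: "type_ideal S" and c: "[:c:] \<in> S" and f: "[:- z, 1:] * f \<in> S" "Q * f \<in> S"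
    and unit: "unit_mod c (poly Q z)"
  shows "f \<in> S"
proof -
  obtain a b where ab: "a * poly Q z - 1 = c * b" using unit by (auto simp: unit_mod_def dvd_def)
  let ?D = "synthetic_div Q z"
  have *: "t * f = Q * f - D * (l * f)" if "l * D + t = Q" for l t D :: "'a poly"
    unfolding that[symmetric] by (simp add: algebra_simps)
  have 1: "[:poly Q z:] * f \<in> S"
    unfolding *[OF synthetic_div_correct'[of z Q]]
    by (intro type_ideal_diff[OF S] type_ideal_mult[OF S] f)
  have "[:a:] * ([:poly Q z:] * f) - [:b:] * f * [:c:] \<in> S"
    by (rule type_ideal_diff[OF S type_ideal_mult[OF S 1] type_ideal_mult[OF S c]])
  moreover have "[:a:] * ([:poly Q z:] * f) - [:b:] * f * [:c:] = f"
  proof -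
    have "[:a:] * ([:poly Q z:] * f) - [:b:] * f * [:c:] = [:a * poly Q z - c * b:] * f"
      by (simp add: algebra_simps smult_diff_left)
    also have "a * poly Q z - c * b = 1" using ab by (simp add: algebra_simps)
    finally show ?thesis by simp
  qed
  ultimately show ?thesis by (simp only:)
qed

text \<open>Synthetic division: \<open>P = (y - z) Q + P(z)\<close>, and the remainder vanishes modulo \<open>c\<close>.\<close>

lemma monic_root_factor_mod:
  fixes P :: "'a::idom poly"
  assumes "Polynomial.lead_coeff P = 1" "Polynomial.degree P > 0" "c dvd poly P z"
  obtains Q where "Polynomial.lead_coeff Q = 1" "Polynomial.degree P = Suc (Polynomial.degree Q)"
    "[:c:] dvd [:- z, 1:] * Q - P"
proof
  let ?Q = "synthetic_div P z"
  have eq: "[:- z, 1:] * ?Q + [:poly P z:] = P" by (rule synthetic_div_correct')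
  show d: "Polynomial.degree P = Suc (Polynomial.degree ?Q)"
    using assms(2) by (simp add: degree_synthetic_div)
  have nz: "?Q \<noteq> 0" using assms(2) by (simp add: synthetic_div_eq_0_iff)
  have "Polynomial.lead_coeff ([:poly P z:] + [:- z, 1:] * ?Q) = Polynomial.lead_coeff ([:- z, 1:] * ?Q)"
  proof (rule lead_coeff_add_le)
    have "Polynomial.degree ([:- z, 1:] * ?Q) > 0" using nz by (subst degree_mult_eq) auto
    then show "Polynomial.degree [:poly P z:] < Polynomial.degree ([:- z, 1:] * ?Q)" by simp
  qed
  then have "Polynomial.lead_coeff P = Polynomial.lead_coeff ([:- z, 1:] * ?Q)"
    using eq by (simp only: add.commute)
  then show "Polynomial.lead_coeff ?Q = 1" using assms(1) by (simp only: lead_coeff_mult) simp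
  have "[:- z, 1:] * ?Q - P = - [:poly P z:]" using eq by (metis add_diff_cancel_left' minus_diff_eq)
  then show "[:c:] dvd [:- z, 1:] * ?Q - P" using assms(3) by simp
qed

lemma cyclotomic_coprime_imp_unit_mod:
  assumes "n > 0" "\<not> n dvd N"
  shows "unit_mod (cyclotomic n) ([:0, 1:] ^ N - 1)"
proof -
  obtain a b where "a * cyclotomic n + b * ([:0, 1:] ^ N - 1) = 1"
    using cyclotomic_coprime_power_minus_1[OF assms] by blast
  then have "b * ([:0, 1:] ^ N - 1) - 1 = cyclotomic n * (- a)" by (simp add: algebra_simps)
  then show ?thesis unfolding unit_mod_def by (metis dvd_triv_left)
qed

lemma unit_mod_of_nat: "n > 0 \<Longrightarrow> unit_mod c (of_nat n :: rat poly)"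
  unfolding unit_mod_def by (rule exI[of _ "[:1 / of_nat n:]"]) (simp add: of_nat_poly one_pCons)

lemma const_dvd_cong:
  assumes "type_ideal S" "[:c:] \<in> S" "[:c:] dvd f - h"
  shows "f \<in> S \<longleftrightarrow> h \<in> S"
  using assms type_ideal_cong type_ideal_dvd by metis

lemma const_dvd_const_mult: "c dvd a \<Longrightarrow> [:c:] dvd [:a:] * f" for c :: "'a::idom"
  by (rule dvd_mult2) (simp only: const_poly_dvd_const_poly_iff)

lemma const_dvd_imp_dvd_poly: "[:c:] dvd f \<Longrightarrow> c dvd poly f z" for c :: "'a::comm_ring_1"
  by (auto simp: dvd_def)

section \<open>The gcd of G and H modulo a cyclotomic polynomial\<close>

text \<open>One factor of \<open>A\<close>. The number \<open>w\<close> is minus the Bezout coefficient of \<open>k\<close>, so the exponent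
\<open>e = um - vk\<close> becomes the natural number \<open>um + wk\<close>, and \<open>pow_diff\<close> is \<open>y\<^sup>g - x\<^sup>e\<close>. The element \<open>xi\<close> is
the inverse of \<open>x\<close> modulo \<open>\<Phi>\<close>; it is a positive power of \<open>x\<close> because \<open>x\<close> has order \<open>2\<delta>\<close> there.\<close>

locale pretzel_factor =
  fixes \<delta> k m g u w :: nat
  assumes delta: "\<delta> > 1" and pos: "k > 0" "m > 0"
    and g_def: "g = gcd m k" and bez: "u * m = g + w * k"
begin

abbreviation "\<Phi> \<equiv> cyclotomic (2 * \<delta>)"
definition xx :: "rat poly" where "xx = [:0, 1:]"
definition xi :: "rat poly" where "xi = xx ^ (2 * \<delta> - 1)"
definition e :: nat where "e = u * m + w * k"
definition pow_diff :: "rat poly poly" where "pow_diff = y_var ^ g - [:xx ^ e:]"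

lemma g_pos: "g > 0" using g_def pos by simp

lemma xx_power_mod: "\<delta> dvd N \<Longrightarrow> \<Phi> dvd xx ^ (2 * N) - 1"
  using delta unfolding xx_def by (intro cyclotomic_dvd_power_minus_1) auto

lemma xi_mult: "xi * xx = xx ^ (2 * \<delta>)"
proof -
  have "2 * \<delta> = Suc (2 * \<delta> - 1)" using delta by simp
  then show ?thesis unfolding xi_def by (metis power_Suc2)
qed

lemma xi_inverse: "\<Phi> dvd xi * xx - 1"
  unfolding xi_mult by (rule xx_power_mod) simp

lemma unit_xx: "unit_mod \<Phi> xx"
  using xi_inverse unfolding unit_mod_def by blast

lemma unit_xx_power: "unit_mod \<Phi> (xx ^ n)"
  by (rule unit_mod_power[OF unit_xx])

lemma unit_xx_power_minus_1: "\<not> \<delta> dvd N \<Longrightarrow> unit_mod \<Phi> (xx ^ (2 * N) - 1)"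
  using delta unfolding xx_def by (intro cyclotomic_coprime_imp_unit_mod) auto

lemmas quotients = bezout_quotients[OF g_def g_pos bez, folded e_def]

text \<open>The identity \<open>k = u lcm(m,k) - (k/g) (wk)\<close> is the Bezout relation divided by \<open>g\<close> and multiplied by \<open>k\<close>.
It converts the value of \<open>pow_diff\<close> at \<open>x\<close>, where \<open>wk\<close> appears, into the condition that \<open>\<delta>\<close> divides \<open>k\<close>.\<close>

lemma dvd_w_imp_dvd_k:
  assumes "\<delta> dvd lcm m k" "\<delta> dvd w * k"
  shows "\<delta> dvd k"
proof -
  obtain m' k' where b: "u * m' = 1 + w * k'" and L: "lcm m k = k * m'" by (rule quotients)
  have "k = u * (k * m') - k' * (w * k)"
  proof -
    have "u * (k * m') = k * (u * m')" by simp
    also have "\<dots> = k + k' * (w * k)" unfolding b by (simp add: algebra_simps)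
    finally show ?thesis by simp
  qed
  then show ?thesis using assms unfolding L by (metis dvd_diff_nat dvd_mult)
qed

text \<open>The counterpart for the value of \<open>pow_diff\<close> at \<open>x\<inverse>\<close>, from \<open>m = (m/g) (um) - w lcm(m,k)\<close>.\<close>

lemma dvd_u_imp_dvd_m:
  assumes "\<delta> dvd lcm m k" "\<delta> dvd u * m"
  shows "\<delta> dvd m"
proof -
  obtain m' k' where m: "m = g * m'" "k = g * k'" and b: "u * m' = 1 + w * k'" and L: "lcm m k = k * m'"
    by (rule quotients)
  have "m = m' * (u * m) - w * (k * m')"
  proof -
    have "m' * (u * m) = m * (u * m')" by simp
    also have "\<dots> = m + w * (m * k')" unfolding b by (simp add: algebra_simps)
    also have "m * k' = k * m'" using m by (metis mult.assoc mult.commute)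
    finally show ?thesis by simp
  qed
  then show ?thesis using assms unfolding L by (metis dvd_diff_nat dvd_mult)
qed

lemma pow_diff_at_xx: "poly pow_diff xx = - (xx ^ g * (xx ^ (2 * (w * k)) - 1))"
proof -
  have "e = g + 2 * (w * k)" using bez by (simp add: e_def)
  then show ?thesis by (simp add: pow_diff_def y_var_def power_add algebra_simps)
qed

lemma pow_diff_at_xi: "\<Phi> dvd xx ^ g * poly pow_diff xi - - (xx ^ (2 * (u * m)) - 1)"
proof -
  have e: "g + e = 2 * (u * m)" using bez by (simp add: e_def)
  have "xx ^ g * poly pow_diff xi = (xi * xx) ^ g - xx ^ (2 * (u * m))"
    unfolding e[symmetric] by (simp add: pow_diff_def y_var_def power_add algebra_simps power_mult_distrib)
  then have "xx ^ g * poly pow_diff xi - - (xx ^ (2 * (u * m)) - 1) = xx ^ (2 * (\<delta> * g)) - 1"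
    by (simp add: xi_mult power_mult[symmetric] mult.assoc)
  then show ?thesis using xx_power_mod[of "\<delta> * g"] by (simp only: dvd_triv_left)
qed

lemma pow_diff_root_xx: "\<delta> dvd k \<Longrightarrow> \<Phi> dvd poly pow_diff xx"
  unfolding pow_diff_at_xx by (simp add: xx_power_mod)

lemma pow_diff_root_xi:
  assumes "\<delta> dvd m"
  shows "\<Phi> dvd poly pow_diff xi"
proof (rule unit_mod_dvd_cancel[OF unit_xx_power[of g]])
  have "\<Phi> dvd - (xx ^ (2 * (u * m)) - 1)" using assms by (simp only: dvd_minus_iff xx_power_mod dvd_mult)
  from dvd_add[OF pow_diff_at_xi this] show "\<Phi> dvd xx ^ g * poly pow_diff xi" by simp
qed

lemma pow_diff_unit_xx:
  assumes "\<delta> dvd lcm m k" "\<not> \<delta> dvd k"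
  shows "unit_mod \<Phi> (poly pow_diff xx)"
  unfolding pow_diff_at_xx unit_mod_uminus
  using assms dvd_w_imp_dvd_k by (intro unit_mod_mult unit_xx_power unit_xx_power_minus_1) blast

lemma pow_diff_unit_xi:
  assumes "\<delta> dvd lcm m k" "\<not> \<delta> dvd m"
  shows "unit_mod \<Phi> (poly pow_diff xi)"
proof (rule unit_mod_right)
  have "unit_mod \<Phi> (- (xx ^ (2 * (u * m)) - 1))"
    unfolding unit_mod_uminus using assms dvd_u_imp_dvd_m by (intro unit_xx_power_minus_1) blast
  then show "unit_mod \<Phi> (xx ^ g * poly pow_diff xi)"
    by (rule unit_mod_cong[OF iffD1[OF dvd_diff_commute pow_diff_at_xi]])
qed

text \<open>\<open>H(x,x) = m x\<^bsup>m-1\<^esup>\<close>, and \<open>m\<close> is invertible in characteristic zero.\<close>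

lemma H_at_xx: "unit_mod \<Phi> (poly (H_poly m) xx)"
proof -
  have "poly (H_poly m) xx = (\<Sum>i<m. xx ^ (m - 1))"
    unfolding H_poly_sum poly_sum
  proof (rule sum.cong)
    fix i assume "i \<in> {..<m}"
    then have "m - Suc i + i = m - 1" by auto
    then show "poly (y_var ^ (m - Suc i) * x_var ^ i) xx = xx ^ (m - 1)"
      by (simp add: x_var_def y_var_def xx_def[symmetric] flip: power_add)
  qed simp
  also have "\<dots> = of_nat m * xx ^ (m - 1)" by simp
  finally show ?thesis using pos by (simp only: unit_mod_mult unit_mod_of_nat unit_xx_power)
qed

text \<open>\<open>G(x,x\<inverse>)\<close> is a sum of \<open>k\<close> ones.\<close>

lemma G_at_xi: "unit_mod \<Phi> (poly (G_poly k) xi)"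
proof (rule unit_mod_cong)
  have "\<Phi> dvd (xi * xx) ^ i - 1" for i
    using xx_power_mod[of "\<delta> * i"] by (simp add: xi_mult power_mult[symmetric] mult.assoc)
  then have "\<Phi> dvd (\<Sum>i<k. (xi * xx) ^ i - 1)" by (intro dvd_sum) auto
  moreover have "poly (G_poly k) xi = (\<Sum>i<k. (xi * xx) ^ i)"
    unfolding G_poly_sum poly_sum by (simp add: x_var_def y_var_def xx_def[symmetric] mult.commute del: mult_pCons_left mult_pCons_right)
  ultimately have "\<Phi> dvd poly (G_poly k) xi - of_nat k" by (simp add: sum_subtractf)
  then show "\<Phi> dvd of_nat k - poly (G_poly k) xi" by (simp add: dvd_diff_commute)
  show "unit_mod \<Phi> (of_nat k)" using pos by (simp add: unit_mod_of_nat)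
qed

text \<open>\<open>x\<close> and \<open>x\<inverse>\<close> differ by a unit, as \<open>x (x\<inverse> - x) = 1 - x\<^sup>2\<close> and \<open>\<delta> > 1\<close>. So when both are roots of
\<open>pow_diff\<close>, both linear factors can be split off.\<close>

lemma unit_xi_minus_xx: "unit_mod \<Phi> (xi - xx)"
proof (rule unit_mod_right)
  have "\<not> \<delta> dvd 1" using delta by auto
  then have "unit_mod \<Phi> (- (xx ^ (2 * 1) - 1))" unfolding unit_mod_uminus by (rule unit_xx_power_minus_1)
  moreover have "- (xx ^ (2 * 1) - 1) - xx * (xi - xx) = - (xi * xx - 1)"
    by (simp add: power2_eq_square algebra_simps)
  moreover have "\<Phi> dvd - (xi * xx - 1)" using xi_inverse by (simp only: dvd_minus_iff)
  ultimately show "unit_mod \<Phi> (xx * (xi - xx))"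
    using unit_mod_cong[of \<Phi> "- (xx ^ (2 * 1) - 1)"] by (simp only:)
qed

lemma x_var_xx: "x_var = [:xx:]"
  by (simp add: x_var_def xx_def)

lemma H_poly_lin: "[:- xx, 1:] * H_poly m = y_var ^ m - x_var ^ m"
proof -
  have "[:- xx, 1:] * H_poly m = - ((x_var - y_var) * H_poly m)"
    unfolding mult_minus_left[symmetric] by (simp add: x_var_xx y_var_def)
  then show ?thesis unfolding H_poly_mult by simp
qed

lemma G_poly_lin: "[:\<Phi>:] dvd [:- xi, 1:] * (x_var * G_poly k) - ((x_var * y_var) ^ k - 1)"
proof -
  have 1: "[:- xi, 1:] * x_var = x_var * y_var - [:xi * xx:]"
    by (simp add: x_var_xx y_var_def)
  have "[:- xi, 1:] * (x_var * G_poly k) = ([:- xi, 1:] * x_var) * G_poly k"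
    by (simp only: mult.assoc)
  also have "\<dots> = (x_var * y_var) * G_poly k - [:xi * xx:] * G_poly k"
    unfolding 1 by (simp only: left_diff_distrib)
  also have "(x_var * y_var) * G_poly k = ((x_var * y_var) ^ k - 1) + G_poly k"
    using G_poly_mult[of k] by (simp add: algebra_simps)
  finally have "[:- xi, 1:] * (x_var * G_poly k) - ((x_var * y_var) ^ k - 1) = [:1 - xi * xx:] * G_poly k"
    by (simp add: smult_diff_left)
  moreover have "\<Phi> dvd 1 - xi * xx" using xi_inverse by (simp only: dvd_diff_commute)
  ultimately show ?thesis by (simp only: const_dvd_const_mult)
qed

lemma pow_diff_H: "\<delta> dvd lcm m k \<Longrightarrow> \<exists>C. [:\<Phi>:] dvd (y_var ^ m - x_var ^ m) - pow_diff * C"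
proof -
  assume L: "\<delta> dvd lcm m k"
  obtain m' k' where m': "m = g * m'" and em: "e * m' = m + 2 * (w * lcm m k)"
    by (rule quotients)
  let ?C = "\<Sum>i<m'. [:xx ^ e:] ^ (m' - Suc i) * (y_var ^ g) ^ i"
  have "pow_diff * ?C = (y_var ^ g) ^ m' - [:xx ^ e:] ^ m'"
    unfolding pow_diff_def by (rule power_diff_sumr2[symmetric])
  also have "\<dots> = y_var ^ m - [:xx ^ (e * m'):]"
    by (simp only: m' power_mult poly_const_pow)
  finally have "(y_var ^ m - x_var ^ m) - pow_diff * ?C = [:xx ^ (e * m') - xx ^ m:]"
    by (simp add: x_var_xx poly_const_pow)
  moreover have "xx ^ (e * m') - xx ^ m = xx ^ m * (xx ^ (2 * (w * lcm m k)) - 1)"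
    unfolding em by (simp add: power_add algebra_simps)
  moreover have "\<Phi> dvd xx ^ (2 * (w * lcm m k)) - 1" using L by (intro xx_power_mod) simp
  ultimately have "[:\<Phi>:] dvd (y_var ^ m - x_var ^ m) - pow_diff * ?C"
    by (simp only: const_poly_dvd_const_poly_iff dvd_mult)
  then show ?thesis by blast
qed

lemma pow_diff_G: "\<delta> dvd lcm m k \<Longrightarrow> \<exists>C. [:\<Phi>:] dvd ((x_var * y_var) ^ k - 1) - pow_diff * C"
proof -
  assume L: "\<delta> dvd lcm m k"
  obtain m' k' where k': "k = g * k'" and ek: "e * k' + k = 2 * (u * lcm m k)"
    by (rule quotients)
  let ?C = "\<Sum>i<k'. [:xx ^ e:] ^ (k' - Suc i) * (y_var ^ g) ^ i"
  have "pow_diff * ?C = (y_var ^ g) ^ k' - [:xx ^ e:] ^ k'"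
    unfolding pow_diff_def by (rule power_diff_sumr2[symmetric])
  also have "\<dots> = y_var ^ k - [:xx ^ (e * k'):]"
    by (simp only: k' power_mult poly_const_pow)
  finally have "pow_diff * (?C * x_var ^ k) = (y_var ^ k - [:xx ^ (e * k'):]) * [:xx ^ k:]"
    by (simp only: mult.assoc[symmetric] x_var_xx poly_const_pow)
  also have "\<dots> = (x_var * y_var) ^ k - [:xx ^ (e * k' + k):]"
    by (simp add: left_diff_distrib x_var_xx smult_power power_add smult_diff_right)
  finally have "pow_diff * (?C * x_var ^ k) = (x_var * y_var) ^ k - [:xx ^ (e * k' + k):]" .
  then have "((x_var * y_var) ^ k - 1) - pow_diff * (?C * x_var ^ k) = [:xx ^ (2 * (u * lcm m k)) - 1:]"
    unfolding ek by (simp add: one_pCons)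
  moreover have "\<Phi> dvd xx ^ (2 * (u * lcm m k)) - 1" using L by (intro xx_power_mod) simp
  ultimately have "[:\<Phi>:] dvd ((x_var * y_var) ^ k - 1) - pow_diff * (?C * x_var ^ k)"
    by (simp only: const_poly_dvd_const_poly_iff)
  then show ?thesis by blast
qed

text \<open>Let \<open>R\<close> be \<open>pow_diff\<close> with the factor \<open>y - z\<close> removed if \<open>b\<close> says that \<open>z\<close> is a root. If \<open>pow_diff\<close> divides
\<open>(y - z) Q\<close> then \<open>R\<close> divides \<open>Q\<close>: when \<open>z\<close> is a root, cancel the monic \<open>y - z\<close>; otherwise \<open>y - z\<close> is
comaximal to \<open>pow_diff\<close>. It is applied with \<open>Q = H\<close>, \<open>z = x\<close> and with \<open>Q = x G\<close>, \<open>z = x\<inverse>\<close>.\<close>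

lemma mem_of_linear_factor:
  assumes S: "type_ideal S" and c: "[:\<Phi>:] \<in> S"
    and Q: "[:\<Phi>:] dvd [:- z, 1:] * Q - pow_diff * C"
    and R: "[:\<Phi>:] dvd [:- z, 1:] ^ of_bool b * R - pow_diff" "R \<in> S"
    and unit: "\<not> b \<Longrightarrow> unit_mod \<Phi> (poly pow_diff z)"
  shows "Q \<in> S"
proof (cases b)
  case True
  define l where "l = [:- z, 1:]"
  have "[:\<Phi>:] dvd l * R - pow_diff" using R(1) True by (simp only: l_def of_bool_eq power_one_right)
  from dvd_diff[OF Q[folded l_def] dvd_mult2[OF this, of C]]
  have "[:\<Phi>:] dvd l * (Q - R * C)" by (simp add: algebra_simps)
  then have "[:\<Phi>:] dvd Q - R * C" by (rule const_dvd_monic_cancel[rotated]) (simp add: l_def)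
  then show ?thesis using const_dvd_cong[OF S c] type_ideal_mult2[OF S R(2)] by blast
next
  case False
  then have "pow_diff \<in> S" using R const_dvd_cong[OF S c R(1)] by simp
  then have "pow_diff * Q \<in> S" "pow_diff * C \<in> S" by (simp_all add: type_ideal_mult2[OF S])
  then show ?thesis
    using type_ideal_root_comaximal[OF S c _ _ unit[OF False]] const_dvd_cong[OF S c Q] by blast
qed

lemma mem_cancel_linear_factor:
  assumes S: "type_ideal S" and c: "[:\<Phi>:] \<in> S" and Q: "Q \<in> S" "unit_mod \<Phi> (poly Q z)"
    and R: "[:- z, 1:] ^ of_bool b * R \<in> S"
  shows "R \<in> S"
proof (cases b)
  case True
  then show ?thesis
    using type_ideal_root_comaximal[OF S c _ _ Q(2), of R] R type_ideal_mult2[OF S Q(1)] by simp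
qed (use R in simp)

lemma pow_diff_mem:
  assumes S: "type_ideal S" and c: "[:\<Phi>:] \<in> S" and GH: "G_poly k \<in> S" "H_poly m \<in> S"
  shows "pow_diff \<in> S" "(x_var * y_var) ^ k - 1 \<in> S" "y_var ^ m - x_var ^ m \<in> S"
proof -
  have "(1 - x_var * y_var) * G_poly k \<in> S" by (rule type_ideal_mult[OF S GH(1)])
  then show k: "(x_var * y_var) ^ k - 1 \<in> S"
    unfolding G_poly_mult using type_ideal_uminus[OF S, of "1 - (x_var * y_var) ^ k"] by simp
  show m: "y_var ^ m - x_var ^ m \<in> S" unfolding H_poly_lin[symmetric] by (rule type_ideal_mult[OF S GH(2)])
  have "y_var ^ g - x_var ^ (u * m + w * k) \<in> S" by (rule bezout_power_cong[OF S k m bez])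
  then show "pow_diff \<in> S" by (simp add: pow_diff_def e_def x_var_xx poly_const_pow)
qed

text \<open>The ideal contains \<open>x\<^bsup>2 lcm(m,k)\<^esup> - 1\<close>, which is a unit modulo \<open>\<Phi>\<close>.\<close>

lemma one_mem_if_not_dvd_lcm:
  assumes S: "type_ideal S" and c: "[:\<Phi>:] \<in> S" and GH: "G_poly k \<in> S" "H_poly m \<in> S"
    and L: "\<not> \<delta> dvd lcm m k"
  shows "1 \<in> S"
proof -
  note GH' = pow_diff_mem[OF S c GH]
  have "[:\<Phi>:] dvd x_var ^ (2 * \<delta>) - 1"
    using xx_power_mod[of \<delta>] by (simp add: x_var_xx poly_const_pow one_pCons)
  then have "x_var ^ (2 * lcm m k) - 1 \<in> S"
    using bezout_power_cong_lcm[OF S GH'(2,3) bez g_def g_pos, of "2 * \<delta>"] delta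
      type_ideal_dvd[OF S c] by auto
  then have *: "[:xx ^ (2 * lcm m k) - 1:] \<in> S" by (simp add: x_var_xx poly_const_pow one_pCons)
  define t where "t = xx ^ (2 * lcm m k) - 1"
  obtain a b where ab: "a * t - 1 = \<Phi> * b"
    using unit_xx_power_minus_1[OF L] by (auto simp: unit_mod_def dvd_def t_def)
  have "[:a:] * [:t:] - [:b:] * [:\<Phi>:] \<in> S"
    by (rule type_ideal_diff[OF S type_ideal_mult[OF S *[folded t_def]] type_ideal_mult[OF S c]])
  moreover have "[:a:] * [:t:] - [:b:] * [:\<Phi>:] = [:a * t - b * \<Phi>:]" by simp
  moreover have "a * t - b * \<Phi> = 1" using ab by (simp add: algebra_simps)
  ultimately show ?thesis by (simp only: one_pCons)
qed

lemma monic_pow_diff: "Polynomial.degree pow_diff = g" "Polynomial.lead_coeff pow_diff = 1"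
proof -
  have p: "pow_diff = Polynomial.monom 1 g + [:- (xx ^ e):]"
    by (simp add: pow_diff_def y_var_def x_as_monom monom_power)
  have "Polynomial.degree [:- (xx ^ e):] < Polynomial.degree (Polynomial.monom (1 :: rat poly) g)"
    using g_pos by (simp add: degree_monom_eq)
  then show d: "Polynomial.degree pow_diff = g"
    unfolding p by (subst degree_add_eq_left) (simp_all add: degree_monom_eq)
  show "Polynomial.lead_coeff pow_diff = 1"
    unfolding d unfolding p using g_pos by (cases g) simp_all
qed

text \<open>The factors \<open>y - x\<close> and \<open>y - x\<inverse>\<close> are split off one after the other. If both occur, \<open>x\<inverse>\<close> is still a root
after the first step because \<open>x\<inverse> - x\<close> is a unit.\<close>

lemma exists_monic_factorization:
  assumes L: "\<delta> dvd lcm m k"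
  obtains p where "Polynomial.lead_coeff p = 1"
    "Polynomial.degree p + of_bool (\<delta> dvd k) + of_bool (\<delta> dvd m) = g"
    "[:\<Phi>:] dvd [:- xx, 1:] ^ of_bool (\<delta> dvd k) * ([:- xi, 1:] ^ of_bool (\<delta> dvd m) * p) - pow_diff"
proof -
  obtain P1 where P1: "Polynomial.lead_coeff P1 = 1"
    "Polynomial.degree P1 + of_bool (\<delta> dvd k) = g"
    "[:\<Phi>:] dvd [:- xx, 1:] ^ of_bool (\<delta> dvd k) * P1 - pow_diff"
  proof (cases "\<delta> dvd k")
    case True
    have "Polynomial.degree pow_diff > 0" using monic_pow_diff g_pos by simp
    then obtain Q where "Polynomial.lead_coeff Q = 1" "Polynomial.degree pow_diff = Suc (Polynomial.degree Q)"
      "[:\<Phi>:] dvd [:- xx, 1:] * Q - pow_diff"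
      using monic_root_factor_mod[OF monic_pow_diff(2) _ pow_diff_root_xx[OF True]] by blast
    then show ?thesis using that[of Q] True monic_pow_diff by simp
  qed (use that[of pow_diff] monic_pow_diff in simp)
  show ?thesis
  proof (cases "\<delta> dvd m")
    case True
    have root: "\<Phi> dvd poly P1 xi"
    proof (cases "\<delta> dvd k")
      case True
      have *: "\<Phi> dvd poly ([:- xx, 1:] * P1 - pow_diff) xi"
        using P1(3) True by (intro const_dvd_imp_dvd_poly) simp
      have **: "poly ([:- xx, 1:] * P1 - pow_diff) xi = (xi - xx) * poly P1 xi - poly pow_diff xi"
        by (simp add: left_diff_distrib)
      have "\<Phi> dvd (xi - xx) * poly P1 xi - poly pow_diff xi + poly pow_diff xi"
        using * pow_diff_root_xi[OF \<open>\<delta> dvd m\<close>] unfolding ** by (rule dvd_add)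
      then show ?thesis
        unfolding diff_add_cancel by (rule unit_mod_dvd_cancel[OF unit_xi_minus_xx])
    next
      case False
      have "\<Phi> dvd poly (P1 - pow_diff) xi"
        using P1(3) False by (intro const_dvd_imp_dvd_poly) simp
      then have "\<Phi> dvd poly P1 xi - poly pow_diff xi" by simp
      from dvd_add[OF this pow_diff_root_xi[OF \<open>\<delta> dvd m\<close>]] show ?thesis by simp
    qed
    \<comment> \<open>Two factors fit into degree g: if delta divides both m and k, it divides g, so g is at least 2.\<close>
    have "g \<ge> of_bool (\<delta> dvd k) + 1"
    proof (cases "\<delta> dvd k")
      case True
      then have "\<delta> dvd g" using \<open>\<delta> dvd m\<close> by (simp add: g_def)
      then have "\<delta> \<le> g" using g_pos by (intro dvd_imp_le)
      then show ?thesis using delta by simp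
    qed (use g_pos in simp)
    then have "Polynomial.degree P1 > 0" using P1(2) by simp
    then obtain p where p: "Polynomial.lead_coeff p = 1" "Polynomial.degree P1 = Suc (Polynomial.degree p)"
      "[:\<Phi>:] dvd [:- xi, 1:] * p - P1"
      using monic_root_factor_mod[OF P1(1) _ root] by blast
    show ?thesis
    proof (rule that[of p])
      let ?B = "[:- xx, 1:] ^ of_bool (\<delta> dvd k)"
      have "[:\<Phi>:] dvd ?B * ([:- xi, 1:] * p - P1) + (?B * P1 - pow_diff)"
        using P1(3) p(3) by (intro dvd_add dvd_mult)
      then show "[:\<Phi>:] dvd ?B * ([:- xi, 1:] ^ of_bool (\<delta> dvd m) * p) - pow_diff"
        using True by (simp only: right_diff_distrib) simp
    qed (use p P1 True in simp_all)
  qed (use that[of P1] P1 in simp)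
qed

text \<open>Quantified over all ideals \<open>S\<close> that contain \<open>\<Phi>\<close>, this is the equality of \<open>\<langle>\<Phi>, p\<rangle>\<close> and
\<open>\<langle>\<Phi>, G, H\<rangle>\<close>. The form is chosen because it is used for different \<open>S\<close>: the ideals \<open>\<langle>\<Phi>, f\<rangle>\<close> make \<open>p\<close> the
greatest common divisor, and \<open>I + \<langle>\<Phi>\<rangle>\<close> recovers \<open>I\<close> as an intersection.\<close>

lemma mem_iff_monic_factor_mem:
  assumes L: "\<delta> dvd lcm m k"
    and p: "[:\<Phi>:] dvd [:- xx, 1:] ^ of_bool (\<delta> dvd k) * ([:- xi, 1:] ^ of_bool (\<delta> dvd m) * p) - pow_diff"
    and S: "type_ideal S" and c: "[:\<Phi>:] \<in> S"
  shows "p \<in> S \<longleftrightarrow> G_poly k \<in> S \<and> H_poly m \<in> S"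
proof
  let ?Bk = "[:- xx, 1:] ^ of_bool (\<delta> dvd k)" and ?Bm = "[:- xi, 1:] ^ of_bool (\<delta> dvd m)"
  have p': "[:\<Phi>:] dvd ?Bm * (?Bk * p) - pow_diff" using p by (simp only: mult.left_commute)
  show "G_poly k \<in> S \<and> H_poly m \<in> S" if mem: "p \<in> S"
  proof
    obtain C where "[:\<Phi>:] dvd (y_var ^ m - x_var ^ m) - pow_diff * C" using pow_diff_H[OF L] by blast
    then have "[:\<Phi>:] dvd [:- xx, 1:] * H_poly m - pow_diff * C" unfolding H_poly_lin .
    then show "H_poly m \<in> S"
      by (rule mem_of_linear_factor[OF S c _ p type_ideal_mult[OF S mem] pow_diff_unit_xx[OF L]])
    obtain C where "[:\<Phi>:] dvd ((x_var * y_var) ^ k - 1) - pow_diff * C" using pow_diff_G[OF L] by blast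
    moreover have "a - b + (b - d) = a - d" for a b d :: "rat poly poly" by simp
    ultimately have "[:\<Phi>:] dvd [:- xi, 1:] * (x_var * G_poly k) - pow_diff * C"
      using dvd_add[OF G_poly_lin] by metis
    then have "x_var * G_poly k \<in> S"
      by (rule mem_of_linear_factor[OF S c _ p' type_ideal_mult[OF S mem] pow_diff_unit_xi[OF L]])
    then have "[:xi:] * (x_var * G_poly k) \<in> S" by (rule type_ideal_mult[OF S])
    moreover have "[:\<Phi>:] dvd [:xi:] * (x_var * G_poly k) - G_poly k"
    proof -
      have "[:xi:] * (x_var * G_poly k) - G_poly k = [:xi * xx - 1:] * G_poly k"
        by (simp add: x_var_xx smult_diff_left mult.commute)
      then show ?thesis using xi_inverse by (simp only: const_dvd_const_mult)
    qed
    ultimately show "G_poly k \<in> S" using const_dvd_cong[OF S c] by blast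
  qed
  show "p \<in> S" if GH: "G_poly k \<in> S \<and> H_poly m \<in> S"
  proof -
    have "pow_diff \<in> S" using pow_diff_mem[OF S c] GH by blast
    then have "?Bk * (?Bm * p) \<in> S" using const_dvd_cong[OF S c p] by blast
    then have "?Bm * p \<in> S" by (rule mem_cancel_linear_factor[OF S c conjunct2[OF GH] H_at_xx])
    then show ?thesis by (rule mem_cancel_linear_factor[OF S c conjunct1[OF GH] G_at_xi])
  qed
qed

end

section \<open>The embedding into Laurent polynomials\<close>

lemma genideal_eqI:
  assumes "\<And>J :: 'a::comm_ring_1 set. type_ideal J \<Longrightarrow> A \<subseteq> J \<longleftrightarrow> B \<subseteq> J"
  shows "Idl\<^bsub>ring_of_type_algebra\<^esub> A = Idl\<^bsub>ring_of_type_algebra\<^esub> B"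
  using assms unfolding genideal_def by blast

lemma type_ideal_genideal: "type_ideal (Idl\<^bsub>ring_of_type_algebra\<^esub> A)" for A :: "'a::comm_ring_1 set"
  by (rule ring.genideal_ideal[OF ring_from_type_algebra]) simp

lemma genideal_minimal_type:
  "type_ideal J \<Longrightarrow> A \<subseteq> J \<Longrightarrow> Idl\<^bsub>ring_of_type_algebra\<^esub> A \<subseteq> J" for A :: "'a::comm_ring_1 set"
  by (rule ring.genideal_minimal[OF ring_from_type_algebra])

lemma genideal_self_type: "A \<subseteq> Idl\<^bsub>ring_of_type_algebra\<^esub> A" for A :: "'a::comm_ring_1 set"
  by (rule ring.genideal_self[OF ring_from_type_algebra]) simp

abbreviation L_x :: laurent where "L_x \<equiv> Poly_Mapping.single (0, 1) 1"
abbreviation L_y :: laurent where "L_y \<equiv> Poly_Mapping.single (1, 0) 1"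
abbreviation L_xi :: laurent where "L_xi \<equiv> Poly_Mapping.single (0, - 1) 1"
abbreviation L_const :: "rat \<Rightarrow> laurent" where "L_const \<equiv> Poly_Mapping.single 0"

lemma L_x_power: "L_x ^ n = Poly_Mapping.single (0, int n) 1"
  by (induction n) (simp_all add: mult_single zero_prod_def[symmetric] single_one)

lemma L_y_power: "L_y ^ n = Poly_Mapping.single (int n, 0) 1"
  by (induction n) (simp_all add: mult_single zero_prod_def[symmetric] single_one)

lemma L_x_inverse: "L_x * L_xi = 1" "L_xi * L_x = 1"
  by (simp_all add: mult_single zero_prod_def[symmetric] single_one)

interpretation L_const: comm_ring_hom L_const
  by standard (simp_all add: single_add mult_single single_one)

interpretation L_const_poly: map_poly_comm_ring_hom L_const ..

definition L_poly_x :: "rat poly \<Rightarrow> laurent" where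
  "L_poly_x c = eval_poly L_const c L_x"

interpretation L_poly_x: comm_ring_hom L_poly_x
  by standard (simp_all add: L_poly_x_def eval_poly_def hom_distribs L_const_poly.hom_mult)

interpretation L_poly_xy: map_poly_comm_ring_hom L_poly_x ..

lemma to_laurent_eval: "to_laurent f = eval_poly L_poly_x f L_y"
  unfolding to_laurent_def
  by (simp add: eval_poly_as_sum L_poly_x_def L_x_power L_y_power mult_single sum_distrib_left)

interpretation to_laurent: comm_ring_hom to_laurent
  by standard (simp_all add: to_laurent_eval eval_poly_def hom_distribs L_poly_xy.hom_mult)

lemma to_laurent_x [simp]: "to_laurent x_var = L_x"
  by (simp add: to_laurent_eval eval_poly_def x_var_def L_poly_x_def)

lemma to_laurent_y [simp]: "to_laurent y_var = L_y"
  by (simp add: to_laurent_eval eval_poly_def y_var_def)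

lemma to_laurent_const: "to_laurent [:[:c:]:] = L_const c"
  by (simp add: to_laurent_eval eval_poly_def L_poly_x_def hom_distribs)

lemma lookup_to_laurent:
  "Poly_Mapping.lookup (to_laurent f) (int j, int i) = Polynomial.coeff (Polynomial.coeff f j) i"
proof -
  let ?c = "\<lambda>j i. Polynomial.coeff (Polynomial.coeff f j) i"
  have "Poly_Mapping.lookup (to_laurent f) (int j, int i) =
      (\<Sum>j'\<le>Polynomial.degree f. \<Sum>i'\<le>Polynomial.degree (Polynomial.coeff f j').
         (if j' = j \<and> i' = i then ?c j' i' else 0))"
    unfolding to_laurent_def lookup_sum lookup_single when_def
    by (intro sum.cong) auto
  also have "\<dots> = (\<Sum>j'\<le>Polynomial.degree f. if j' = j then ?c j i else 0)"
  proof (intro sum.cong refl)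
    fix j'
    have "(\<Sum>i'\<le>Polynomial.degree (Polynomial.coeff f j'). if j' = j \<and> i' = i then ?c j' i' else 0)
      = (\<Sum>i'\<le>Polynomial.degree (Polynomial.coeff f j'). if i' = i then (if j' = j then ?c j' i' else 0) else 0)"
      by (intro sum.cong) auto
    also have "\<dots> = (if j' = j then ?c j i else 0)"
      by (subst sum.delta) (auto simp: coeff_eq_0)
    finally show "(\<Sum>i'\<le>Polynomial.degree (Polynomial.coeff f j'). if j' = j \<and> i' = i then ?c j' i' else 0)
      = (if j' = j then ?c j i else 0)" .
  qed
  also have "\<dots> = ?c j i" by (subst sum.delta) (auto simp: coeff_eq_0)
  finally show ?thesis .
qed

lemma to_laurent_inj: "to_laurent f = to_laurent h \<Longrightarrow> f = h"
  by (simp add: poly_eq_iff lookup_to_laurent[symmetric])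

lemma poly_mapping_eq_sum_single:
  "(f :: 'a \<Rightarrow>\<^sub>0 'b::comm_monoid_add) = (\<Sum>k\<in>Poly_Mapping.keys f. Poly_Mapping.single k (Poly_Mapping.lookup f k))"
proof (rule poly_mapping_eqI)
  fix k
  have "Poly_Mapping.lookup (\<Sum>k\<in>Poly_Mapping.keys f. Poly_Mapping.single k (Poly_Mapping.lookup f k)) k
    = (\<Sum>k'\<in>Poly_Mapping.keys f. if k' = k then Poly_Mapping.lookup f k' else 0)"
    by (simp add: lookup_sum lookup_single when_def)
  also have "\<dots> = Poly_Mapping.lookup f k" by (simp add: in_keys_iff)
  finally show "Poly_Mapping.lookup f k =
    Poly_Mapping.lookup (\<Sum>k\<in>Poly_Mapping.keys f. Poly_Mapping.single k (Poly_Mapping.lookup f k)) k" ..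
qed

text \<open>Powers of \<open>xy\<close> suffice as common denominators.\<close>

lemma laurent_denominator: "\<exists>N f. (L_x * L_y) ^ N * p = to_laurent f"
proof -
  have sum: "\<exists>N f. (L_x * L_y) ^ N * (\<Sum>k\<in>A. Poly_Mapping.single k (c k)) = to_laurent f"
    if "finite A" for A :: "(int \<times> int) set" and c :: "int \<times> int \<Rightarrow> rat"
    using that
  proof (induction A)
    case empty
    show ?case by (intro exI[of _ 0]) (auto intro: exI[of _ 0])
  next
    case (insert k A)
    obtain N f where f: "(L_x * L_y) ^ N * (\<Sum>k\<in>A. Poly_Mapping.single k (c k)) = to_laurent f"
      using insert.IH by blast
    obtain i j where k: "k = (i, j)" by (cases k)
    obtain M a b where M: "int a = j + int M" "int b = i + int M"
    proof
      show "int (nat (j + int (nat \<bar>i\<bar> + nat \<bar>j\<bar>))) = j + int (nat \<bar>i\<bar> + nat \<bar>j\<bar>)"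
        "int (nat (i + int (nat \<bar>i\<bar> + nat \<bar>j\<bar>))) = i + int (nat \<bar>i\<bar> + nat \<bar>j\<bar>)" by simp_all
    qed
    let ?M = M
    have "(L_x * L_y) ^ ?M * Poly_Mapping.single k (c k) = L_const (c k) * L_x ^ a * L_y ^ b"
      unfolding power_mult_distrib L_x_power L_y_power
      by (simp add: mult_single zero_prod_def k M add.commute)
    also have "\<dots> = to_laurent ([:[:c k:]:] * x_var ^ a * y_var ^ b)"
      by (simp only: to_laurent.hom_mult to_laurent.hom_power to_laurent_x to_laurent_y to_laurent_const)
    finally obtain h where h: "(L_x * L_y) ^ ?M * Poly_Mapping.single k (c k) = to_laurent h" by blast
    have "(L_x * L_y) ^ (N + ?M) * (\<Sum>k\<in>insert k A. Poly_Mapping.single k (c k)) =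
      (L_x * L_y) ^ N * ((L_x * L_y) ^ ?M * Poly_Mapping.single k (c k)) +
      (L_x * L_y) ^ ?M * ((L_x * L_y) ^ N * (\<Sum>k\<in>A. Poly_Mapping.single k (c k)))"
      unfolding sum.insert[OF insert.hyps] power_add distrib_left by (simp only: ac_simps)
    also have "\<dots> = to_laurent ((x_var * y_var) ^ N * h + (x_var * y_var) ^ ?M * f)"
      unfolding f h by (simp add: to_laurent.hom_mult to_laurent.hom_power to_laurent.hom_add)
    finally show ?case by blast
  qed
  show ?thesis by (subst poly_mapping_eq_sum_single) (rule sum[OF finite_keys])
qed

text \<open>The contraction of an extended ideal consists of the \<open>f\<close> with \<open>(xy)\<^sup>N f\<close> in the ideal for some \<open>N\<close>. The
hypothesis says that \<open>xy\<close> is invertible modulo the ideal, with inverse \<open>h\<close>, so \<open>(xy)\<^sup>N\<close> can be cancelled.\<close>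

lemma contract_laurent_genideal:
  assumes G: "1 - x_var * y_var * h \<in> Idl\<^bsub>Rxy\<^esub> B"
  shows "{f. to_laurent f \<in> Idl\<^bsub>Laurent\<^esub> (to_laurent ` B)} = Idl\<^bsub>Rxy\<^esub> B"
proof (intro equalityI subsetI)
  let ?I = "Idl\<^bsub>Rxy\<^esub> B"
  have I: "type_ideal ?I" by (rule type_ideal_genideal)
  define J where "J = {p. \<exists>N f. f \<in> ?I \<and> (L_x * L_y) ^ N * p = to_laurent f}"
  have "type_ideal J"
  proof (rule type_idealI)
    show "0 \<in> J" unfolding J_def using type_ideal_0[OF I] by (intro CollectI exI[of _ 0]) auto
    fix p assume "p \<in> J"
    then obtain N f where f: "f \<in> ?I" "(L_x * L_y) ^ N * p = to_laurent f" unfolding J_def by blast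
    show "s * p \<in> J" for s
    proof -
      obtain M h where h: "(L_x * L_y) ^ M * s = to_laurent h" using laurent_denominator by blast
      have "(L_x * L_y) ^ (M + N) * (s * p) = ((L_x * L_y) ^ M * s) * ((L_x * L_y) ^ N * p)"
        by (simp only: power_add ac_simps)
      also have "\<dots> = to_laurent (h * f)" unfolding f h by (simp add: to_laurent.hom_mult)
      finally show ?thesis unfolding J_def using type_ideal_mult[OF I f(1)] by (intro CollectI exI conjI)
    qed
    show "p + p' \<in> J" if p': "p' \<in> J" for p'
    proof -
      obtain M h where h: "h \<in> ?I" "(L_x * L_y) ^ M * p' = to_laurent h" using p' unfolding J_def by blast
      have "(L_x * L_y) ^ (M + N) * (p + p') =
          (L_x * L_y) ^ M * ((L_x * L_y) ^ N * p) + (L_x * L_y) ^ N * ((L_x * L_y) ^ M * p')"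
        unfolding power_add distrib_left by (simp only: ac_simps)
      also have "\<dots> = to_laurent ((x_var * y_var) ^ M * f + (x_var * y_var) ^ N * h)"
        unfolding f h by (simp add: to_laurent.hom_mult to_laurent.hom_power to_laurent.hom_add)
      finally show ?thesis
        unfolding J_def using type_ideal_add[OF I type_ideal_mult[OF I f(1)] type_ideal_mult[OF I h(1)]]
        by (intro CollectI exI conjI)
    qed
  qed
  moreover have "to_laurent ` B \<subseteq> J"
  proof (intro image_subsetI)
    fix b assume "b \<in> B"
    then have "b \<in> ?I" by (rule subsetD[OF genideal_self_type])
    then show "to_laurent b \<in> J" unfolding J_def by (intro CollectI exI[of _ 0] exI[of _ b]) simp
  qed
  ultimately have sub: "Idl\<^bsub>Laurent\<^esub> (to_laurent ` B) \<subseteq> J" by (rule genideal_minimal_type)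
  fix f assume "f \<in> {f. to_laurent f \<in> Idl\<^bsub>Laurent\<^esub> (to_laurent ` B)}"
  then have "to_laurent f \<in> J" using sub by blast
  then obtain N f' where f': "f' \<in> ?I" "(L_x * L_y) ^ N * to_laurent f = to_laurent f'"
    unfolding J_def by blast
  have "to_laurent ((x_var * y_var) ^ N * f) = to_laurent f'"
    using f'(2) by (simp add: to_laurent.hom_mult to_laurent.hom_power)
  then have "(x_var * y_var) ^ N * f \<in> ?I" using to_laurent_inj f'(1) by metis
  then show "f \<in> ?I"
  proof (induction N)
    case (Suc N)
    let ?t = "(x_var * y_var) ^ N * f"
    have "(1 - x_var * y_var * h) * ?t + h * ((x_var * y_var) ^ Suc N * f) \<in> ?I"
      by (rule type_ideal_add[OF I type_ideal_mult2[OF I G] type_ideal_mult[OF I Suc.prems]])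
    moreover have "(1 - x_var * y_var * h) * ?t + h * ((x_var * y_var) ^ Suc N * f) = ?t"
      by (simp add: algebra_simps)
    ultimately have "?t \<in> ?I" by (simp only:)
    then show ?case by (rule Suc.IH)
  qed simp
next
  let ?J = "Idl\<^bsub>Laurent\<^esub> (to_laurent ` B)"
  have J: "type_ideal ?J" by (rule type_ideal_genideal)
  have "type_ideal {f. to_laurent f \<in> ?J}"
    by (rule type_idealI)
       (auto simp: to_laurent.hom_mult to_laurent.hom_add type_ideal_0[OF J] intro: type_ideal_add[OF J] type_ideal_mult[OF J])
  moreover have "B \<subseteq> {f. to_laurent f \<in> ?J}"
    using genideal_self_type[of "to_laurent ` B"] by (auto simp: image_subset_iff)
  ultimately have sub: "Idl\<^bsub>Rxy\<^esub> B \<subseteq> {f. to_laurent f \<in> ?J}" by (rule genideal_minimal_type)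
  fix f assume "f \<in> Idl\<^bsub>Rxy\<^esub> B"
  then show "f \<in> {f. to_laurent f \<in> ?J}" by (rule subsetD[OF sub])
qed

section \<open>Fox derivatives and the second elementary ideal\<close>

text \<open>The image of a word in the group ring of \<open>\<int>\<^sup>2\<close>.\<close>

fun word_val :: "(nat \<Rightarrow> int \<times> int) \<Rightarrow> word \<Rightarrow> laurent" where
  "word_val \<phi> [] = 1"
| "word_val \<phi> ((i, s) # v) = Poly_Mapping.single (if s then \<phi> i else - \<phi> i) 1 * word_val \<phi> v"

lemma word_val_append: "word_val \<phi> (v @ w) = word_val \<phi> v * word_val \<phi> w"
  by (induction \<phi> v rule: word_val.induct) (simp_all add: mult.assoc)

lemma fox_append: "fox \<phi> j (v @ w) = fox \<phi> j v + word_val \<phi> v * fox \<phi> j w"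
  by (induction \<phi> j v rule: fox.induct) (simp_all add: algebra_simps)

lemma winv_append: "winv (v @ w) = winv w @ winv v"
  by (simp add: winv_def)

lemma winv_winv: "winv (winv w) = w"
  by (simp add: winv_def rev_map comp_def case_prod_beta)

lemma winv_Cons: "winv ((i, s) # w) = winv w @ [(i, \<not> s)]"
  by (simp add: winv_def)

lemma word_val_winv: "word_val \<phi> (winv w) * word_val \<phi> w = 1"
proof (induction \<phi> w rule: word_val.induct)
  case (2 \<phi> i s v)
  have "word_val \<phi> (winv ((i, s) # v)) * word_val \<phi> ((i, s) # v) =
    (word_val \<phi> (winv v) * word_val \<phi> v) *
    (Poly_Mapping.single (if \<not> s then \<phi> i else - \<phi> i) 1 * Poly_Mapping.single (if s then \<phi> i else - \<phi> i) 1)"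
    by (simp add: winv_Cons word_val_append mult_ac)
  also have "Poly_Mapping.single (if \<not> s then \<phi> i else - \<phi> i) 1 *
      Poly_Mapping.single (if s then \<phi> i else - \<phi> i) (1::rat) = 1"
    by (simp add: mult_single single_one)
  finally show ?case using 2 by simp
qed (simp add: winv_def)

lemma fox_winv: "fox \<phi> j (winv w) = - (word_val \<phi> (winv w) * fox \<phi> j w)"
proof -
  have triv: "fox \<phi> j (winv w @ w) = 0" for w
  proof (induction w)
    case (Cons a w)
    obtain i s where a: "a = (i, s)" by (cases a)
    have cancel: "fox \<phi> j ((i, \<not> s) # (i, s) # w) = fox \<phi> j w"
      by (cases s) (simp_all add: distrib_left mult_single single_one flip: mult.assoc)
    have "fox \<phi> j (winv (a # w) @ a # w) = fox \<phi> j (winv w @ w)"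
      unfolding a winv_Cons append_assoc append_Cons append_Nil fox_append cancel ..
    then show ?case using Cons.IH by simp
  qed (simp add: winv_def)
  then show ?thesis using triv[of w] by (simp add: fox_append eq_neg_iff_add_eq_0)
qed

lemma wpow_Suc: "wpow w (Suc n) = w @ wpow w n" "wpow w 0 = []"
  by (simp_all add: wpow_def)

lemma wpow_Suc2: "wpow w (Suc n) = wpow w n @ w"
  by (induction n) (simp_all add: wpow_Suc)

lemma winv_wpow: "winv (wpow w n) = wpow (winv w) n"
  by (induction n) (simp_all add: wpow_Suc(2) winv_def[of "[]"] wpow_Suc(1)[of w] winv_append wpow_Suc2[symmetric])

lemma word_val_wpow: "word_val \<phi> (wpow w n) = word_val \<phi> w ^ n"
  by (induction n) (simp_all add: wpow_Suc word_val_append)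

lemma fox_wpow: "fox \<phi> j (wpow w n) = (\<Sum>i<n. word_val \<phi> w ^ i) * fox \<phi> j w"
  by (induction n) (simp_all add: wpow_Suc2 wpow_Suc(2) fox_append word_val_wpow algebra_simps del: wpow_Suc(1))

text \<open>Both relators of the pretzel link group are products of two conjugates, so this formula is applied to
all four of them.\<close>

lemma fox_conjugate:
  "fox \<phi> j (v @ z @ winv v) = (1 - word_val \<phi> z) * fox \<phi> j v + word_val \<phi> v * fox \<phi> j z"
proof -
  have "fox \<phi> j (v @ z @ winv v) = fox \<phi> j v + word_val \<phi> v * fox \<phi> j z
      - (word_val \<phi> (winv v) * word_val \<phi> v) * (word_val \<phi> z * fox \<phi> j v)"
    by (simp add: fox_append fox_winv algebra_simps)
  then show ?thesis unfolding word_val_winv by (simp add: algebra_simps)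
qed

lemma word_val_conjugate: "word_val \<phi> (v @ z @ winv v) = word_val \<phi> z"
proof -
  have "word_val \<phi> (v @ z @ winv v) = (word_val \<phi> (winv v) * word_val \<phi> v) * word_val \<phi> z"
    by (simp only: word_val_append ac_simps)
  then show ?thesis by (simp add: word_val_winv)
qed

lemma sum_alternating_pairs: "(\<Sum>i<2 * n. (- x) ^ i) = (1 - x) * (\<Sum>i<n. (x * x) ^ i)" for x :: "'a::comm_ring_1"
proof (induction n)
  case (Suc n)
  have "(- x) ^ (2 * n) = (x * x) ^ n" by (simp add: power_mult power2_eq_square)
  then have "(\<Sum>i<2 * Suc n. (- x) ^ i) = (\<Sum>i<2 * n. (- x) ^ i) + (1 - x) * (x * x) ^ n"
    by (simp add: left_diff_distrib)
  then show ?case unfolding Suc.IH by (simp add: distrib_left)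
qed simp

lemma A_poly_sum:
  assumes "odd q"
  shows "A_poly q = (\<Sum>i<q. (- x_var) ^ i)"
proof -
  have "1 + x_var ^ q = (1 + x_var) * (\<Sum>i<q. (- x_var) ^ i)"
    using one_diff_power_eq[of "- x_var" q] assms by simp
  moreover have "1 + x_var \<noteq> 0" by (simp add: x_var_def one_pCons)
  ultimately show ?thesis
    unfolding A_poly_def by (simp only: nonzero_mult_div_cancel_left not_False_eq_True)
qed

text \<open>With three generators the minors for \<open>d = 2\<close> have size one, so the ideal is generated by the entries.\<close>

lemma single_entry_minors:
  assumes "rs = [r1, r2]"
  shows "elementary_ideal 2 \<phi> 3 rs = Idl\<^bsub>Laurent\<^esub> ((\<lambda>j. fox \<phi> j r1) ` {..<3} \<union> (\<lambda>j. fox \<phi> j r2) ` {..<3})"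
proof -
  let ?M = "fox_matrix \<phi> 3 rs"
  have det: "det (submatrix ?M {i} {j}) = fox \<phi> j (rs ! i)" if "i < 2" "j < 3" for i j
  proof -
    have I: "{a. a < dim_row ?M \<and> a \<in> {i}} = {i}" "{a. a < dim_col ?M \<and> a \<in> {j}} = {j}"
      using that assms by (auto simp: fox_matrix_def)
    have pick: "pick {a} 0 = a" for a by (simp add: Least_equality)
    have "submatrix ?M {i} {j} = mat 1 1 (\<lambda>_. fox \<phi> j (rs ! i))"
      unfolding submatrix_def I using that assms by (auto simp: pick fox_matrix_def simp del: pick.simps)
    then show ?thesis by (simp add: det_single)
  qed
  have "{det (submatrix ?M S T) | S T. S \<subseteq> {..<length rs} \<and> T \<subseteq> {..<3} \<and> card S = 3 - 2 \<and> card T = 3 - 2}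
    = {fox \<phi> j (rs ! i) | i j. i < 2 \<and> j < 3}" (is "?L = ?R")
  proof (intro equalityI subsetI)
    fix x assume "x \<in> ?L"
    then obtain S T where x: "x = det (submatrix ?M S T)" "S \<subseteq> {..<length rs}" "T \<subseteq> {..<3}" "card S = 1" "card T = 1"
      by auto
    then obtain i j where ij: "S = {i}" "T = {j}" by (metis card_1_singletonE)
    then have "i < 2" "j < 3" using x(2,3) assms by auto
    moreover from this have "x = fox \<phi> j (rs ! i)" using x(1) ij det by simp
    ultimately show "x \<in> ?R" by blast
  next
    fix x assume "x \<in> ?R"
    then obtain i j where "x = fox \<phi> j (rs ! i)" "i < 2" "j < 3" by auto
    then have "x = det (submatrix ?M {i} {j})" "{i} \<subseteq> {..<length rs}" "{j} \<subseteq> {..<3}"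
      using det assms by auto
    then show "x \<in> ?L" by (intro CollectI exI[of _ "{i}"] exI[of _ "{j}"]) simp
  qed
  also have "\<dots> = (\<lambda>j. fox \<phi> j r1) ` {..<3} \<union> (\<lambda>j. fox \<phi> j r2) ` {..<3}"
    unfolding assms by (force simp: less_2_cases_iff)
  finally show ?thesis unfolding elementary_ideal_def by simp
qed

lemma fox_two_conjugates:
  "fox \<phi> j ((v @ z @ winv v) @ (v' @ z' @ winv v')) =
    (1 - word_val \<phi> z) * fox \<phi> j v + word_val \<phi> v * fox \<phi> j z +
    word_val \<phi> z * ((1 - word_val \<phi> z') * fox \<phi> j v' + word_val \<phi> v' * fox \<phi> j z')"
  unfolding fox_append[of _ _ "v @ z @ winv v"] fox_conjugate word_val_conjugate ..

text \<open>The two relators bracketed as products of two conjugates; in the first one, \<open>(ca\<inverse>)\<^sup>m\<close> is written as the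
inverse of \<open>(ac\<inverse>)\<^sup>m\<close>.\<close>

definition pretzel_rel1 :: "nat \<Rightarrow> nat \<Rightarrow> word" where
  "pretzel_rel1 m r =
    (wpow (gen 2 @ gen 1) r @ winv (gen 1) @ winv (wpow (gen 2 @ gen 1) r)) @
    (wpow (gen 0 @ winv (gen 2)) m @ gen 2 @ winv (wpow (gen 0 @ winv (gen 2)) m))"

definition pretzel_rel2 :: "nat \<Rightarrow> nat \<Rightarrow> word" where
  "pretzel_rel2 k r =
    (winv (wpow (gen 0 @ gen 1) k) @ gen 1 @ winv (winv (wpow (gen 0 @ gen 1) k))) @
    (wpow (gen 2 @ gen 1) (r - 1) @ winv (gen 2) @ winv (wpow (gen 2 @ gen 1) (r - 1)))"

lemma pretzel_relators_eq: "pretzel_relators k m r = [pretzel_rel1 m r, pretzel_rel2 k r]"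
  unfolding pretzel_relators_def pretzel_rel1_def pretzel_rel2_def Let_def
  by (simp add: winv_wpow winv_append winv_winv)

lemma word_val_generators:
  "word_val pretzel_phi (gen 0) = L_y" "word_val pretzel_phi (gen 1) = L_x" "word_val pretzel_phi (gen 2) = L_x"
  "word_val pretzel_phi (winv (gen 1)) = L_xi" "word_val pretzel_phi (winv (gen 2)) = L_xi"
  by (simp_all add: gen_def winv_def pretzel_phi_def)

lemma fox_generators:
  "fox \<phi> j (gen i) = (if i = j then 1 else 0)"
  "fox pretzel_phi j (winv (gen 1)) = (if j = 1 then - L_xi else 0)"
  "fox pretzel_phi j (winv (gen 2)) = (if j = 2 then - L_xi else 0)"
  by (simp_all add: gen_def winv_def pretzel_phi_def)

lemma L_x_cancel: "L_x * (L_xi * z) = z" "L_xi * (L_x * z) = z"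
  by (simp_all only: mult.assoc[symmetric] L_x_inverse mult_1_left)

lemma pretzel_rel1_fox:
  fixes m r :: nat
  defines "s \<equiv> L_y * L_xi"
  shows
    "fox pretzel_phi 0 (pretzel_rel1 m r) = (L_xi - 1) * (\<Sum>i<m. s ^ i)"
    "fox pretzel_phi 1 (pretzel_rel1 m r) =
       (1 - L_xi) * (\<Sum>i<r. (L_x * L_x) ^ i) * L_x - (L_x * L_x) ^ r * L_xi"
    "fox pretzel_phi 2 (pretzel_rel1 m r) = (1 - L_xi) * (\<Sum>i<r. (L_x * L_x) ^ i) +
       L_xi * (s ^ m - (1 - L_x) * (\<Sum>i<m. s ^ i) * s)"
  unfolding pretzel_rel1_def fox_two_conjugates
  unfolding fox_wpow fox_append word_val_wpow word_val_append
    word_val_generators fox_generators s_def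
  by (simp_all add: algebra_simps L_x_cancel)

text \<open>The word \<open>(ab)\<^bsup>-k\<^esup>\<close> enters only through its value \<open>t\<close>, the inverse of \<open>(xy)\<^sup>k\<close>.\<close>

lemma pretzel_rel2_fox:
  fixes k r :: nat
  defines "t \<equiv> word_val pretzel_phi (winv (wpow (gen 0 @ gen 1) k))"
  shows
    "fox pretzel_phi 0 (pretzel_rel2 k r) = t * (L_x - 1) * (\<Sum>i<k. (L_y * L_x) ^ i)"
    "fox pretzel_phi 1 (pretzel_rel2 k r) = t * ((L_x - 1) * (\<Sum>i<k. (L_y * L_x) ^ i) * L_y + 1) +
       L_x * ((1 - L_xi) * (\<Sum>i<r - 1. (L_x * L_x) ^ i) * L_x)"
    "fox pretzel_phi 2 (pretzel_rel2 k r) =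
       L_x * ((1 - L_xi) * (\<Sum>i<r - 1. (L_x * L_x) ^ i) - (L_x * L_x) ^ (r - 1) * L_xi)"
  unfolding pretzel_rel2_def fox_two_conjugates
  unfolding fox_winv[of _ _ "wpow _ _"] t_def[symmetric]
  unfolding fox_wpow fox_append word_val_wpow word_val_append word_val_generators fox_generators
  by (simp_all add: algebra_simps L_x_cancel)

text \<open>With \<open>S = \<Sum>\<^bsub>i<m\<^esub> (y/x)\<^sup>i\<close> and \<open>T = G\<close> the six entries are, relator by relator,
\<open>(x\<inverse> - 1) S\<close>, \<open>- A\<close>, \<open>A + x\<inverse> (y - 1) S\<close> and \<open>t (x - 1) T\<close>, \<open>A + t (1 - y) T\<close>, \<open>- A\<close>; and \<open>S\<close> is \<open>H\<close> up to
a power of \<open>x\<close>. So the entries lie in \<open>\<langle>A, G, H\<rangle>\<close>. Conversely \<open>A = 1 + (x - 1) W\<close> for some \<open>W\<close>, hence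
an ideal that contains \<open>A\<close> and \<open>(x - 1) z\<close> contains \<open>z\<close>.\<close>

lemma pretzel_entries_ideal:
  fixes J :: "laurent set"
  assumes J: "type_ideal J" and k: "k > 0" and m: "m > 0" and r: "r \<ge> 2"
  shows "(\<lambda>j. fox pretzel_phi j (pretzel_rel1 m r)) ` {..<3} \<union> (\<lambda>j. fox pretzel_phi j (pretzel_rel2 k r)) ` {..<3} \<subseteq> J
    \<longleftrightarrow> to_laurent ` {A_poly (2 * r - 1), G_poly k, H_poly m} \<subseteq> J"
proof -
  define s t where "s = L_y * L_xi" and "t = word_val pretzel_phi (winv (wpow (gen 0 @ gen 1) k))"
  define a where "a = to_laurent (A_poly (2 * r - 1))"
  define R1 where "R1 = (\<Sum>i<r. (L_x * L_x) ^ i)"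
  define R2 where "R2 = (\<Sum>i<r - 1. (L_x * L_x) ^ i)"
  define S where "S = (\<Sum>i<m. s ^ i)"
  define T where "T = (\<Sum>i<k. (L_y * L_x) ^ i)"
  note e1 = pretzel_rel1_fox[of m r, folded s_def, folded S_def R1_def]
  note e2 = pretzel_rel2_fox[of k r, folded t_def, folded T_def R2_def]
  have G: "to_laurent (G_poly k) = T"
    by (simp add: G_poly_sum T_def to_laurent.hom_sum to_laurent.hom_power to_laurent.hom_mult mult.commute)
  have xs: "L_x * s = L_y" unfolding s_def by (simp only: mult.left_commute[of L_x] L_x_inverse mult_1_right)
  have H: "to_laurent (H_poly m) = L_x ^ (m - 1) * S"
  proof -
    have "to_laurent (H_poly m) = (\<Sum>i<m. L_y ^ (m - Suc i) * L_x ^ i)"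
      by (simp add: H_poly_sum to_laurent.hom_sum to_laurent.hom_power to_laurent.hom_mult)
    also have "\<dots> = (\<Sum>i<m. L_y ^ i * L_x ^ (m - Suc i))"
      by (subst sum.nat_diff_reindex[symmetric]) (intro sum.cong, auto)
    also have "\<dots> = (\<Sum>i<m. L_x ^ (m - 1) * s ^ i)"
    proof (intro sum.cong refl)
      fix i assume "i \<in> {..<m}"
      then have "L_x ^ (m - 1) = L_x ^ (m - Suc i) * L_x ^ i" by (simp flip: power_add)
      then show "L_y ^ i * L_x ^ (m - Suc i) = L_x ^ (m - 1) * s ^ i"
        by (simp only: xs[symmetric] power_mult_distrib ac_simps)
    qed
    finally show ?thesis by (simp only: S_def sum_distrib_left)
  qed
  have S: "L_xi ^ (m - 1) * (L_x ^ (m - 1) * S) = S"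
    by (simp only: mult.assoc[symmetric] power_mult_distrib[symmetric] L_x_inverse power_one mult_1_left)
  have a_sum: "a = (\<Sum>i<2 * r - 1. (- L_x) ^ i)"
    using r by (simp add: a_def A_poly_sum to_laurent.hom_sum to_laurent.hom_power to_laurent.hom_uminus)
  have r1: "Suc (2 * r - 1) = 2 * r" "Suc (2 * (r - 1)) = 2 * r - 1" "2 * (r - 1) = 2 * r - 2" using r by auto
  have odd: "odd (2 * r - 1)" using r by simp
  \<comment> \<open>A is an alternating sum of an odd number of powers of x. Pairing neighbours works after one
    summand is added (a1) or removed (a2); R1 and R2 are the sums that occur in the entries.\<close>
  have "(\<Sum>i<Suc (2 * r - 1). (- L_x) ^ i) = a - L_x ^ (2 * r - 1)"
    unfolding sum.lessThan_Suc a_sum using odd by simp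
  then have a1: "a = (1 - L_x) * R1 + L_x ^ (2 * r - 1)"
    unfolding r1(1) sum_alternating_pairs R1_def by (simp add: algebra_simps)
  have a2: "a = (1 - L_x) * R2 + L_x ^ (2 * r - 2)"
  proof -
    have "a = (\<Sum>i<Suc (2 * (r - 1)). (- L_x) ^ i)" unfolding a_sum r1(2) ..
    also have "\<dots> = (1 - L_x) * R2 + (- L_x) ^ (2 * (r - 1))"
      unfolding sum.lessThan_Suc sum_alternating_pairs R2_def ..
    also have "(- L_x) ^ (2 * (r - 1)) = L_x ^ (2 * r - 2)" unfolding r1(3)[symmetric] by simp
    finally show ?thesis .
  qed
  have a3: "(1 + L_x) * a = 1 + L_x ^ (2 * r - 1)"
    unfolding a_sum using one_diff_power_eq[of "- L_x" "2 * r - 1"] odd by simp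
  have p1: "(L_x * L_x) ^ r = L_x * L_x ^ (2 * r - 1)" "(L_x * L_x) ^ (r - 1) = L_x ^ (2 * r - 2)"
    "L_x ^ (2 * r - 1) = L_x * L_x ^ (2 * r - 2)"
  proof -
    show "(L_x * L_x) ^ (r - 1) = L_x ^ (2 * r - 2)"
      unfolding r1(3)[symmetric] power_mult power2_eq_square ..
    show "L_x ^ (2 * r - 1) = L_x * L_x ^ (2 * r - 2)"
      unfolding r1(2)[symmetric] r1(3) by simp
    show "(L_x * L_x) ^ r = L_x * L_x ^ (2 * r - 1)"
      unfolding power_Suc[symmetric] r1(1) power_mult power2_eq_square ..
  qed
  note x1 = L_x_cancel
  have f11: "fox pretzel_phi 1 (pretzel_rel1 m r) = - a"
    unfolding e1 p1(1) a1 by (simp add: x1 L_x_inverse algebra_simps)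
  have f22: "fox pretzel_phi 2 (pretzel_rel2 k r) = - a"
    unfolding e2 p1(2) a2 by (simp add: x1 L_x_inverse algebra_simps)
  have f12: "fox pretzel_phi 2 (pretzel_rel1 m r) = a + L_xi * (L_y - 1) * S"
  proof -
    have sm: "s ^ m = 1 - (1 - s) * S" unfolding S_def one_diff_power_eq[symmetric] by simp
    have "L_x * fox pretzel_phi 2 (pretzel_rel1 m r) = - ((1 - L_x) * R1) + (1 - (1 - s) * S - (1 - L_x) * S * s)"
      unfolding e1 sm by (simp add: x1 L_x_inverse algebra_simps)
    also have "- ((1 - L_x) * R1) = 1 + L_x ^ (2 * r - 1) - 1 - a" using a1 by simp
    also have "\<dots> = L_x * a - 1" unfolding a3[symmetric] by (simp add: algebra_simps)
    also have "L_x * a - 1 + (1 - (1 - s) * S - (1 - L_x) * S * s) = L_x * a + (L_x * s - 1) * S"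
      by (simp add: algebra_simps)
    finally have "L_xi * (L_x * fox pretzel_phi 2 (pretzel_rel1 m r)) = L_xi * (L_x * a + (L_y - 1) * S)"
      unfolding xs by (simp only:)
    then show ?thesis by (simp only: x1 distrib_left mult.assoc)
  qed
  have t: "t * (L_y * L_x) ^ k = 1"
    using word_val_winv[of pretzel_phi "wpow (gen 0 @ gen 1) k"]
    unfolding t_def word_val_wpow word_val_append word_val_generators .
  have f21: "fox pretzel_phi 1 (pretzel_rel2 k r) = a + t * (1 - L_y) * T"
  proof -
    have "(1 - L_y * L_x) * T = 1 - (L_y * L_x) ^ k" unfolding T_def by (rule one_diff_power_eq[symmetric])
    then have "t * (1 - (1 - L_y * L_x) * T) = 1" using t by simp
    then have t1: "t * 1 = 1 + t * (1 - L_y * L_x) * T" by (simp add: algebra_simps)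
    have "fox pretzel_phi 1 (pretzel_rel2 k r) = t * (L_x - 1) * T * L_y + t * 1 - (1 - L_x) * R2 * L_x"
      unfolding e2 by (simp add: x1 L_x_inverse algebra_simps)
    also have "(1 - L_x) * R2 * L_x = L_x * a - L_x ^ (2 * r - 1)"
      unfolding p1(3) a2 by (simp add: algebra_simps)
    also have "L_x ^ (2 * r - 1) = (1 + L_x) * a - 1" unfolding a3 by simp
    finally show ?thesis unfolding t1 by (simp add: algebra_simps)
  qed
  have range: "(\<lambda>j. f j) ` {..<3} = {f 0, f 1, f 2}" for f :: "nat \<Rightarrow> laurent"
    by (auto simp: numeral_3_eq_3 lessThan_Suc numeral_2_eq_2)
  have "{f10, - a, a + c * S} \<union> {f20, a + d * T, - a} \<subseteq> J \<longleftrightarrow> {a, T, L_x ^ (m - 1) * S} \<subseteq> J"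
    if f10: "f10 = (L_xi - 1) * S" and f20: "f20 = t * (L_x - 1) * T" for f10 f20 c d
  proof
    assume *: "{f10, - a, a + c * S} \<union> {f20, a + d * T, - a} \<subseteq> J"
    then have mem: "f10 \<in> J" "f20 \<in> J" "- a \<in> J" by auto
    have aJ: "a \<in> J" using type_ideal_uminus[OF J mem(3)] by simp
    \<comment> \<open>A(1) = 1, so A - 1 is a multiple of x - 1; W is the cofactor.\<close>
    define W where "W = (\<Sum>i<2 * r - 1. L_x ^ i) - R1"
    have "L_x ^ (2 * r - 1) - 1 = (L_x - 1) * (\<Sum>i<2 * r - 1. L_x ^ i)" by (rule power_diff_1_eq)
    then have aW: "a = 1 + (L_x - 1) * W" unfolding a1 W_def by (simp add: algebra_simps)
    have cancel: "z \<in> J" if "(L_x - 1) * z \<in> J" for z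
    proof -
      have "z * a - W * ((L_x - 1) * z) \<in> J"
        by (rule type_ideal_diff[OF J type_ideal_mult[OF J aJ] type_ideal_mult[OF J that]])
      then show ?thesis unfolding aW by (simp add: algebra_simps)
    qed
    have "(- L_x) * f10 \<in> J" by (rule type_ideal_mult[OF J mem(1)])
    then have "(L_x - 1) * S \<in> J" unfolding f10 by (simp add: x1 L_x_inverse algebra_simps)
    then have S: "S \<in> J" by (rule cancel)
    have "(L_y * L_x) ^ k * f20 \<in> J" by (rule type_ideal_mult[OF J mem(2)])
    moreover have "(L_y * L_x) ^ k * f20 = (t * (L_y * L_x) ^ k) * ((L_x - 1) * T)"
      unfolding f20 by (simp only: ac_simps)
    ultimately have "(L_x - 1) * T \<in> J" unfolding t by simp
    then have "T \<in> J" by (rule cancel)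
    then show "{a, T, L_x ^ (m - 1) * S} \<subseteq> J" using aJ type_ideal_mult[OF J S] by simp
  next
    assume *: "{a, T, L_x ^ (m - 1) * S} \<subseteq> J"
    then have aT: "a \<in> J" "T \<in> J" by auto
    have "S \<in> J" using * type_ideal_mult[OF J, of "L_x ^ (m - 1) * S" "L_xi ^ (m - 1)"] unfolding S by simp
    then show "{f10, - a, a + c * S} \<union> {f20, a + d * T, - a} \<subseteq> J"
      unfolding f10 f20 using aT
      by (simp add: type_ideal_add[OF J] type_ideal_mult[OF J] type_ideal_uminus[OF J])
  qed
  then show ?thesis
    unfolding range f11 f22 f12 f21 image_insert image_empty G H a_def[symmetric] e1(1) e2(1) by blast
qed

text \<open>Since \<open>G\<close> begins with \<open>1\<close> and all its other terms are multiples of \<open>xy\<close>, it provides the inverse of \<open>xy\<close>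
that makes the contraction trivial.\<close>

lemma pretzel_I_eq:
  assumes k: "k > 0" and m: "m > 0" and r: "r \<ge> 2"
  shows "pretzel_I k m r = Idl\<^bsub>Rxy\<^esub> {A_poly (2 * r - 1), G_poly k, H_poly m}"
proof -
  let ?B = "{A_poly (2 * r - 1), G_poly k, H_poly m}"
  obtain k' where k': "k = Suc k'" using k by (cases k) auto
  define h where "h = - (\<Sum>i<k'. (x_var * y_var) ^ i)"
  have G: "G_poly k = 1 - x_var * y_var * h"
    unfolding G_poly_sum k' h_def sum.lessThan_Suc_shift by (simp add: sum_distrib_left)
  have "G_poly k \<in> Idl\<^bsub>Rxy\<^esub> ?B" by (rule subsetD[OF genideal_self_type]) simp
  then have *: "1 - x_var * y_var * h \<in> Idl\<^bsub>Rxy\<^esub> ?B" unfolding G .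
  have "pretzel_E2 k m r = Idl\<^bsub>Laurent\<^esub> (to_laurent ` ?B)"
    unfolding pretzel_E2_def single_entry_minors[OF pretzel_relators_eq]
    by (rule genideal_eqI) (rule pretzel_entries_ideal[OF _ k m r])
  then show ?thesis
    unfolding pretzel_I_def by (simp only: contract_laurent_genideal[OF *])
qed

section \<open>Polynomials over the cyclotomic quotient ring\<close>

lemma type_ideal_pair: "type_ideal {s * a + t * b | s t. True}" for a b :: "'a::comm_ring_1"
proof (rule type_idealI)
  show "0 \<in> {s * a + t * b | s t. True}" by (intro CollectI exI[of _ 0]) simp
  fix f assume "f \<in> {s * a + t * b | s t. True}"
  then obtain s t where f: "f = s * a + t * b" by blast
  show "r * f \<in> {s * a + t * b | s t. True}" for r
    unfolding f by (intro CollectI exI[of _ "r * s"] exI[of _ "r * t"]) (simp add: algebra_simps)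
  fix h assume "h \<in> {s * a + t * b | s t. True}"
  then obtain s' t' where h: "h = s' * a + t' * b" by blast
  show "f + h \<in> {s * a + t * b | s t. True}"
    unfolding f h by (intro CollectI exI[of _ "s + s'"] exI[of _ "t + t'"]) (simp add: algebra_simps)
qed

lemma pair_ideal_generators: "a \<in> {s * a + t * b | s t. True}" "b \<in> {s * a + t * b | s t. True}" for a b :: "'a::comm_ring_1"
proof -
  show "a \<in> {s * a + t * b | s t. True}" by (rule CollectI, rule exI[of _ 1], rule exI[of _ 0]) simp
  show "b \<in> {s * a + t * b | s t. True}" by (rule CollectI, rule exI[of _ 0], rule exI[of _ 1]) simp
qed

lemma carrier_UP_up: "carrier (UP R) = up R"
  by (simp add: UP_def)

lemma UP_operations:
  "f \<in> up R \<Longrightarrow> up_ring.coeff (UP R) f n = f n"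
  "f \<in> up R \<Longrightarrow> h \<in> up R \<Longrightarrow> f \<oplus>\<^bsub>UP R\<^esub> h = (\<lambda>i. f i \<oplus>\<^bsub>R\<^esub> h i)"
  "f \<in> up R \<Longrightarrow> h \<in> up R \<Longrightarrow>
    f \<otimes>\<^bsub>UP R\<^esub> h = (\<lambda>n. \<Oplus>\<^bsub>R\<^esub>i\<in>{..n}. f i \<otimes>\<^bsub>R\<^esub> h (n - i))"
  "\<one>\<^bsub>UP R\<^esub> = (\<lambda>i. if i = 0 then \<one>\<^bsub>R\<^esub> else \<zero>\<^bsub>R\<^esub>)"
  "c \<in> carrier R \<Longrightarrow> up_ring.monom (UP R) c n = (\<lambda>i. if i = n then c else \<zero>\<^bsub>R\<^esub>)"
  by (simp_all add: UP_def)

text \<open>The map \<open>sub\<close> from \<open>\<rat>[x,y]\<close> onto \<open>\<K>\<^sub>\<delta>[y]\<close> has kernel \<open>\<langle>\<Phi>\<rangle>\<close>. Divisibility, degrees and gcds of monic polynomials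
over \<open>K\<close> are thereby statements about \<open>\<rat>[x,y]\<close> modulo \<open>[:\<Phi>:]\<close>.\<close>

locale cyclotomic_quotient =
  fixes \<delta> :: nat
  assumes pos: "\<delta> > 0"
begin

abbreviation "\<Phi> \<equiv> cyclotomic (2 * \<delta>)"
abbreviation "K \<equiv> K_cyc \<delta>"
abbreviation "cls \<equiv> cyc_class \<delta>"

lemma cyc_ideal_iff: "f \<in> cyc_ideal \<delta> \<longleftrightarrow> \<Phi> dvd f"
  unfolding cyc_ideal_def cgenideal_def by (auto simp: dvd_def mult.commute)

sublocale I: ideal "cyc_ideal \<delta>" "ring_of_type_algebra :: rat poly ring"
  unfolding cyc_ideal_def by (rule cring.cgenideal_ideal[OF cring_from_type_algebra]) simp

sublocale K: cring K
  unfolding K_cyc_def by (rule I.quotient_is_cring[OF cring_from_type_algebra])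

sublocale cls: ring_hom_cring "ring_of_type_algebra :: rat poly ring" K cls
  unfolding K_cyc_def cyc_class_def[abs_def] by (rule I.rcos_ring_hom_cring[OF cring_from_type_algebra])

sublocale U: UP_cring K "UP K"
  by unfold_locales simp

lemma cls_closed [simp]: "cls f \<in> carrier K"
  by simp

lemma carrier_K: "carrier K = range cls"
  unfolding K_cyc_def cyc_class_def[abs_def] by (auto simp: FactRing_def A_RCOSETS_def')

lemma cls_eq_iff: "cls f = cls h \<longleftrightarrow> \<Phi> dvd f - h"
proof
  assume "\<Phi> dvd f - h"
  then have "f - h \<in> cyc_ideal \<delta>" by (simp add: cyc_ideal_iff)
  then have "cls (f - h) = \<zero>\<^bsub>K\<^esub>"
    unfolding K_cyc_def cyc_class_def FactRing_def using I.a_rcos_const by simp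
  then have "cls ((f - h) + h) = cls h" using cls.hom_add[of "f - h" h] by simp
  then show "cls f = cls h" by simp
next
  assume "cls f = cls h"
  moreover have "f \<in> cls f" unfolding cyc_class_def by (rule I.a_rcos_self) simp
  ultimately have "f \<in> cyc_ideal \<delta> +>\<^bsub>ring_of_type_algebra\<^esub> h" unfolding cyc_class_def by simp
  then obtain i where "i \<in> cyc_ideal \<delta>" "f = i + h" by (auto simp: a_r_coset_def')
  then show "\<Phi> dvd f - h" by (simp add: cyc_ideal_iff)
qed

lemma cls_simps:
  "cls (f + h) = cls f \<oplus>\<^bsub>K\<^esub> cls h" "cls (f * h) = cls f \<otimes>\<^bsub>K\<^esub> cls h"
  "cls 1 = \<one>\<^bsub>K\<^esub>" "cls 0 = \<zero>\<^bsub>K\<^esub>"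
  using cls.hom_add[of f h] cls.hom_mult[of f h] cls.hom_one cls.hom_zero by simp_all

lemma cls_sum: "finite A \<Longrightarrow> cls (sum f A) = (\<Oplus>\<^bsub>K\<^esub>i\<in>A. cls (f i))"
  by (induction A rule: finite_induct) (simp_all add: cls_simps)

lemma Phi_not_unit: "\<not> \<Phi> dvd 1"
proof
  assume "\<Phi> dvd 1"
  then have "Polynomial.degree \<Phi> = 0" by (simp add: poly_dvd_1)
  then show False using degree_cyclotomic_pos[of "2 * \<delta>"] pos by simp
qed

lemma K_nontrivial: "\<one>\<^bsub>K\<^esub> \<noteq> \<zero>\<^bsub>K\<^esub>"
  using cls_eq_iff[of 1 0] Phi_not_unit by (simp add: cls_simps)

abbreviation "sub \<equiv> subst_x \<delta>"

lemma sub_closed [simp]: "sub f \<in> carrier (UP K)"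
proof -
  have "bound \<zero>\<^bsub>K\<^esub> (Polynomial.degree f) (sub f)"
    by (rule bound.intro) (simp add: subst_x_def coeff_eq_0 cls_simps)
  then have "\<exists>n. bound \<zero>\<^bsub>K\<^esub> n (sub f)" by (rule exI)
  then have "sub f \<in> up K" by (rule mem_upI[rotated]) (simp only: subst_x_def cls_closed)
  then show ?thesis unfolding carrier_UP_up .
qed

lemma sub_up: "sub f \<in> up K"
  using sub_closed[of f] unfolding carrier_UP_up .

lemma sub_apply: "sub f n = cls (Polynomial.coeff f n)"
  by (simp only: subst_x_def)

lemma coeff_sub: "up_ring.coeff (UP K) (sub f) n = cls (Polynomial.coeff f n)"
  unfolding UP_operations(1)[OF sub_up] sub_apply ..

lemma sub_eq_iff: "sub f = sub h \<longleftrightarrow> [:\<Phi>:] dvd f - h"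
  by (simp add: subst_x_def fun_eq_iff cls_eq_iff const_poly_dvd_iff)

lemma sub_ring_hom: "sub \<in> Ring.ring_hom Rxy (UP K)"
proof (rule ring_hom_memI)
  fix f h :: "rat poly poly"
  show "sub (f \<otimes>\<^bsub>Rxy\<^esub> h) = sub f \<otimes>\<^bsub>UP K\<^esub> sub h"
  proof
    fix n
    have "sub (f * h) n = (\<Oplus>\<^bsub>K\<^esub>i\<in>{..n}. sub f i \<otimes>\<^bsub>K\<^esub> sub h (n - i))"
      by (simp add: sub_apply coeff_mult cls_sum cls_simps)
    then show "sub (f \<otimes>\<^bsub>Rxy\<^esub> h) n = (sub f \<otimes>\<^bsub>UP K\<^esub> sub h) n"
      unfolding UP_operations(3)[OF sub_up sub_up] by simp
  qed
  show "sub (f \<oplus>\<^bsub>Rxy\<^esub> h) = sub f \<oplus>\<^bsub>UP K\<^esub> sub h"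
    unfolding UP_operations(2)[OF sub_up sub_up] by (rule ext) (simp add: sub_apply cls_simps)
  show "sub \<one>\<^bsub>Rxy\<^esub> = \<one>\<^bsub>UP K\<^esub>"
    unfolding UP_operations(4) by (rule ext) (simp add: sub_apply cls_simps)
qed simp

sublocale sub: ring_hom_cring Rxy "UP K" sub
  using sub_ring_hom U.P.cring_axioms
  by (intro ring_hom_cring.intro ring_hom_cring_axioms.intro cring_from_type_algebra) (auto intro: U.UP_cring)

lemma sub_simps:
  "sub (f * h) = sub f \<otimes>\<^bsub>UP K\<^esub> sub h" "sub (f + h) = sub f \<oplus>\<^bsub>UP K\<^esub> sub h"
  "sub 1 = \<one>\<^bsub>UP K\<^esub>" "sub 0 = \<zero>\<^bsub>UP K\<^esub>"
  using sub.hom_mult[of f h] sub.hom_add[of f h] sub.hom_one sub.hom_zero by simp_all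

lemma sub_diff: "sub (f - h) = sub f \<ominus>\<^bsub>UP K\<^esub> sub h"
proof -
  have "sub f = sub (f - h) \<oplus>\<^bsub>UP K\<^esub> sub h" using sub_simps(2)[of "f - h" h] by simp
  then show ?thesis by (simp add: U.P.minus_eq U.P.a_assoc U.P.r_neg)
qed

lemma sub_power: "sub (f ^ n) = sub f [^]\<^bsub>UP K\<^esub> n"
  by (induction n) (simp_all add: sub_simps mult.commute U.P.m_comm)

lemma sub_monom: "sub (Polynomial.monom c n) = up_ring.monom (UP K) (cls c) n"
  unfolding UP_operations(5)[OF cls_closed] by (rule ext) (simp add: sub_apply cls_simps)

lemma exists_lift:
  assumes "p \<in> carrier (UP K)"
  obtains f where "p = sub f"
proof -
  have p: "p \<in> up K" using assms unfolding carrier_UP_up .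
  obtain N where "bound \<zero>\<^bsub>K\<^esub> N p" using K.bound_upD[OF p] by blast
  then have N: "\<And>n. n > N \<Longrightarrow> p n = \<zero>\<^bsub>K\<^esub>" by (rule bound.bound)
  have "\<forall>n. \<exists>c. p n = cls c" using mem_upD[OF p] unfolding carrier_K by blast
  then obtain c where c: "\<And>n. p n = cls (c n)" by metis
  define f where "f = (\<Sum>i\<le>N. Polynomial.monom (c i) i)"
  have "Polynomial.coeff f n = (if n \<le> N then c n else 0)" for n
    by (simp add: f_def Polynomial.coeff_sum)
  then have "p n = sub f n" for n using N[of n] c[of n] by (simp add: sub_apply cls_simps)
  then have "p = sub f" by (rule ext)
  then show ?thesis by (rule that)
qed

lemma carrier_UP: "carrier (UP K) = range sub"
proof (intro equalityI subsetI)
  fix p assume "p \<in> carrier (UP K)"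
  then obtain f where "p = sub f" by (rule exists_lift)
  then show "p \<in> range sub" by (simp only: rangeI)
next
  fix p assume "p \<in> range sub"
  then show "p \<in> carrier (UP K)" by (elim rangeE) (simp only: sub_closed)
qed

lemma deg_sub_monic:
  assumes "Polynomial.lead_coeff f = 1"
  shows "deg K (sub f) = Polynomial.degree f"
proof (rule antisym)
  show "deg K (sub f) \<le> Polynomial.degree f"
    by (rule U.deg_aboveI) (simp_all add: coeff_sub coeff_eq_0 cls_simps)
  show "Polynomial.degree f \<le> deg K (sub f)"
    by (rule U.deg_belowI) (use assms K_nontrivial in \<open>simp_all add: coeff_sub cls_simps\<close>)
qed

text \<open>Lift the coefficients below the degree arbitrarily, and the leading one to \<open>1\<close> itself.\<close>

lemma exists_monic_lift:
  assumes p: "p \<in> carrier (UP K)" and lc: "up_ring.coeff (UP K) p (deg K p) = \<one>\<^bsub>K\<^esub>"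
  obtains f where "p = sub f" "Polynomial.lead_coeff f = 1"
proof -
  obtain h where h: "p = sub h" using exists_lift[OF p] .
  let ?d = "deg K p"
  define f where "f = Polynomial.monom 1 ?d + (\<Sum>i<?d. Polynomial.monom (Polynomial.coeff h i) i)"
  have f: "Polynomial.coeff f n = (if n = ?d then 1 else if n < ?d then Polynomial.coeff h n else 0)" for n
    by (simp add: f_def Polynomial.coeff_sum)
  have "Polynomial.degree f = ?d"
    by (rule antisym) (auto intro!: degree_le le_degree simp: f)
  then have lcf: "Polynomial.lead_coeff f = 1" by (simp add: f)
  have "cls (Polynomial.coeff h n) = cls (Polynomial.coeff f n)" for n
    using U.deg_aboveD[OF _ p, of n] lc by (auto simp: f h coeff_sub cls_simps)
  then have "p = sub f" unfolding h by (intro ext) (simp only: sub_apply)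
  then show ?thesis using lcf by (rule that)
qed

lemma sub_divides_iff:
  "sub f divides\<^bsub>UP K\<^esub> sub h \<longleftrightarrow> (\<exists>s t. h = s * f + t * [:\<Phi>:])"
proof
  assume "sub f divides\<^bsub>UP K\<^esub> sub h"
  then obtain c where "c \<in> carrier (UP K)" "sub h = sub f \<otimes>\<^bsub>UP K\<^esub> c" by (auto simp: factor_def)
  then obtain s where "sub h = sub (f * s)" by (metis exists_lift sub_simps(1))
  then obtain t where "h - f * s = [:\<Phi>:] * t" unfolding sub_eq_iff by (auto simp: dvd_def)
  then have "h = s * f + t * [:\<Phi>:]" by (simp add: algebra_simps)
  then show "\<exists>s t. h = s * f + t * [:\<Phi>:]" by blast
next
  assume "\<exists>s t. h = s * f + t * [:\<Phi>:]"
  then obtain s t where "h = s * f + t * [:\<Phi>:]" by blast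
  then have "h - f * s = [:\<Phi>:] * t" by (simp add: algebra_simps)
  then have "[:\<Phi>:] dvd h - f * s" by (rule dvdI)
  then have "sub h = sub f \<otimes>\<^bsub>UP K\<^esub> sub s" unfolding sub_simps(1)[symmetric] sub_eq_iff .
  then show "sub f divides\<^bsub>UP K\<^esub> sub h" by (auto simp: factor_def)
qed

lemma monic_divides_degree_le:
  assumes "Polynomial.lead_coeff p = 1" "Polynomial.lead_coeff q = 1"
    and dvd: "sub p divides\<^bsub>UP K\<^esub> sub q"
  shows "Polynomial.degree p \<le> Polynomial.degree q"
proof (rule ccontr)
  assume "\<not> ?thesis"
  then have d: "Polynomial.degree (- q) < Polynomial.degree p" by simp
  obtain s t where q: "q = s * p + t * [:\<Phi>:]" using dvd unfolding sub_divides_iff by blast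
  then have "s * p + - q = [:\<Phi>:] * (- t)" by (simp add: algebra_simps)
  then have "[:\<Phi>:] dvd s * p + - q" by (rule dvdI)
  then have "[:\<Phi>:] dvd s" using const_dvd_monic_mult_add[of p "- q" \<Phi> s] assms(1) d by blast
  then have "[:\<Phi>:] dvd q" unfolding q by (intro dvd_add dvd_mult2 dvd_triv_right)
  then have "\<Phi> dvd 1" using assms(2) by (metis const_poly_dvd_iff)
  then show False using Phi_not_unit by blast
qed

text \<open>The degrees agree, so \<open>p - q\<close> has smaller degree than \<open>p\<close> while \<open>p\<close> divides it modulo \<open>\<Phi>\<close>. Uniqueness of
monic division makes the quotient, and then \<open>p - q\<close>, vanish modulo \<open>\<Phi>\<close>.\<close>

lemma monic_associated_unique:
  assumes p: "Polynomial.lead_coeff p = 1" and q: "Polynomial.lead_coeff q = 1"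
    and dvd: "sub p divides\<^bsub>UP K\<^esub> sub q" "sub q divides\<^bsub>UP K\<^esub> sub p"
  shows "sub p = sub q"
proof -
  have deg: "Polynomial.degree p = Polynomial.degree q"
    using monic_divides_degree_le[OF p q dvd(1)] monic_divides_degree_le[OF q p dvd(2)] by simp
  obtain s t where st: "q = s * p + t * [:\<Phi>:]" using dvd(1) unfolding sub_divides_iff by blast
  have small: "p - q = 0 \<or> Polynomial.degree (p - q) < Polynomial.degree p"
  proof (cases "Polynomial.degree p = 0")
    case True
    then have "p = 1" "q = 1" using p q deg by (metis degree_eq_zeroE coeff_pCons_0 degree_pCons_0 one_pCons)+
    then show ?thesis by simp
  next
    case False
    have "Polynomial.degree (p - q) \<noteq> Polynomial.degree p"
    proof
      assume eq: "Polynomial.degree (p - q) = Polynomial.degree p"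
      have "Polynomial.lead_coeff (p - q) = 0" unfolding eq using p q deg by simp
      then have "p - q = 0" by (simp only: leading_coeff_0_iff)
      then show False using eq False by simp
    qed
    moreover have "Polynomial.degree (p - q) \<le> Polynomial.degree p"
      using degree_diff_le[of p "Polynomial.degree p" q] deg by simp
    ultimately show ?thesis by simp
  qed
  have "(s - 1) * p + (p - q) = [:\<Phi>:] * (- t)" unfolding st by (simp add: algebra_simps)
  then have 1: "[:\<Phi>:] dvd (s - 1) * p + (p - q)" by (rule dvdI)
  then have 2: "[:\<Phi>:] dvd s - 1" by (rule const_dvd_monic_mult_add[OF p small])
  have "[:\<Phi>:] dvd ((s - 1) * p + (p - q)) - (s - 1) * p" by (rule dvd_diff[OF 1 dvd_mult2[OF 2]])
  then show ?thesis unfolding sub_eq_iff by simp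
qed

lemma monic_gcd_unique:
  assumes "monic_gcd K P a b" "monic_gcd K Q a b"
  shows "P = Q"
proof -
  obtain p where p: "P = sub p" "Polynomial.lead_coeff p = 1"
    using assms(1) unfolding monic_gcd_def by (elim conjE, elim exists_monic_lift)
  obtain q where q: "Q = sub q" "Polynomial.lead_coeff q = 1"
    using assms(2) unfolding monic_gcd_def by (elim conjE, elim exists_monic_lift)
  have "P divides\<^bsub>UP K\<^esub> Q" "Q divides\<^bsub>UP K\<^esub> P"
    using assms unfolding monic_gcd_def isgcd_def by auto
  then show ?thesis using monic_associated_unique p q by simp
qed

text \<open>\<open>sub f\<close> divides \<open>sub h\<close> exactly if \<open>h\<close> lies in the ideal \<open>\<langle>f, \<Phi>\<rangle>\<close>. With these ideals for \<open>S\<close>, the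
hypothesis says that \<open>p\<close> has the same divisors as the pair \<open>a\<close>, \<open>b\<close>.\<close>

lemma monic_gcdI:
  assumes p: "Polynomial.lead_coeff p = 1"
    and mem: "\<And>S. type_ideal S \<Longrightarrow> [:\<Phi>:] \<in> S \<Longrightarrow> p \<in> S \<longleftrightarrow> a \<in> S \<and> b \<in> S"
  shows "monic_gcd K (sub p) (sub a) (sub b)"
proof -
  have iff: "sub f divides\<^bsub>UP K\<^esub> sub p \<longleftrightarrow>
      sub f divides\<^bsub>UP K\<^esub> sub a \<and> sub f divides\<^bsub>UP K\<^esub> sub b" for f
    using mem[OF type_ideal_pair pair_ideal_generators(2), of f] unfolding sub_divides_iff by simp
  have refl: "sub p divides\<^bsub>UP K\<^esub> sub p" by (rule U.P.divides_refl) simp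
  show ?thesis
    unfolding monic_gcd_def isgcd_def
  proof (intro conjI ballI impI)
    show "up_ring.coeff (UP K) (sub p) (deg K (sub p)) = \<one>\<^bsub>K\<^esub>"
      unfolding deg_sub_monic[OF p] using p by (simp add: coeff_sub cls_simps)
    show "sub p divides\<^bsub>UP K\<^esub> sub a" "sub p divides\<^bsub>UP K\<^esub> sub b" using iff[of p] refl by blast+
    fix y assume "y \<in> carrier (UP K)"
      and y: "y divides\<^bsub>UP K\<^esub> sub a \<and> y divides\<^bsub>UP K\<^esub> sub b"
    then obtain f where f: "y = sub f" by (elim exists_lift)
    show "y divides\<^bsub>UP K\<^esub> sub p" using y unfolding f iff .
  qed simp
qed

lemma p_gcd_eq:
  assumes "monic_gcd K P (sub (G_poly k)) (sub (H_poly m))"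
  shows "p_gcd k m \<delta> = P"
  unfolding p_gcd_def
proof (rule the_equality)
  show "monic_gcd K P (sub (G_poly k)) (sub (H_poly m))" by (rule assms)
qed (rule monic_gcd_unique[OF _ assms])

end

section \<open>Codimension of rational subspaces\<close>

definition rat_const :: "rat \<Rightarrow> rat poly poly" where "rat_const c = [:[:c:]:]"

lemma rat_const_simps: "rat_const (a + b) = rat_const a + rat_const b" "rat_const (a * b) = rat_const a * rat_const b" "rat_const 1 = 1" "rat_const 0 = 0" "rat_const (- a) = - rat_const a"
  by (simp_all add: rat_const_def one_pCons)

definition rat_subspace :: "rat poly poly set \<Rightarrow> bool" where
  "rat_subspace V \<longleftrightarrow> 0 \<in> V \<and> (\<forall>f\<in>V. \<forall>h\<in>V. f + h \<in> V) \<and> (\<forall>f\<in>V. \<forall>c. rat_const c * f \<in> V)"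

definition add_line :: "rat poly poly \<Rightarrow> rat poly poly set \<Rightarrow> rat poly poly set" where
  "add_line f V = {h + rat_const c * f | h c. h \<in> V}"

text \<open>\<open>codim_chain n V W\<close>: the space \<open>W\<close> arises from \<open>V\<close> by adjoining \<open>n\<close> vectors one at a time, each outside the
space reached so far. It has the shape of the inductive predicate \<open>ring.dimension\<close>, and
becomes it in the quotient by \<open>V\<close>; working upstairs keeps one ambient ring for all ideals.\<close>

inductive codim_chain :: "nat \<Rightarrow> rat poly poly set \<Rightarrow> rat poly poly set \<Rightarrow> bool" where
  codim_refl: "codim_chain 0 V V"
| codim_step: "codim_chain n V W \<Longrightarrow> f \<notin> W \<Longrightarrow> codim_chain (Suc n) V (add_line f W)"

lemma codim_chain_trans:
  assumes "codim_chain b V W" "codim_chain a U V"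
  shows "codim_chain (a + b) U W"
  using assms by (induction rule: codim_chain.induct) (auto intro: codim_step)

lemma add_lineI: "h \<in> V \<Longrightarrow> f = h + rat_const c * b \<Longrightarrow> f \<in> add_line b V"
  unfolding add_line_def by blast

lemma add_lineE: "f \<in> add_line b V \<Longrightarrow> (\<And>h c. h \<in> V \<Longrightarrow> f = h + rat_const c * b \<Longrightarrow> thesis) \<Longrightarrow> thesis"
  unfolding add_line_def by blast

lemma
  assumes "rat_subspace V"
  shows rat_subspace_0: "0 \<in> V"
    and rat_subspace_add: "f \<in> V \<Longrightarrow> h \<in> V \<Longrightarrow> f + h \<in> V"
    and rat_subspace_scale: "f \<in> V \<Longrightarrow> rat_const c * f \<in> V"
  using assms unfolding rat_subspace_def by simp_all

lemma rat_subspace_diff: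
  assumes "rat_subspace V" "f \<in> V" "h \<in> V"
  shows "f - h \<in> V"
proof -
  have "f + rat_const (- 1) * h \<in> V" using assms by (intro rat_subspace_add rat_subspace_scale)
  then show ?thesis by (simp add: rat_const_simps)
qed

lemma type_ideal_rat_subspace: "type_ideal V \<Longrightarrow> rat_subspace V"
  unfolding rat_subspace_def by (intro conjI ballI allI type_ideal_0 type_ideal_add type_ideal_mult)

lemma rat_subspace_add_line:
  assumes V: "rat_subspace V"
  shows "rat_subspace (add_line b V)"
  unfolding rat_subspace_def
proof (intro conjI ballI allI)
  show "0 \<in> add_line b V" by (rule add_lineI[OF rat_subspace_0[OF V], of _ 0]) (simp add: rat_const_simps)
  fix f assume "f \<in> add_line b V"
  then obtain v c where f: "v \<in> V" "f = v + rat_const c * b" by (rule add_lineE)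
  show "rat_const s * f \<in> add_line b V" for s
    by (rule add_lineI[OF rat_subspace_scale[OF V f(1), of s], of _ "s * c"]) (simp add: f(2) rat_const_simps algebra_simps)
  fix h assume "h \<in> add_line b V"
  then obtain v' c' where h: "v' \<in> V" "h = v' + rat_const c' * b" by (rule add_lineE)
  show "f + h \<in> add_line b V"
    by (rule add_lineI[OF rat_subspace_add[OF V f(1) h(1)], of _ "c + c'"])
       (simp add: f(2) h(2) rat_const_simps algebra_simps)
qed

lemma subset_add_line: "V \<subseteq> add_line b V"
  by (rule subsetI, rule add_lineI[where c = 0]) (simp_all add: rat_const_simps)

lemma mem_add_line: "rat_subspace V \<Longrightarrow> b \<in> add_line b V"
  by (rule add_lineI[OF rat_subspace_0, where c = 1]) (simp_all add: rat_const_simps)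

lemma codim_chain_subspace:
  assumes "codim_chain n V W" "rat_subspace V"
  shows "rat_subspace W \<and> V \<subseteq> W"
  using assms
proof (induction rule: codim_chain.induct)
  case (codim_step n V W f)
  then show ?case using rat_subspace_add_line[of W f] subset_add_line[of W f] by auto
qed simp

text \<open>The isomorphism \<open>W/V \<cong> (W \<inter> J)/(V \<inter> J)\<close> for \<open>W \<subseteq> V + J\<close>: every vector that is adjoined to \<open>V\<close> can be
corrected by an element of \<open>V\<close> so as to lie in \<open>J\<close>.\<close>

lemma codim_chain_Int:
  assumes "codim_chain n V W" "rat_subspace V" "rat_subspace J"
    and "\<forall>f\<in>W. \<exists>v\<in>V. f - v \<in> J"
  shows "codim_chain n (V \<inter> J) (W \<inter> J)"
  using assms
proof (induction rule: codim_chain.induct)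
  case (codim_step n V W f)
  have sub: "rat_subspace W" "V \<subseteq> W"
    using codim_chain_subspace[OF codim_step.hyps(1) codim_step.prems(1)] by simp_all
  have "codim_chain n (V \<inter> J) (W \<inter> J)"
    using codim_step.IH codim_step.prems subsetD[OF subset_add_line, of _ W f] by simp
  moreover obtain v where v: "v \<in> V" "f - v \<in> J"
    using codim_step.prems(3) mem_add_line[OF sub(1)] by blast
  define j where "j = f - v"
  have vW: "v \<in> W" by (rule subsetD[OF sub(2) v(1)])
  have j: "j \<in> J" "j \<notin> W"
    using v codim_step.hyps rat_subspace_add[OF sub(1) _ vW, of j] by (auto simp: j_def)
  moreover have "add_line f W \<inter> J = add_line j (W \<inter> J)"
  proof (intro equalityI subsetI)
    fix x assume x: "x \<in> add_line f W \<inter> J"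
    then obtain h c where h: "h \<in> W" "x = h + rat_const c * f" by (elim IntE add_lineE) (rule that)
    let ?h = "h + rat_const c * v"
    have eq: "x = ?h + rat_const c * j" by (simp add: h(2) j_def algebra_simps)
    have "?h \<in> W" by (intro rat_subspace_add[OF sub(1)] rat_subspace_scale[OF sub(1)] h(1) vW)
    moreover have "?h = x - rat_const c * j" using eq by simp
    then have "?h \<in> J"
      using rat_subspace_diff[OF codim_step.prems(2), of x] rat_subspace_scale[OF codim_step.prems(2) j(1)] x by simp
    ultimately show "x \<in> add_line j (W \<inter> J)" by (intro add_lineI[OF _ eq] IntI)
  next
    fix x assume "x \<in> add_line j (W \<inter> J)"
    then obtain h c where h: "h \<in> W" "h \<in> J" "x = h + rat_const c * j"
      by (elim add_lineE IntE) (rule that)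
    have "h - rat_const c * v \<in> W" by (intro rat_subspace_diff[OF sub(1)] rat_subspace_scale[OF sub(1)] h(1) vW)
    then have "x \<in> add_line f W"
      by (rule add_lineI[where c = c]) (simp add: h(3) j_def algebra_simps)
    moreover have "x \<in> J" unfolding h(3)
      by (intro rat_subspace_add[OF codim_step.prems(2)] rat_subspace_scale[OF codim_step.prems(2)] h(2) j(1))
    ultimately show "x \<in> add_line f W \<inter> J" by simp
  qed
  ultimately show ?case using codim_chain.codim_step[of n "V \<inter> J" "W \<inter> J" j] by simp
qed (rule codim_refl)

text \<open>If \<open>a\<close> and \<open>b\<close> in \<open>J\<close> are \<open>1\<close> modulo two ideals, then \<open>a + b - a b\<close>, that is \<open>1 - (1 - a) (1 - b)\<close>, is \<open>1\<close>
modulo both.\<close>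

lemma comaximal_Inter:
  assumes "finite F" "type_ideal J" "\<And>i. i \<in> F \<Longrightarrow> type_ideal (N i)" "\<And>i. i \<in> F \<Longrightarrow> \<exists>a\<in>J. 1 - a \<in> N i"
  shows "\<exists>a\<in>J. 1 - a \<in> (\<Inter>i\<in>F. N i)"
  using assms(1,3,4)
proof (induction F rule: finite_induct)
  case empty
  show ?case using type_ideal_0[OF assms(2)] by auto
next
  case (insert i F)
  have "\<exists>a\<in>J. 1 - a \<in> (\<Inter>i\<in>F. N i)" by (rule insert.IH) (simp_all add: insert.prems)
  then obtain a where a: "a \<in> J" "1 - a \<in> (\<Inter>i\<in>F. N i)" by (elim bexE)
  have "\<exists>b\<in>J. 1 - b \<in> N i" by (rule insert.prems(2)) simp
  then obtain b where b: "b \<in> J" "1 - b \<in> N i" by (elim bexE)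
  have "1 - (a + b - a * b) = (1 - a) * (1 - b)" by (simp add: algebra_simps)
  moreover have "(1 - a) * (1 - b) \<in> N j" if "j \<in> insert i F" for j
  proof (cases "j = i")
    case True
    then show ?thesis using type_ideal_mult[OF insert.prems(1)[of i] b(2)] by simp
  next
    case False
    then show ?thesis using that a(2) type_ideal_mult2[OF insert.prems(1)[OF that]] by simp
  qed
  ultimately have "1 - (a + b - a * b) \<in> (\<Inter>i\<in>insert i F. N i)" by simp
  moreover have "a + b - a * b \<in> J"
    using a(1) b(1) by (intro type_ideal_diff[OF assms(2)] type_ideal_add[OF assms(2)] type_ideal_mult[OF assms(2)])
  ultimately show ?case by (intro bexI)
qed

lemma type_ideal_Inter: "(\<And>i. i \<in> F \<Longrightarrow> type_ideal (N i)) \<Longrightarrow> type_ideal (\<Inter>i\<in>F. N i)"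
  by (rule type_idealI) (simp_all add: type_ideal_0 type_ideal_add type_ideal_mult)

text \<open>Intersecting the chain for \<open>N i\<close> with the intersection \<open>M\<close> of the other ideals gives a chain from
\<open>N i \<inter> M\<close> to \<open>M\<close>, since \<open>N i\<close> and \<open>M\<close> are comaximal; continue with the chain for \<open>M\<close>.\<close>

lemma codim_chain_Inter:
  assumes "finite F" "\<And>i. i \<in> F \<Longrightarrow> type_ideal (N i)" "\<And>i. i \<in> F \<Longrightarrow> codim_chain (n i) (N i) UNIV"
    and "\<And>i j. i \<in> F \<Longrightarrow> j \<in> F \<Longrightarrow> i \<noteq> j \<Longrightarrow> \<exists>a\<in>N i. 1 - a \<in> N j"
  shows "codim_chain (\<Sum>i\<in>F. n i) (\<Inter>i\<in>F. N i) UNIV"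
  using assms
proof (induction F rule: finite_induct)
  case empty
  show ?case by (simp add: codim_refl)
next
  case (insert i F)
  let ?M = "\<Inter>i\<in>F. N i"
  have M: "type_ideal ?M" using insert.prems(1) by (intro type_ideal_Inter) simp
  have Ni: "type_ideal (N i)" using insert.prems(1) by simp
  have IH: "codim_chain (\<Sum>i\<in>F. n i) ?M UNIV" using insert.prems by (intro insert.IH) simp_all
  have "\<exists>a\<in>N i. 1 - a \<in> N j" if "j \<in> F" for j
    using insert.prems(3)[of i j] insert.hyps that by blast
  then have "\<exists>a\<in>N i. 1 - a \<in> ?M"
    by (intro comaximal_Inter[OF insert.hyps(1) Ni]) (simp_all add: insert.prems(1))
  then obtain a where a: "a \<in> N i" "1 - a \<in> ?M" by (elim bexE)
  have "\<exists>v\<in>N i. f - v \<in> ?M" for f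
  proof (rule bexI[of _ "f * a"])
    show "f * a \<in> N i" using type_ideal_mult[OF Ni a(1)] .
    have "f - f * a = f * (1 - a)" by (simp add: algebra_simps)
    then show "f - f * a \<in> ?M" using type_ideal_mult[OF M a(2)] by (simp only:)
  qed
  then have "codim_chain (n i) (N i \<inter> ?M) (UNIV \<inter> ?M)"
    by (intro codim_chain_Int ballI type_ideal_rat_subspace Ni M) (simp_all add: insert.prems(2))
  then have "codim_chain (n i) (N i \<inter> ?M) ?M" by simp
  from codim_chain_trans[OF IH this] show ?case using insert.hyps by simp
qed

lemma codim_chain_dimension:
  assumes I: "type_ideal I" and chain: "codim_chain n I W"
  shows "ring.dimension (Rxy Quot I) n (rat_scalars I) ((\<lambda>f. I +>\<^bsub>Rxy\<^esub> f) ` W)"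
proof -
  interpret I: ideal I Rxy by (rule I)
  interpret Q: ring "Rxy Quot I" by (rule I.quotient_is_ring)
  interpret h: ring_hom_ring Rxy "Rxy Quot I" "(+>\<^bsub>Rxy\<^esub>) I" by (rule I.rcos_ring_hom_ring)
  let ?c = "\<lambda>f. I +>\<^bsub>Rxy\<^esub> f"
  have hom: "?c (f + h) = ?c f \<oplus>\<^bsub>Rxy Quot I\<^esub> ?c h" "?c (f * h) = ?c f \<otimes>\<^bsub>Rxy Quot I\<^esub> ?c h" for f h
    using h.hom_add[of f h] h.hom_mult[of f h] by simp_all
  have eqD: "f - h \<in> I" if "?c f = ?c h" for f h
  proof -
    have "f \<in> ?c f" by (rule I.a_rcos_self) simp
    then have "f \<in> ?c h" using that by simp
    then obtain i where "i \<in> I" "f = i + h" by (auto simp: a_r_coset_def')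
    then show ?thesis by simp
  qed
  have "Q.dimension n (rat_scalars I) (?c ` W)" if "codim_chain n V W" "V = I" for n V W
    using that
  proof (induction rule: codim_chain.induct)
    case (codim_refl V)
    have "?c f = \<zero>\<^bsub>Rxy Quot I\<^esub>" if "f \<in> I" for f
      using I.a_rcos_const[OF that] by (simp add: FactRing_def)
    then have "?c ` I = {\<zero>\<^bsub>Rxy Quot I\<^esub>}" using type_ideal_0[OF I] by (auto simp: image_iff)
    then show ?case unfolding codim_refl by (simp only: Q.zero_dim)
  next
    case (codim_step n V W f)
    have sub: "I \<subseteq> W" "rat_subspace W"
      using codim_chain_subspace[OF codim_step.hyps(1)] type_ideal_rat_subspace[OF I] codim_step.prems by simp_all
    have notin: "?c f \<notin> ?c ` W"
    proof
      assume "?c f \<in> ?c ` W"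
      then obtain w where w: "w \<in> W" "?c f = ?c w" by (elim imageE)
      have "f - w \<in> W" by (rule subsetD[OF sub(1) eqD[OF w(2)]])
      then have "f - w + w \<in> W" using w(1) by (rule rat_subspace_add[OF sub(2)])
      then show False using codim_step.hyps(2) by simp
    qed
    have line: "?c ` add_line f W = Q.line_extension (rat_scalars I) (?c f) (?c ` W)"
    proof (intro equalityI subsetI)
      fix x assume "x \<in> ?c ` add_line f W"
      then obtain h c where h: "h \<in> W" "x = ?c (h + rat_const c * f)" by (elim imageE add_lineE) (rule that, simp_all)
      have "x = ?c (rat_const c) \<otimes>\<^bsub>Rxy Quot I\<^esub> ?c f \<oplus>\<^bsub>Rxy Quot I\<^esub> ?c h"
        unfolding h(2) by (simp only: hom[symmetric] add.commute)
      moreover have "?c (rat_const c) \<in> rat_scalars I" unfolding rat_scalars_def rat_const_def by (rule rangeI)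
      ultimately show "x \<in> Q.line_extension (rat_scalars I) (?c f) (?c ` W)"
        unfolding Q.line_extension_def set_add_def' r_coset_def using h(1) by blast
    next
      fix x assume "x \<in> Q.line_extension (rat_scalars I) (?c f) (?c ` W)"
      then obtain c h where h: "h \<in> W" "x = ?c (rat_const c) \<otimes>\<^bsub>Rxy Quot I\<^esub> ?c f \<oplus>\<^bsub>Rxy Quot I\<^esub> ?c h"
        unfolding Q.line_extension_def set_add_def' r_coset_def rat_scalars_def rat_const_def by blast
      have "x = ?c (h + rat_const c * f)" unfolding h(2) by (simp only: hom[symmetric] add.commute)
      moreover have "h + rat_const c * f \<in> add_line f W" by (rule add_lineI[OF h(1) refl])
      ultimately show "x \<in> ?c ` add_line f W" by (rule image_eqI)
    qed
    have "?c f \<in> carrier (Rxy Quot I)" using h.hom_closed[of f] by simp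
    then show ?case unfolding line using codim_step.IH[OF codim_step.prems] notin by (intro Q.Suc_dim)
  qed
  then show ?thesis using chain by blast
qed

text \<open>The monomials \<open>x\<^sup>i y\<^sup>j\<close> with \<open>i < deg \<Phi>\<close> and \<open>j < deg p\<close> are adjoined one after the other. They exhaust the
ring by division by \<open>p\<close> and then by \<open>\<Phi>\<close>, and they are independent modulo \<open>\<langle>p, \<Phi>\<rangle>\<close> by uniqueness of
monic division.\<close>

lemma codim_chain_monic:
  fixes p :: "rat poly poly" and \<Phi> :: "rat poly"
  assumes p: "Polynomial.lead_coeff p = 1" and D: "Polynomial.degree \<Phi> > 0"
  shows "codim_chain (Polynomial.degree p * Polynomial.degree \<Phi>) {s * p + t * [:\<Phi>:] | s t. True} UNIV"
proof -
  let ?J = "{s * p + t * [:\<Phi>:] | s t. True}"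
  let ?d = "Polynomial.degree p" and ?D = "Polynomial.degree \<Phi>"
  have J: "type_ideal ?J" by (rule type_ideal_pair)
  \<comment> \<open>The span of the first n monomials, where x^i y^j has position j * deg Phi + i.\<close>
  define N where "N n = {r :: rat poly poly. \<forall>j i. Polynomial.coeff (Polynomial.coeff r j) i \<noteq> 0 \<longrightarrow> i < ?D \<and> j * ?D + i < n}" for n
  have N_diff: "r - r' \<in> N n" if "r \<in> N n" "r' \<in> N n" for r r' n
    using that unfolding N_def by (auto simp: ) (metis diff_zero)+
  have N_J: "r = 0" if r: "r \<in> N n" "n \<le> ?d * ?D" "r \<in> ?J" for r n
  proof -
    have zero: "Polynomial.coeff r j = 0" if "j \<ge> ?d" for j
    proof (rule poly_eqI)
      fix i
      have "?d * ?D \<le> j * ?D" using that by simp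
      then have "\<not> j * ?D + i < n" using r(2) by linarith
      then show "Polynomial.coeff (Polynomial.coeff r j) i = Polynomial.coeff 0 i" using r(1) unfolding N_def by auto
    qed
    have "- r = 0 \<or> Polynomial.degree (- r) < ?d"
    proof (cases "r = 0")
      case False
      then have "Polynomial.lead_coeff r \<noteq> 0" by simp
      then have "Polynomial.degree r < ?d" using zero not_less by blast
      then show ?thesis by simp
    qed simp
    moreover obtain s t where st: "r = s * p + t * [:\<Phi>:]" using r(3) by blast
    then have "s * p + - r = [:\<Phi>:] * (- t)" by (simp add: algebra_simps)
    then have "[:\<Phi>:] dvd s * p + - r" by (rule dvdI)
    ultimately have "[:\<Phi>:] dvd s" using const_dvd_monic_mult_add[OF p] by blast
    then have "[:\<Phi>:] dvd r" unfolding st by (intro dvd_add dvd_mult2 dvd_triv_right)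
    then have dvd: "\<Phi> dvd Polynomial.coeff r j" for j by (simp only: const_poly_dvd_iff)
    have "Polynomial.coeff r j = 0" for j
    proof (rule ccontr)
      assume nz: "Polynomial.coeff r j \<noteq> 0"
      then have "Polynomial.lead_coeff (Polynomial.coeff r j) \<noteq> 0" by simp
      then have "Polynomial.degree (Polynomial.coeff r j) < ?D" using r(1) unfolding N_def by blast
      then show False using dvd_imp_degree_le[OF dvd nz] by simp
    qed
    then show ?thesis by (simp add: poly_eq_iff)
  qed
  define W where "W n = {r + h | r h. r \<in> N n \<and> h \<in> ?J}" for n
  have chain: "codim_chain n ?J (W n)" if "n \<le> ?d * ?D" for n
    using that
  proof (induction n)
    case 0
    have "N 0 = {0}" unfolding N_def by (auto simp: poly_eq_iff)
    then have "W 0 = ?J" unfolding W_def by simp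
    then show ?case using codim_refl by simp
  next
    case (Suc n)
    define i j where "i = n mod ?D" and "j = n div ?D"
    have ij: "i < ?D" "j * ?D + i = n" using D by (simp_all add: i_def j_def)
    define b :: "rat poly poly" where "b = Polynomial.monom (Polynomial.monom 1 i) j"
    have coeff_b: "Polynomial.coeff (Polynomial.coeff (rat_const c * b) j') i' = (if j' = j \<and> i' = i then c else 0)" for c j' i'
      by (auto simp: b_def smult_monom rat_const_def)
    have uniq: "j' = j \<and> i' = i" if "i' < ?D" "j' * ?D + i' = n" for i' j'
      using that ij D by (metis add.commute div_mult_self3 div_less mod_mult_self3 mod_less add_0 i_def j_def less_imp_neq neq0_conv)
    have scale: "rat_const c * b \<in> N (Suc n)" for c
      unfolding N_def mem_Collect_eq coeff_b using ij by simp
    have "b \<notin> W n"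
    proof
      assume "b \<in> W n"
      then obtain r h where r: "b = r + h" "r \<in> N n" "h \<in> ?J" unfolding W_def by blast
      have "r \<in> N (Suc n)" using r(2) unfolding N_def by (auto simp: less_Suc_eq)
      then have "b - r \<in> N (Suc n)" using N_diff scale[of 1] by (simp add: rat_const_simps)
      moreover have "b - r \<in> ?J" using r(1,3) by simp
      ultimately have "b - r = 0" using N_J Suc.prems by blast
      then have "b \<in> N n" using r(2) by simp
      then have "Polynomial.coeff (Polynomial.coeff b j) i \<noteq> 0 \<longrightarrow> j * ?D + i < n" unfolding N_def by blast
      then show False using coeff_b[of 1 j i] ij by (simp add: rat_const_simps)
    qed
    moreover have "W (Suc n) = add_line b (W n)"
    proof (intro equalityI subsetI)
      fix f assume "f \<in> W (Suc n)"
      then obtain r h where r: "f = r + h" "r \<in> N (Suc n)" "h \<in> ?J" unfolding W_def by blast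
      define c where "c = Polynomial.coeff (Polynomial.coeff r j) i"
      have "r - rat_const c * b \<in> N n"
        using r(2) uniq unfolding N_def by (auto simp: coeff_b c_def less_Suc_eq)
      then have "(r - rat_const c * b) + h \<in> W n" using r(3) unfolding W_def by blast
      then show "f \<in> add_line b (W n)" by (rule add_lineI[where c = c]) (simp add: r(1))
    next
      fix f assume "f \<in> add_line b (W n)"
      then obtain w c where w: "w \<in> W n" "f = w + rat_const c * b" by (rule add_lineE)
      then obtain r h where r: "f = (r + h) + rat_const c * b" "r \<in> N n" "h \<in> ?J"
        unfolding W_def by blast
      have "r + rat_const c * b \<in> N (Suc n)"
        using r(2) ij unfolding N_def by (auto simp: coeff_b less_Suc_eq split: if_splits)
      moreover have "f = (r + rat_const c * b) + h" using r(1) by simp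
      ultimately show "f \<in> W (Suc n)" using r(3) unfolding W_def by blast
    qed
    ultimately show ?case using Suc codim_step by simp
  qed
  have "W (?d * ?D) = UNIV"
  proof (intro equalityI subsetI UNIV_I)
    fix f :: "rat poly poly"
    \<comment> \<open>Pseudo-division by a monic polynomial is ordinary division with remainder.\<close>
    obtain s r where sr: "pseudo_divmod f p = (s, r)" by (cases "pseudo_divmod f p")
    have "p \<noteq> 0" using p by auto
    note div = pseudo_divmod[OF this sr]
    have f: "f = p * s + r" using div(1) p by simp
    define r' where "r' = map_poly (\<lambda>c. c mod \<Phi>) r"
    have c: "Polynomial.coeff r' j = Polynomial.coeff r j mod \<Phi>" for j
      unfolding r'_def by (simp add: coeff_map_poly)
    have "[:\<Phi>:] dvd r - r'" unfolding const_poly_dvd_iff by (simp add: c mod_eq_dvd_iff[symmetric])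
    then obtain t where t: "r - r' = [:\<Phi>:] * t" by (rule dvdE)
    have \<Phi>0: "\<Phi> \<noteq> 0" using D by auto
    have a1: "r' \<in> N (?d * ?D)"
      unfolding N_def
    proof (intro CollectI allI impI)
      fix j i assume nz: "Polynomial.coeff (Polynomial.coeff r' j) i \<noteq> 0"
      then have "Polynomial.coeff r j mod \<Phi> \<noteq> 0" unfolding c by auto
      then have "Polynomial.degree (Polynomial.coeff r j mod \<Phi>) < ?D"
        using degree_mod_less[OF \<Phi>0, of "Polynomial.coeff r j"] by simp
      moreover have "i \<le> Polynomial.degree (Polynomial.coeff r j mod \<Phi>)"
        using nz unfolding c by (rule le_degree)
      ultimately have i: "i < ?D" by simp
      have "Polynomial.coeff r j \<noteq> 0" using nz c by auto
      then have "r \<noteq> 0" "j \<le> Polynomial.degree r" by (auto intro: le_degree)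
      then have "Suc j \<le> ?d" using div(2) by auto
      then have "Suc j * ?D \<le> ?d * ?D" by (rule mult_le_mono1)
      then show "i < ?D \<and> j * ?D + i < ?d * ?D" using i by simp
    qed
    have a2: "f = r' + (s * p + t * [:\<Phi>:])" using f t by (simp add: algebra_simps)
    have a3: "s * p + t * [:\<Phi>:] \<in> ?J" by (rule CollectI, rule exI, rule exI, rule conjI[OF refl TrueI])
    show "f \<in> W (?d * ?D)"
      unfolding W_def
      by (rule CollectI, rule exI[of _ r'], rule exI[of _ "s * p + t * [:\<Phi>:]"]) (intro conjI a1 a2 a3)
  qed
  then show ?thesis using chain[of "?d * ?D"] by simp
qed

section \<open>The gcd and the quotient over the cyclotomic quotient ring\<close>

lemma is_ring_isoI: "f \<in> ring_iso R S \<Longrightarrow> R \<simeq> S"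
  unfolding is_ring_iso_def by blast

lemma is_ring_isoE:
  assumes "R \<simeq> S" obtains f where "f \<in> ring_iso R S"
  using assms unfolding is_ring_iso_def by blast

lemma RDirProd_list_cong:
  assumes "list_all2 (\<lambda>R S. R \<simeq> S) Rs Ss"
  shows "RDirProd_list Rs \<simeq> RDirProd_list Ss"
  using assms
proof (induction rule: list_all2_induct)
  case Nil
  have "(\<lambda>_. []) \<in> ring_iso nil_ring nil_ring"
    by (simp add: ring_iso_def Ring.ring_hom_def bij_betw_def monoid.defs)
  then show ?case unfolding RDirProd_list_nil by (rule is_ring_isoI)
next
  case (Cons R Rs S Ss)
  obtain f where f: "f \<in> ring_iso R S" using Cons.hyps(1) by (rule is_ring_isoE)
  obtain h where h: "h \<in> ring_iso (RDirProd_list Rs) (RDirProd_list Ss)"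
    using Cons.IH by (rule is_ring_isoE)
  show ?case
    by (rule is_ring_isoI) (rule ring_iso_set_trans[OF ring_iso_set_trans[OF RDirProd_list_iso2 RDirProd_iso6[OF f h]] RDirProd_list_iso1])
qed

text \<open>Adding a multiple \<open>t\<close> of \<open>(k/g, -m/g)\<close> to a Bezout pair makes its first entry nonnegative and its second one
nonpositive; the exponent \<open>e\<close> grows by \<open>2 t lcm(m,k)\<close>. As \<open>x\<close> has order \<open>2\<delta>\<close> modulo \<open>\<Phi>\<close>, this does not
change \<open>x\<^sup>e\<close> when \<open>\<delta>\<close> divides the lcm.\<close>

lemma natural_bezout:
  fixes k m g :: nat and u v e :: int
  assumes pos: "k > 0" "m > 0" and g: "g = gcd m k" and bez: "u * int m + v * int k = int g"
    and e: "e = u * int m - v * int k"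
  obtains u' w t :: nat where "u' * m = g + w * k" "int (u' * m + w * k) = e + 2 * int (lcm m k) * int t"
proof -
  obtain m' k' where m': "m = g * m'" and k': "k = g * k'"
    using g by (metis gcd_dvd1 gcd_dvd2 dvdE)
  have gpos: "g > 0" using g pos by simp
  have L: "lcm m k = k * m'"
  proof -
    have "g * lcm m k = g * (k * m')"
      using prod_gcd_lcm_nat[of m k] m' unfolding g[symmetric] by (metis mult.assoc mult.commute)
    then show ?thesis using gpos by (metis mult_left_cancel neq0_conv)
  qed
  have L2: "m * k' = k * m'" using m' k' by (metis mult.assoc mult.commute)
  define t where "t = nat (\<bar>u\<bar> + \<bar>v\<bar>)"
  have t: "int t = \<bar>u\<bar> + \<bar>v\<bar>" by (simp add: t_def)
  have pos': "m' \<ge> 1" "k' \<ge> 1" using pos m' k' by (auto intro!: Suc_leI Nat.gr0I)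
  have "int t \<le> int k' * int t" "int t \<le> int m' * int t"
    using pos' by (simp_all add: mult_le_cancel_right1)
  then have nn: "u + int k' * int t \<ge> 0" "int m' * int t - v \<ge> 0" using t by linarith+
  define u' w where "u' = nat (u + int k' * int t)" and "w = nat (int m' * int t - v)"
  have u': "int u' = u + int k' * int t" and w: "int w = int m' * int t - v"
    using nn by (simp_all add: u'_def w_def)
  have "int (k' * (m * t)) = int (k * (m' * t))" using L2 by (metis mult.assoc mult.commute)
  then have L2': "int k' * (int m * int t) = int k * (int m' * int t)" by (simp only: of_nat_mult)
  have um: "int (u' * m) = u * int m + int k' * (int m * int t)"
    unfolding of_nat_mult u' by (simp add: algebra_simps)
  have wk: "int (w * k) = int k * (int m' * int t) - v * int k"
    unfolding of_nat_mult w by (simp add: algebra_simps)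
  have "int (u' * m) = int (g + w * k)"
    unfolding of_nat_add um wk using bez L2' by linarith
  then have 1: "u' * m = g + w * k" by (simp only: of_nat_eq_iff)
  have "2 * int (lcm m k) * int t = 2 * (int k * (int m' * int t))"
    unfolding L of_nat_mult by (simp only: ac_simps)
  then have "int (u' * m + w * k) = e + 2 * int (lcm m k) * int t"
    unfolding of_nat_add um wk e using L2' by linarith
  from that[OF 1 this] show ?thesis .
qed

text \<open>The factorization with \<open>x\<close>, \<open>x\<inverse>\<close> and \<open>e\<close> spelled out, for use where the names of the locale are
not available.\<close>

lemma (in pretzel_factor) monic_gcd_lift:
  assumes L: "\<delta> dvd lcm m k"
  obtains p where "Polynomial.lead_coeff p = 1"
    "Polynomial.degree p + of_bool (\<delta> dvd k) + of_bool (\<delta> dvd m) = g"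
    "[:\<Phi>:] dvd p * ((y_var - [:[:0, 1:]:]) ^ of_bool (\<delta> dvd k) *
       (y_var - [:[:0, 1:] ^ (2 * \<delta> - 1):]) ^ of_bool (\<delta> dvd m)) - (y_var ^ g - [:[:0, 1:] ^ (u * m + w * k):])"
    "\<forall>S. type_ideal S \<longrightarrow> [:\<Phi>:] \<in> S \<longrightarrow> (p \<in> S \<longleftrightarrow> G_poly k \<in> S \<and> H_poly m \<in> S)"
proof -
  obtain p where p: "Polynomial.lead_coeff p = 1"
    "Polynomial.degree p + of_bool (\<delta> dvd k) + of_bool (\<delta> dvd m) = g"
    "[:\<Phi>:] dvd [:- xx, 1:] ^ of_bool (\<delta> dvd k) * ([:- xi, 1:] ^ of_bool (\<delta> dvd m) * p) - pow_diff"
    by (rule exists_monic_factorization[OF L])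
  have lin: "[:- z, 1:] = y_var - [:z:]" for z :: "rat poly" by (simp add: y_var_def)
  have "[:\<Phi>:] dvd p * ((y_var - [:[:0, 1:]:]) ^ of_bool (\<delta> dvd k) *
       (y_var - [:[:0, 1:] ^ (2 * \<delta> - 1):]) ^ of_bool (\<delta> dvd m)) - (y_var ^ g - [:[:0, 1:] ^ (u * m + w * k):])"
    using p(3) unfolding lin pow_diff_def e_def xi_def xx_def by (simp only: ac_simps)
  moreover have "\<forall>S. type_ideal S \<longrightarrow> [:\<Phi>:] \<in> S \<longrightarrow> (p \<in> S \<longleftrightarrow> G_poly k \<in> S \<and> H_poly m \<in> S)"
    by (intro allI impI mem_iff_monic_factor_mem[OF L p(3)])
  ultimately show ?thesis by (rule that[OF p(1,2)])
qed

context cyclotomic_quotient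
begin

definition xx :: "rat poly" where "xx = [:0, 1:]"
definition xi :: "rat poly" where "xi = xx ^ (2 * \<delta> - 1)"

lemma x_cls_eq: "x_cls \<delta> = cls xx"
  by (simp only: x_cls_def xx_def)

lemma cls_xx_power_cong:
  assumes "int (2 * \<delta>) dvd int b - int a"
  shows "cls (xx ^ a) = cls (xx ^ b)"
proof -
  have *: "cls (xx ^ a) = cls (xx ^ b)" if "a \<le> b" "int (2 * \<delta>) dvd int b - int a" for a b
  proof -
    obtain c where c: "b = a + c" using \<open>a \<le> b\<close> le_Suc_ex by blast
    then have "2 * \<delta> dvd c" using that(2) by (simp flip: of_nat_mult)
    then have "\<Phi> dvd xx ^ c - 1" unfolding xx_def using pos by (intro cyclotomic_dvd_power_minus_1) simp_all
    then have "\<Phi> dvd xx ^ a * (xx ^ c - 1)" by (rule dvd_mult)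
    moreover have "xx ^ b - xx ^ a = xx ^ a * (xx ^ c - 1)" by (simp add: c power_add algebra_simps)
    ultimately have "cls (xx ^ b) = cls (xx ^ a)" unfolding cls_eq_iff by (simp only:)
    then show ?thesis by (rule sym)
  qed
  show ?thesis
  proof (cases "a \<le> b")
    case False
    have "int (2 * \<delta>) dvd int a - int b" using assms by (simp only: dvd_diff_commute)
    then show ?thesis using *[of b a] False by simp
  qed (use * assms in blast)
qed

lemma cls_power: "cls (f ^ n) = cls f [^]\<^bsub>K\<^esub> n"
  by (induction n) (simp_all add: cls_simps K.m_comm)

lemma inv_x_cls: "inv\<^bsub>K\<^esub> x_cls \<delta> = cls xi"
  unfolding x_cls_eq
proof (rule K.comm_inv_char)
  have "Suc (2 * \<delta> - 1) = 2 * \<delta>" using pos by simp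
  then have "cls (xx * xi) = cls (xx ^ (2 * \<delta>))" by (simp only: xi_def power_Suc[symmetric])
  also have "\<dots> = cls (xx ^ 0)" by (rule cls_xx_power_cong) simp
  finally show "cls xx \<otimes>\<^bsub>K\<^esub> cls xi = \<one>\<^bsub>K\<^esub>" by (simp only: cls_simps power_0)
qed (rule cls_closed)+

lemma x_cls_int_power:
  assumes "int (2 * \<delta>) dvd int n - e"
  shows "x_cls \<delta> [^]\<^bsub>K\<^esub> e = cls (xx ^ n)"
proof (cases "e < 0")
  case False
  then have "x_cls \<delta> [^]\<^bsub>K\<^esub> e = cls (xx ^ nat e)"
    by (simp only: int_pow_def2 x_cls_eq cls_power Let_def if_False)
  also have "\<dots> = cls (xx ^ n)" using False assms by (intro cls_xx_power_cong) simp
  finally show ?thesis .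
next
  case True
  then have "x_cls \<delta> [^]\<^bsub>K\<^esub> e = inv\<^bsub>K\<^esub> (cls (xx ^ nat (- e)))"
    by (simp only: int_pow_def2 x_cls_eq cls_power Let_def if_True)
  also have "\<dots> = cls (xx ^ n)"
  proof (rule K.comm_inv_char)
    have "cls (xx ^ nat (- e) * xx ^ n) = cls (xx ^ (nat (- e) + n))" by (simp only: power_add)
    also have "\<dots> = cls (xx ^ 0)"
      by (rule cls_xx_power_cong[symmetric]) (use True assms in \<open>simp add: algebra_simps\<close>)
    finally show "cls (xx ^ nat (- e)) \<otimes>\<^bsub>K\<^esub> cls (xx ^ n) = \<one>\<^bsub>K\<^esub>" by (simp only: cls_simps power_0)
  qed (rule cls_closed)+
  finally show ?thesis .
qed

lemma up_y_eq: "up_y \<delta> = sub y_var"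
proof -
  have y: "y_var = Polynomial.monom 1 1" by (simp add: y_var_def x_as_monom)
  show ?thesis unfolding y sub_monom cls_simps ..
qed

lemma up_const_eq: "up_const \<delta> (cls c) = sub [:c:]"
  by (simp only: sub_monom[symmetric] monom_0)

text \<open>The composite of \<open>sub\<close> and the projection is onto, with kernel \<open>\<langle>p, \<Phi>\<rangle>\<close>.\<close>

lemma quotient_iso: "(Rxy Quot {s * p + t * [:\<Phi>:] | s t. True}) \<simeq> (UP K Quot (PIdl\<^bsub>UP K\<^esub> (sub p)))"
proof -
  let ?P = "PIdl\<^bsub>UP K\<^esub> (sub p)" and ?J = "{s * p + t * [:\<Phi>:] | s t. True}"
  interpret P: ideal ?P "UP K" by (rule U.P.cgenideal_ideal[OF sub_closed])
  let ?h = "(+>\<^bsub>UP K\<^esub>) ?P \<circ> sub"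
  have hom: "?h \<in> Ring.ring_hom Rxy (UP K Quot ?P)"
    by (rule ring_hom_trans[OF sub_ring_hom P.rcos_ring_hom])
  have hr: "ring_hom_ring Rxy (UP K Quot ?P) ?h"
    by (rule ring_hom_ringI2[OF ring_from_type_algebra P.quotient_is_ring hom])
  have surj: "?h ` carrier Rxy = carrier (UP K Quot ?P)"
  proof -
    have "carrier (UP K Quot ?P) = (+>\<^bsub>UP K\<^esub>) ?P ` carrier (UP K)"
      by (auto simp: FactRing_def A_RCOSETS_def')
    then show ?thesis by (simp only: carrier_UP ring_of_type_algebra_simps image_comp)
  qed
  have mem: "sub f \<in> ?P \<longleftrightarrow> f \<in> ?J" for f
  proof -
    have "sub f \<in> ?P \<longleftrightarrow> sub p divides\<^bsub>UP K\<^esub> sub f"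
      unfolding cgenideal_def factor_def using U.P.m_comm[OF sub_closed, of _ p] by (auto simp: Bex_def)
    then show ?thesis by (simp only: sub_divides_iff mem_Collect_eq simp_thms)
  qed
  have ker: "?h f = \<zero>\<^bsub>UP K Quot ?P\<^esub> \<longleftrightarrow> sub f \<in> ?P" for f
  proof
    assume "?h f = \<zero>\<^bsub>UP K Quot ?P\<^esub>"
    then have "?P +>\<^bsub>UP K\<^esub> sub f = ?P" by (simp add: FactRing_def)
    then show "sub f \<in> ?P" using P.a_rcos_self[OF sub_closed[of f]] by simp
  next
    assume "sub f \<in> ?P"
    then show "?h f = \<zero>\<^bsub>UP K Quot ?P\<^esub>" using P.a_rcos_const by (simp add: FactRing_def)
  qed
  have "a_kernel Rxy (UP K Quot ?P) ?h = ?J"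
    unfolding a_kernel_def' using ker mem by auto
  then show ?thesis using ring_hom_ring.FactRing_iso[OF hr surj] by simp
qed

text \<open>All properties of the gcd in one statement about a single lift \<open>p\<close>, so that one choice of \<open>p\<close> for each \<open>\<delta>\<close>
serves the formula for \<open>p\<^sub>\<delta>\<close>, its degree, the intersection of ideals and the dimension. When \<open>\<delta>\<close>
does not divide the lcm, \<open>p = 1\<close> qualifies because \<open>G\<close>, \<open>H\<close> and \<open>\<Phi>\<close> generate the unit ideal.\<close>

lemma p_gcd_description:
  fixes k m g :: nat and u v e :: int
  assumes km: "k > 0" "m > 0" and g: "g = gcd m k" and bez: "u * int m + v * int k = int g"
    and e: "e = u * int m - v * int k" and \<delta>: "\<delta> > 1"
  shows "\<exists>p. Polynomial.lead_coeff p = 1 \<and>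
    (\<forall>S. type_ideal S \<longrightarrow> [:\<Phi>:] \<in> S \<longrightarrow> (p \<in> S \<longleftrightarrow> G_poly k \<in> S \<and> H_poly m \<in> S)) \<and>
    (\<not> \<delta> dvd lcm m k \<longrightarrow> p = 1) \<and>
    (\<delta> dvd lcm m k \<longrightarrow> Polynomial.degree p + of_bool (\<delta> dvd k) + of_bool (\<delta> dvd m) = g) \<and>
    (\<delta> dvd lcm m k \<longrightarrow> subst_x \<delta> p \<otimes>\<^bsub>UP (K_cyc \<delta>)\<^esub>
             ((up_y \<delta> \<ominus>\<^bsub>UP (K_cyc \<delta>)\<^esub> up_const \<delta> (x_cls \<delta>))
                [^]\<^bsub>UP (K_cyc \<delta>)\<^esub> (of_bool (\<delta> dvd k) :: nat) \<otimes>\<^bsub>UP (K_cyc \<delta>)\<^esub>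
              (up_y \<delta> \<ominus>\<^bsub>UP (K_cyc \<delta>)\<^esub> up_const \<delta> (inv\<^bsub>K_cyc \<delta>\<^esub> x_cls \<delta>))
                [^]\<^bsub>UP (K_cyc \<delta>)\<^esub> (of_bool (\<delta> dvd m) :: nat))
           = up_y \<delta> [^]\<^bsub>UP (K_cyc \<delta>)\<^esub> g
               \<ominus>\<^bsub>UP (K_cyc \<delta>)\<^esub> up_const \<delta> (x_cls \<delta> [^]\<^bsub>K_cyc \<delta>\<^esub> e))"
proof -
  obtain u' w t where nb: "u' * m = g + w * k" "int (u' * m + w * k) = e + 2 * int (lcm m k) * int t"
    by (rule natural_bezout[OF km g bez e])
  note f = pretzel_factor.intro[OF \<delta> km g nb(1)]
  show ?thesis
  proof (cases "\<delta> dvd lcm m k")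
    case False
    have *: "1 \<in> S \<longleftrightarrow> G_poly k \<in> S \<and> H_poly m \<in> S" if S: "type_ideal S" "[:\<Phi>:] \<in> S" for S
    proof
      assume "1 \<in> S"
      then have "h \<in> S" for h using type_ideal_mult[OF S(1), of 1 h] by simp
      then show "G_poly k \<in> S \<and> H_poly m \<in> S" by (intro conjI)
    next
      assume "G_poly k \<in> S \<and> H_poly m \<in> S"
      then show "1 \<in> S" by (elim conjE) (rule pretzel_factor.one_mem_if_not_dvd_lcm[OF f S _ _ False])
    qed
    have "\<forall>S. type_ideal S \<longrightarrow> [:\<Phi>:] \<in> S \<longrightarrow> (1 \<in> S \<longleftrightarrow> G_poly k \<in> S \<and> H_poly m \<in> S)"
      by (intro allI impI *)
    then show ?thesis using False by (intro exI[of _ 1] conjI impI) simp_all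
  next
    case True
    obtain p where p: "Polynomial.lead_coeff p = 1"
      "Polynomial.degree p + of_bool (\<delta> dvd k) + of_bool (\<delta> dvd m) = g"
      "[:\<Phi>:] dvd p * ((y_var - [:[:0, 1:]:]) ^ of_bool (\<delta> dvd k) *
       (y_var - [:[:0, 1:] ^ (2 * \<delta> - 1):]) ^ of_bool (\<delta> dvd m)) - (y_var ^ g - [:[:0, 1:] ^ (u' * m + w * k):])"
      "\<forall>S. type_ideal S \<longrightarrow> [:\<Phi>:] \<in> S \<longrightarrow> (p \<in> S \<longleftrightarrow> G_poly k \<in> S \<and> H_poly m \<in> S)"
      by (rule pretzel_factor.monic_gcd_lift[OF f True])
    have "int (2 * \<delta>) dvd int (u' * m + w * k) - e"
    proof -
      have "int (2 * \<delta>) dvd int (2 * lcm m k)" using True by (simp only: of_nat_dvd_iff mult_dvd_mono dvd_refl)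
      then have "int (2 * \<delta>) dvd int (2 * lcm m k) * int t" by (rule dvd_mult2)
      moreover have "int (u' * m + w * k) - e = int (2 * lcm m k) * int t" using nb(2) by simp
      ultimately show ?thesis by (simp only:)
    qed
    then have xe: "x_cls \<delta> [^]\<^bsub>K_cyc \<delta>\<^esub> e = cls (xx ^ (u' * m + w * k))" by (rule x_cls_int_power)
    have "sub (p * ((y_var - [:xx:]) ^ of_bool (\<delta> dvd k) * (y_var - [:xi:]) ^ of_bool (\<delta> dvd m)))
      = sub (y_var ^ g - [:xx ^ (u' * m + w * k):])"
      unfolding sub_eq_iff xi_def xx_def by (rule p(3))
    then have eq: "sub p \<otimes>\<^bsub>UP (K_cyc \<delta>)\<^esub>
             ((up_y \<delta> \<ominus>\<^bsub>UP (K_cyc \<delta>)\<^esub> up_const \<delta> (x_cls \<delta>))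
                [^]\<^bsub>UP (K_cyc \<delta>)\<^esub> (of_bool (\<delta> dvd k) :: nat) \<otimes>\<^bsub>UP (K_cyc \<delta>)\<^esub>
              (up_y \<delta> \<ominus>\<^bsub>UP (K_cyc \<delta>)\<^esub> up_const \<delta> (inv\<^bsub>K_cyc \<delta>\<^esub> x_cls \<delta>))
                [^]\<^bsub>UP (K_cyc \<delta>)\<^esub> (of_bool (\<delta> dvd m) :: nat))
           = up_y \<delta> [^]\<^bsub>UP (K_cyc \<delta>)\<^esub> g
               \<ominus>\<^bsub>UP (K_cyc \<delta>)\<^esub> up_const \<delta> (x_cls \<delta> [^]\<^bsub>K_cyc \<delta>\<^esub> e)"
      unfolding xe inv_x_cls
      unfolding x_cls_eq up_const_eq up_y_eq
      by (simp only: sub_simps(1) sub_diff sub_power)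
    show ?thesis by (intro exI[of _ p] conjI impI p(1,2,4) eq) (use True in simp)
  qed
qed

end

section \<open>Assembling the quotient ring\<close>

text \<open>The factors \<open>c i\<close> and \<open>C\<close> (the product of the others) satisfy \<open>s c\<^sub>i + t C = 1\<close>. Weighting \<open>f \<equiv> C a\<close> with \<open>s c\<^sub>i\<close> and
\<open>f \<equiv> c\<^sub>i b\<close> with \<open>t C\<close> exhibits \<open>f\<close> as a multiple of \<open>c\<^sub>i C\<close> modulo \<open>N\<close>. Applied to an ideal \<open>N\<close> that
contains the full product, it shows that \<open>N\<close> is the intersection of the ideals \<open>N + \<langle>c i\<rangle>\<close>.\<close>

lemma congruent_mod_prod:
  fixes c :: "'i \<Rightarrow> 'a::comm_ring_1"
  assumes N: "type_ideal N" and F: "finite F"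
    and cop: "\<And>i j. i \<in> F \<Longrightarrow> j \<in> F \<Longrightarrow> i \<noteq> j \<Longrightarrow> \<exists>s t. s * c i + t * c j = 1"
    and f: "\<And>i. i \<in> F \<Longrightarrow> \<exists>a. f - c i * a \<in> N"
  shows "\<exists>a. f - (\<Prod>i\<in>F. c i) * a \<in> N"
  using F cop f
proof (induction F rule: finite_induct)
  case empty
  show ?case using type_ideal_0[OF N] by (intro exI[of _ f]) simp
next
  case (insert i F)
  let ?C = "\<Prod>i\<in>F. c i"
  have "\<exists>s t. s * c i + t * (\<Prod>j\<in>F'. c j) = 1" if "F' \<subseteq> F" for F'
    using finite_subset[OF that insert.hyps(1)] that
  proof (induction F' rule: finite_induct)
    case empty
    show ?case by (intro exI[of _ 0] exI[of _ 1]) simp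
  next
    case (insert j F')
    obtain s t where st: "s * c i + t * (\<Prod>j\<in>F'. c j) = 1" using insert by blast
    have "j \<in> F" using insert.prems by simp
    then have "i \<noteq> j" using \<open>i \<notin> F\<close> by auto
    then obtain s' t' where st': "s' * c i + t' * c j = 1"
      using \<open>j \<in> F\<close> \<open>\<And>i' j. i' \<in> insert i F \<Longrightarrow> j \<in> insert i F \<Longrightarrow> i' \<noteq> j \<Longrightarrow> \<exists>s t. s * c i' + t * c j = 1\<close>[of i j] by auto
    have "1 = (s * c i + t * (\<Prod>j\<in>F'. c j)) * (s' * c i + t' * c j)" unfolding st st' by simp
    also have "\<dots> = (s * (s' * c i + t' * c j) + t * (\<Prod>j\<in>F'. c j) * s') * c i + (t * t') * (\<Prod>j\<in>insert j F'. c j)"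
      using insert.hyps by (simp add: algebra_simps)
    finally show ?case by metis
  qed
  from this[OF order_refl] obtain s t where st: "s * c i + t * ?C = 1" by blast
  obtain a where a: "f - ?C * a \<in> N" using insert by auto
  obtain b where b: "f - c i * b \<in> N" using insert.prems(2)[of i] by auto
  have "(s * c i) * (f - ?C * a) + (t * ?C) * (f - c i * b) \<in> N"
    by (intro type_ideal_add[OF N] type_ideal_mult[OF N] a b)
  also have "(s * c i) * (f - ?C * a) + (t * ?C) * (f - c i * b) =
      (s * c i + t * ?C) * f - (c i * ?C) * (s * a + t * b)"
    by (simp add: algebra_simps)
  also have "\<dots> = f - (\<Prod>i\<in>insert i F. c i) * (s * a + t * b)"
    unfolding st using insert.hyps by simp
  finally show ?case by blast
qed

lemma type_ideal_add_principal: "type_ideal N \<Longrightarrow> type_ideal {f. \<exists>a. f - c * a \<in> N}" for c :: "'a::comm_ring_1"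
proof (rule type_idealI)
  assume N: "type_ideal N"
  show "0 \<in> {f. \<exists>a. f - c * a \<in> N}" using type_ideal_0[OF N] by (auto intro: exI[of _ 0])
  fix f assume "f \<in> {f. \<exists>a. f - c * a \<in> N}"
  then obtain a where a: "f - c * a \<in> N" by blast
  have "r * f - c * (r * a) = r * (f - c * a)" for r by (simp add: algebra_simps)
  then show "r * f \<in> {f. \<exists>a. f - c * a \<in> N}" for r
    using type_ideal_mult[OF N a, of r] by (intro CollectI exI[of _ "r * a"]) (simp only:)
  fix h assume "h \<in> {f. \<exists>a. f - c * a \<in> N}"
  then obtain b where b: "h - c * b \<in> N" by blast
  have "f + h - c * (a + b) = (f - c * a) + (h - c * b)" by (simp add: algebra_simps)
  then show "f + h \<in> {f. \<exists>a. f - c * a \<in> N}"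
    using type_ideal_add[OF N a b] by (intro CollectI exI[of _ "a + b"]) (simp only:)
qed

lemma set_add_comaximal:
  fixes N :: "'a::comm_ring_1 set"
  assumes "type_ideal N" "type_ideal M" "\<exists>a\<in>N. 1 - a \<in> M"
  shows "N <+>\<^bsub>ring_of_type_algebra\<^esub> M = UNIV"
proof (intro equalityI subsetI UNIV_I)
  fix f :: 'a
  obtain a where a: "a \<in> N" "1 - a \<in> M" using assms(3) by (elim bexE)
  have "f = f * a + f * (1 - a)" by (simp add: algebra_simps)
  then show "f \<in> N <+>\<^bsub>ring_of_type_algebra\<^esub> M"
    unfolding set_add_def'
    using type_ideal_mult[OF assms(1) a(1), of f] type_ideal_mult[OF assms(2) a(2), of f] by auto
qed

lemma chinese_remainder_set:
  fixes N :: "nat \<Rightarrow> 'a::comm_ring_1 set"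
  assumes fin: "finite D" and ne: "D \<noteq> {}" and N: "\<And>i. i \<in> D \<Longrightarrow> type_ideal (N i)"
    and com: "\<And>i j. i \<in> D \<Longrightarrow> j \<in> D \<Longrightarrow> i \<noteq> j \<Longrightarrow> \<exists>a\<in>N i. 1 - a \<in> N j"
  shows "((ring_of_type_algebra :: 'a ring) Quot (\<Inter>i\<in>D. N i)) \<simeq>
    RDirProd_list (map (\<lambda>i. ring_of_type_algebra Quot N i) (sorted_list_of_set D))"
proof -
  define L where "L = sorted_list_of_set D"
  have L: "set L = D" "distinct L" using fin by (simp_all add: L_def)
  have "length L > 0" using L ne by auto
  define n where "n = length L - 1"
  have n: "Suc n = length L" using \<open>length L > 0\<close> by (simp add: n_def)
  have mem: "L ! i \<in> D" if "i \<le> n" for i using that n L(1) by (metis le_imp_less_Suc nth_mem)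
  have "((ring_of_type_algebra :: 'a ring) Quot (\<Inter>i\<le>n. N (L ! i))) \<simeq>
    RDirProd_list (map (\<lambda>i. ring_of_type_algebra Quot N (L ! i)) [0..<Suc n])"
  proof (rule cring.chinese_remainder[OF cring_from_type_algebra])
    show "type_ideal (N (L ! i))" if "i \<le> n" for i by (rule N[OF mem[OF that]])
    fix i j assume ij: "i \<le> n" "j \<le> n" "i \<noteq> j"
    then have "L ! i \<noteq> L ! j" using L(2) n by (simp add: nth_eq_iff_index_eq)
    then show "N (L ! i) <+>\<^bsub>ring_of_type_algebra\<^esub> N (L ! j) = carrier ring_of_type_algebra"
      using set_add_comaximal[OF N[OF mem] N[OF mem] com[OF mem mem]] ij by simp
  qed
  moreover have "(\<Inter>i\<le>n. N (L ! i)) = (\<Inter>i\<in>D. N i)"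
  proof -
    have "D = (\<lambda>i. L ! i) ` {..n}"
      unfolding L(1)[symmetric] set_conv_nth using n by (auto simp: less_Suc_eq_le[symmetric])
    then show ?thesis by (simp add: image_image)
  qed
  moreover have "map (\<lambda>i. (ring_of_type_algebra :: 'a ring) Quot N (L ! i)) [0..<Suc n] = map (\<lambda>i. ring_of_type_algebra Quot N i) L"
    unfolding n by (rule nth_equalityI) simp_all
  ultimately show ?thesis unfolding L_def by simp
qed

theorem lemma4p5:
  fixes k m r q g :: nat and u v e :: int and I :: "rat poly poly set"
  assumes "k \<ge> 1" and "m \<ge> 1" and "r \<ge> 2" and "q = 2 * r - 1"
    and "I = pretzel_I k m r"
    and "g = gcd m k"
    and "u * int m + v * int k = int g"
    and "e = u * int m - v * int k"
  shows
    "I = Idl\<^bsub>Rxy\<^esub> {A_poly q, G_poly k, H_poly m} \<and>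
     (\<forall>\<delta>. \<delta> dvd q \<and> \<delta> > 1 \<longrightarrow>
        monic_gcd (K_cyc \<delta>) (p_gcd k m \<delta>) (subst_x \<delta> (G_poly k)) (subst_x \<delta> (H_poly m)) \<and>
        (\<not> \<delta> dvd lcm m k \<longrightarrow>
           p_gcd k m \<delta> = \<one>\<^bsub>UP (K_cyc \<delta>)\<^esub> \<and> d_gcd k m \<delta> = 0) \<and>
        (\<delta> dvd lcm m k \<longrightarrow>
           p_gcd k m \<delta> \<otimes>\<^bsub>UP (K_cyc \<delta>)\<^esub>
             ((up_y \<delta> \<ominus>\<^bsub>UP (K_cyc \<delta>)\<^esub> up_const \<delta> (x_cls \<delta>))
                [^]\<^bsub>UP (K_cyc \<delta>)\<^esub> (of_bool (\<delta> dvd k) :: nat) \<otimes>\<^bsub>UP (K_cyc \<delta>)\<^esub>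
              (up_y \<delta> \<ominus>\<^bsub>UP (K_cyc \<delta>)\<^esub> up_const \<delta> (inv\<^bsub>K_cyc \<delta>\<^esub> x_cls \<delta>))
                [^]\<^bsub>UP (K_cyc \<delta>)\<^esub> (of_bool (\<delta> dvd m) :: nat))
           = up_y \<delta> [^]\<^bsub>UP (K_cyc \<delta>)\<^esub> g
               \<ominus>\<^bsub>UP (K_cyc \<delta>)\<^esub> up_const \<delta> (x_cls \<delta> [^]\<^bsub>K_cyc \<delta>\<^esub> e) \<and>
           int (d_gcd k m \<delta>) = int g - of_bool (\<delta> dvd m) - of_bool (\<delta> dvd k))) \<and>
     (D_set k m q = {} \<longrightarrow> I = carrier Rxy) \<and>
     (D_set k m q \<noteq> {} \<longrightarrow>
        (Rxy Quot I) \<simeq>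
          RDirProd_list (map (\<lambda>\<delta>. UP (K_cyc \<delta>) Quot (PIdl\<^bsub>UP (K_cyc \<delta>)\<^esub> (p_gcd k m \<delta>)))
            (sorted_list_of_set (D_set k m q))) \<and>
        ring.dimension (Rxy Quot I)
          (\<Sum>\<delta>\<in>D_set k m q. d_gcd k m \<delta> * Polynomial.degree (cyclotomic (2 * \<delta>)))
          (rat_scalars I) (carrier (Rxy Quot I)))"
proof -
  have km: "k > 0" "m > 0" and odd: "odd q" and q: "q > 0" using assms(1-4) by simp_all
  define F where "F = {\<delta>. \<delta> dvd q \<and> \<delta> > 1}"
  have finF: "finite F" unfolding F_def using q by (intro finite_subset[OF _ finite_divisors_nat[OF q]]) auto
  define \<Phi> where "\<Phi> \<delta> = cyclotomic (2 * \<delta>)" for \<delta>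
  \<comment> \<open>Everything that is needed about the lift p of the gcd for delta.\<close>
  define good where "good \<delta> p \<longleftrightarrow> Polynomial.lead_coeff p = 1 \<and>
    (\<forall>S. type_ideal S \<longrightarrow> [:\<Phi> \<delta>:] \<in> S \<longrightarrow> (p \<in> S \<longleftrightarrow> G_poly k \<in> S \<and> H_poly m \<in> S)) \<and>
    (\<not> \<delta> dvd lcm m k \<longrightarrow> p = 1) \<and>
    (\<delta> dvd lcm m k \<longrightarrow> Polynomial.degree p + of_bool (\<delta> dvd k) + of_bool (\<delta> dvd m) = g) \<and>
    (\<delta> dvd lcm m k \<longrightarrow> subst_x \<delta> p \<otimes>\<^bsub>UP (K_cyc \<delta>)\<^esub>
             ((up_y \<delta> \<ominus>\<^bsub>UP (K_cyc \<delta>)\<^esub> up_const \<delta> (x_cls \<delta>))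
                [^]\<^bsub>UP (K_cyc \<delta>)\<^esub> (of_bool (\<delta> dvd k) :: nat) \<otimes>\<^bsub>UP (K_cyc \<delta>)\<^esub>
              (up_y \<delta> \<ominus>\<^bsub>UP (K_cyc \<delta>)\<^esub> up_const \<delta> (inv\<^bsub>K_cyc \<delta>\<^esub> x_cls \<delta>))
                [^]\<^bsub>UP (K_cyc \<delta>)\<^esub> (of_bool (\<delta> dvd m) :: nat))
           = up_y \<delta> [^]\<^bsub>UP (K_cyc \<delta>)\<^esub> g
               \<ominus>\<^bsub>UP (K_cyc \<delta>)\<^esub> up_const \<delta> (x_cls \<delta> [^]\<^bsub>K_cyc \<delta>\<^esub> e))" for \<delta> p
  define p where "p \<delta> = (SOME p. good \<delta> p)" for \<delta>
  have cq: "cyclotomic_quotient \<delta>" if "\<delta> \<in> F" for \<delta>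
    by (rule cyclotomic_quotient.intro) (use that in \<open>simp add: F_def\<close>)
  have good: "good \<delta> (p \<delta>)" if "\<delta> \<in> F" for \<delta>
  proof -
    have "\<delta> > 1" using that by (simp add: F_def)
    from cyclotomic_quotient.p_gcd_description[OF cq[OF that] km assms(6-8) this]
    have "\<exists>p. good \<delta> p" unfolding good_def \<Phi>_def .
    then show ?thesis unfolding p_def by (rule someI_ex)
  qed
  note good1 = good[unfolded good_def, THEN conjunct1]
  note good2 = good[unfolded good_def, THEN conjunct2, THEN conjunct1]
  note good3 = good[unfolded good_def, THEN conjunct2, THEN conjunct2, THEN conjunct1, THEN mp]
  note good4 = good[unfolded good_def, THEN conjunct2, THEN conjunct2, THEN conjunct2, THEN conjunct1, THEN mp]
  note good5 = good[unfolded good_def, THEN conjunct2, THEN conjunct2, THEN conjunct2, THEN conjunct2, THEN mp]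
  have lead: "Polynomial.lead_coeff (p \<delta>) = 1" if "\<delta> \<in> F" for \<delta> by (rule good1[OF that])
  have p_mem: "p \<delta> \<in> S \<longleftrightarrow> G_poly k \<in> S \<and> H_poly m \<in> S"
    if "\<delta> \<in> F" "type_ideal S" "[:\<Phi> \<delta>:] \<in> S" for \<delta> S
    by (rule mp[OF mp[OF spec[OF good2[OF that(1)]] that(2)] that(3)])
  have mgcd: "monic_gcd (K_cyc \<delta>) (subst_x \<delta> (p \<delta>)) (subst_x \<delta> (G_poly k)) (subst_x \<delta> (H_poly m))"
    if "\<delta> \<in> F" for \<delta>
    by (rule cyclotomic_quotient.monic_gcdI[OF cq[OF that] lead[OF that]]) (rule p_mem[OF that, unfolded \<Phi>_def])
  have p_gcd: "p_gcd k m \<delta> = subst_x \<delta> (p \<delta>)" if "\<delta> \<in> F" for \<delta>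
    by (rule cyclotomic_quotient.p_gcd_eq[OF cq[OF that] mgcd[OF that]])
  have d_gcd: "d_gcd k m \<delta> = Polynomial.degree (p \<delta>)" if "\<delta> \<in> F" for \<delta>
    unfolding d_gcd_def p_gcd[OF that] by (rule cyclotomic_quotient.deg_sub_monic[OF cq[OF that] lead[OF that]])
  have I_eq: "I = Idl\<^bsub>Rxy\<^esub> {A_poly q, G_poly k, H_poly m}"
    unfolding assms(4,5) by (rule pretzel_I_eq[OF km assms(3)])
  have I: "type_ideal I" unfolding I_eq by (rule type_ideal_genideal)
  have I_mem: "A_poly q \<in> I" "G_poly k \<in> I" "H_poly m \<in> I"
    using genideal_self_type[of "{A_poly q, G_poly k, H_poly m}"] unfolding I_eq by simp_all
  \<comment> \<open>The ideal generated by Phi, G and H, which is that of Phi and p.\<close>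
  define J where "J \<delta> = {s * p \<delta> + t * [:\<Phi> \<delta>:] | s t. True}" for \<delta>
  have J: "type_ideal (J \<delta>)" for \<delta> unfolding J_def by (rule type_ideal_pair)
  have J_mem: "p \<delta> \<in> J \<delta>" "[:\<Phi> \<delta>:] \<in> J \<delta>" for \<delta> unfolding J_def by (rule pair_ideal_generators)+
  have A: "A_poly q = (\<Prod>\<delta>\<in>F. [:\<Phi> \<delta>:])"
  proof -
    have "(\<Prod>\<delta>\<in>F'. [:\<Phi> \<delta>:]) = [:\<Prod>\<delta>\<in>F'. \<Phi> \<delta>:]" if "finite F'" for F'
      using that by (induction F' rule: finite_induct) (simp_all add: one_pCons)
    then show ?thesis using A_poly_eq_prod_cyclotomic[OF odd] finF unfolding F_def \<Phi>_def by simp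
  qed
  have coprime: "\<exists>s t. s * [:\<Phi> i:] + t * [:\<Phi> j:] = 1" if ij: "i \<in> F" "j \<in> F" "i \<noteq> j" for i j
  proof -
    have "2 * i > 0" "2 * j > 0" "2 * i \<noteq> 2 * j" using ij by (simp_all add: F_def)
    from cyclotomic_coprime[OF this] obtain s t where "s * \<Phi> i + t * \<Phi> j = 1"
      unfolding \<Phi>_def by (elim exE)
    then have "[:s * \<Phi> i + t * \<Phi> j:] = 1" by (simp only: one_pCons)
    moreover have "[:s:] * [:\<Phi> i:] + [:t:] * [:\<Phi> j:] = [:s * \<Phi> i + t * \<Phi> j:]" by (simp add: mult.commute)
    ultimately have "[:s:] * [:\<Phi> i:] + [:t:] * [:\<Phi> j:] = 1" by (simp only:)
    then show ?thesis by (intro exI)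
  qed
  have comax: "\<exists>a\<in>J i. 1 - a \<in> J j" if ij: "i \<in> F" "j \<in> F" "i \<noteq> j" for i j
  proof -
    obtain s t where st: "s * [:\<Phi> i:] + t * [:\<Phi> j:] = 1" using coprime[OF ij] by (elim exE)
    then have "1 - s * [:\<Phi> i:] = t * [:\<Phi> j:]" by (simp add: algebra_simps)
    then show ?thesis using type_ideal_mult[OF J J_mem(2)] by (intro bexI[of _ "s * [:\<Phi> i:]"]) simp_all
  qed
  have "I = (\<Inter>\<delta>\<in>F. J \<delta>)"
  proof (intro equalityI subsetI)
    fix f assume "f \<in> I"
    moreover have "I \<subseteq> J \<delta>" if "\<delta> \<in> F" for \<delta>
      unfolding I_eq
    proof (rule genideal_minimal_type[OF J])
      have "[:\<Phi> \<delta>:] dvd A_poly q" unfolding A using finF that by (rule dvd_prodI)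
      then have "A_poly q \<in> J \<delta>" by (rule type_ideal_dvd[OF J J_mem(2)])
      then show "{A_poly q, G_poly k, H_poly m} \<subseteq> J \<delta>"
        using p_mem[OF that J J_mem(2)] J_mem(1) by simp
    qed
    ultimately show "f \<in> (\<Inter>\<delta>\<in>F. J \<delta>)" by (intro INT_I) (rule subsetD)
  next
    fix f assume f: "f \<in> (\<Inter>\<delta>\<in>F. J \<delta>)"
    have "\<exists>a. f - (\<Prod>\<delta>\<in>F. [:\<Phi> \<delta>:]) * a \<in> I"
    proof (rule congruent_mod_prod[OF I finF coprime])
      fix \<delta> assume \<delta>: "\<delta> \<in> F"
      let ?T = "{f. \<exists>a. f - [:\<Phi> \<delta>:] * a \<in> I}"
      have T: "type_ideal ?T" by (rule type_ideal_add_principal[OF I])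
      have c: "[:\<Phi> \<delta>:] \<in> ?T" using type_ideal_0[OF I] by (intro CollectI exI[of _ 1]) simp
      have "h \<in> ?T" if "h \<in> I" for h using that by (intro CollectI exI[of _ 0]) simp
      then have "p \<delta> \<in> ?T" using p_mem[OF \<delta> T c] I_mem by simp
      have "f \<in> J \<delta>" using f \<delta> by (rule INT_D)
      then obtain s t where st: "f = s * p \<delta> + t * [:\<Phi> \<delta>:]" unfolding J_def by (elim CollectE exE conjE)
      have "f \<in> ?T"
        unfolding st by (rule type_ideal_add[OF T type_ideal_mult[OF T \<open>p \<delta> \<in> ?T\<close>] type_ideal_mult[OF T c]])
      then show "\<exists>a. f - [:\<Phi> \<delta>:] * a \<in> I" by (rule CollectD)
    qed
    then obtain a where "f - A_poly q * a \<in> I" unfolding A[symmetric] by (elim exE)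
    then have "f - A_poly q * a + A_poly q * a \<in> I"
      using I_mem(1) by (intro type_ideal_add[OF I] type_ideal_mult2[OF I])
    then show "f \<in> I" by simp
  qed
  define D where "D = D_set k m q"
  have D: "D = {\<delta>\<in>F. Polynomial.degree (p \<delta>) > 0}"
    unfolding D_def D_set_def F_def using d_gcd by (auto simp: F_def)
  have DF: "\<delta> \<in> F" if "\<delta> \<in> D" for \<delta> using that unfolding D by simp
  have finD: "finite D" unfolding D using finF by simp
  \<comment> \<open>A gcd of degree 0 gives the unit ideal, so only the factors in D contribute.\<close>
  have "J \<delta> = UNIV" if "\<delta> \<in> F" "\<delta> \<notin> D" for \<delta>
  proof -
    have "Polynomial.degree (p \<delta>) = 0" using that unfolding D by simp
    then obtain c where c: "p \<delta> = [:c:]" by (rule degree_eq_zeroE)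
    with lead[OF \<open>\<delta> \<in> F\<close>] have "p \<delta> = 1" by (simp add: one_pCons)
    then have "1 \<in> J \<delta>" using J_mem(1)[of \<delta>] by simp
    then have "f \<in> J \<delta>" for f using type_ideal_mult[OF J, of 1 \<delta> f] by simp
    then show ?thesis by (intro equalityI subsetI UNIV_I)
  qed
  note J_UNIV = this
  have "(\<Inter>\<delta>\<in>F. J \<delta>) = (\<Inter>\<delta>\<in>D. J \<delta>)"
  proof (intro equalityI subsetI INT_I)
    fix f \<delta> assume f: "f \<in> (\<Inter>\<delta>\<in>F. J \<delta>)" and "\<delta> \<in> D"
    then have "\<delta> \<in> F" by (intro DF)
    with f show "f \<in> J \<delta>" by (rule INT_D)
  next
    fix f \<delta> assume f: "f \<in> (\<Inter>\<delta>\<in>D. J \<delta>)" and \<delta>: "\<delta> \<in> F"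
    show "f \<in> J \<delta>"
    proof (cases "\<delta> \<in> D")
      case True
      with f show ?thesis by (rule INT_D)
    qed (simp add: J_UNIV[OF \<delta>])
  qed
  with \<open>I = (\<Inter>\<delta>\<in>F. J \<delta>)\<close> have I_Inter: "I = (\<Inter>\<delta>\<in>D. J \<delta>)" by (rule trans)
  have part2: "monic_gcd (K_cyc \<delta>) (p_gcd k m \<delta>) (subst_x \<delta> (G_poly k)) (subst_x \<delta> (H_poly m)) \<and>
        (\<not> \<delta> dvd lcm m k \<longrightarrow>
           p_gcd k m \<delta> = \<one>\<^bsub>UP (K_cyc \<delta>)\<^esub> \<and> d_gcd k m \<delta> = 0) \<and>
        (\<delta> dvd lcm m k \<longrightarrow>
           p_gcd k m \<delta> \<otimes>\<^bsub>UP (K_cyc \<delta>)\<^esub>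
             ((up_y \<delta> \<ominus>\<^bsub>UP (K_cyc \<delta>)\<^esub> up_const \<delta> (x_cls \<delta>))
                [^]\<^bsub>UP (K_cyc \<delta>)\<^esub> (of_bool (\<delta> dvd k) :: nat) \<otimes>\<^bsub>UP (K_cyc \<delta>)\<^esub>
              (up_y \<delta> \<ominus>\<^bsub>UP (K_cyc \<delta>)\<^esub> up_const \<delta> (inv\<^bsub>K_cyc \<delta>\<^esub> x_cls \<delta>))
                [^]\<^bsub>UP (K_cyc \<delta>)\<^esub> (of_bool (\<delta> dvd m) :: nat))
           = up_y \<delta> [^]\<^bsub>UP (K_cyc \<delta>)\<^esub> g
               \<ominus>\<^bsub>UP (K_cyc \<delta>)\<^esub> up_const \<delta> (x_cls \<delta> [^]\<^bsub>K_cyc \<delta>\<^esub> e) \<and>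
           int (d_gcd k m \<delta>) = int g - of_bool (\<delta> dvd m) - of_bool (\<delta> dvd k))" if \<delta>: "\<delta> \<in> F" for \<delta>
    unfolding p_gcd[OF \<delta>] d_gcd[OF \<delta>]
  proof (intro conjI impI)
    show "monic_gcd (K_cyc \<delta>) (subst_x \<delta> (p \<delta>)) (subst_x \<delta> (G_poly k)) (subst_x \<delta> (H_poly m))"
      by (rule mgcd[OF \<delta>])
    show "subst_x \<delta> (p \<delta>) = \<one>\<^bsub>UP (K_cyc \<delta>)\<^esub>" "Polynomial.degree (p \<delta>) = 0" if "\<not> \<delta> dvd lcm m k"
    proof -
      have "p \<delta> = 1" by (rule good3[OF \<delta> that])
      then show "subst_x \<delta> (p \<delta>) = \<one>\<^bsub>UP (K_cyc \<delta>)\<^esub>" "Polynomial.degree (p \<delta>) = 0"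
        by (simp_all add: cyclotomic_quotient.sub_simps(3)[OF cq[OF \<delta>]])
    qed
    assume L: "\<delta> dvd lcm m k"
    show "int (Polynomial.degree (p \<delta>)) = int g - of_bool (\<delta> dvd m) - of_bool (\<delta> dvd k)"
    proof -
      have "Polynomial.degree (p \<delta>) + of_bool (\<delta> dvd k) + of_bool (\<delta> dvd m) = g"
        by (rule good4[OF \<delta> L])
      then show ?thesis by (auto simp: of_bool_def)
    qed
  qed (rule good5[OF \<delta>])
  have iso: "(Rxy Quot I) \<simeq> RDirProd_list (map (\<lambda>\<delta>. UP (K_cyc \<delta>) Quot (PIdl\<^bsub>UP (K_cyc \<delta>)\<^esub> (p_gcd k m \<delta>)))
            (sorted_list_of_set D))" if "D \<noteq> {}"
  proof -
    have 1: "(Rxy Quot I) \<simeq> RDirProd_list (map (\<lambda>\<delta>. Rxy Quot J \<delta>) (sorted_list_of_set D))"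
      unfolding I_Inter by (rule chinese_remainder_set[OF finD that J comax]) (simp_all add: DF)
    have factor: "(Rxy Quot J \<delta>) \<simeq> (UP (K_cyc \<delta>) Quot (PIdl\<^bsub>UP (K_cyc \<delta>)\<^esub> (p_gcd k m \<delta>)))" if "\<delta> \<in> D" for \<delta>
      unfolding J_def \<Phi>_def p_gcd[OF DF[OF that]]
      by (rule cyclotomic_quotient.quotient_iso[OF cq[OF DF[OF that]]])
    have 2: "RDirProd_list (map (\<lambda>\<delta>. Rxy Quot J \<delta>) (sorted_list_of_set D)) \<simeq>
       RDirProd_list (map (\<lambda>\<delta>. UP (K_cyc \<delta>) Quot (PIdl\<^bsub>UP (K_cyc \<delta>)\<^esub> (p_gcd k m \<delta>))) (sorted_list_of_set D))"
    proof (intro RDirProd_list_cong list_all2_all_nthI)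
      fix n assume "n < length (map (\<lambda>\<delta>. Rxy Quot J \<delta>) (sorted_list_of_set D))"
      then have n: "n < length (sorted_list_of_set D)" by simp
      then have "sorted_list_of_set D ! n \<in> D" using nth_mem[OF n] finD by simp
      then show "map (\<lambda>\<delta>. Rxy Quot J \<delta>) (sorted_list_of_set D) ! n \<simeq>
          map (\<lambda>\<delta>. UP (K_cyc \<delta>) Quot (PIdl\<^bsub>UP (K_cyc \<delta>)\<^esub> (p_gcd k m \<delta>))) (sorted_list_of_set D) ! n"
        unfolding nth_map[OF n] by (rule factor)
    qed simp
    obtain f where f: "f \<in> ring_iso (Rxy Quot I) (RDirProd_list (map (\<lambda>\<delta>. Rxy Quot J \<delta>) (sorted_list_of_set D)))"
      using 1 by (rule is_ring_isoE)
    obtain h where h: "h \<in> ring_iso (RDirProd_list (map (\<lambda>\<delta>. Rxy Quot J \<delta>) (sorted_list_of_set D)))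
       (RDirProd_list (map (\<lambda>\<delta>. UP (K_cyc \<delta>) Quot (PIdl\<^bsub>UP (K_cyc \<delta>)\<^esub> (p_gcd k m \<delta>))) (sorted_list_of_set D)))"
      using 2 by (rule is_ring_isoE)
    show ?thesis by (rule is_ring_isoI[OF ring_iso_set_trans[OF f h]])
  qed
  have dim: "ring.dimension (Rxy Quot I)
          (\<Sum>\<delta>\<in>D. d_gcd k m \<delta> * Polynomial.degree (cyclotomic (2 * \<delta>)))
          (rat_scalars I) (carrier (Rxy Quot I))"
  proof -
    have "codim_chain (\<Sum>\<delta>\<in>D. d_gcd k m \<delta> * Polynomial.degree (cyclotomic (2 * \<delta>))) I UNIV"
      unfolding I_Inter
    proof (rule codim_chain_Inter[OF finD J])
      fix \<delta> assume "\<delta> \<in> D"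
      then have \<delta>: "\<delta> \<in> F" by (rule DF)
      then have "Polynomial.degree (\<Phi> \<delta>) > 0" unfolding \<Phi>_def F_def by (simp add: degree_cyclotomic_pos)
      then show "codim_chain (d_gcd k m \<delta> * Polynomial.degree (cyclotomic (2 * \<delta>))) (J \<delta>) UNIV"
        unfolding J_def d_gcd[OF \<delta>] \<Phi>_def[symmetric] by (rule codim_chain_monic[OF lead[OF \<delta>]])
    qed (rule comax[OF DF DF])
    from codim_chain_dimension[OF I this]
    have "ring.dimension (Rxy Quot I) (\<Sum>\<delta>\<in>D. d_gcd k m \<delta> * Polynomial.degree (cyclotomic (2 * \<delta>)))
       (rat_scalars I) (range (\<lambda>f. I +>\<^bsub>Rxy\<^esub> f))" .
    moreover have "range (\<lambda>f. I +>\<^bsub>Rxy\<^esub> f) = carrier (Rxy Quot I)"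
      by (auto simp: FactRing_def A_RCOSETS_def')
    ultimately show ?thesis by (simp only:)
  qed
  show ?thesis
    unfolding D_def[symmetric]
  proof (intro conjI allI impI)
    show "I = Idl\<^bsub>Rxy\<^esub> {A_poly q, G_poly k, H_poly m}" by (rule I_eq)
    show "I = carrier Rxy" if "D = {}" using I_Inter that by simp
  next
    fix \<delta> assume "\<delta> dvd q \<and> \<delta> > 1"
    then have \<delta>: "\<delta> \<in> F" by (simp add: F_def)
    note p = part2[OF \<delta>]
    show "monic_gcd (K_cyc \<delta>) (p_gcd k m \<delta>) (subst_x \<delta> (G_poly k)) (subst_x \<delta> (H_poly m))"
      by (rule p[THEN conjunct1])
    show "p_gcd k m \<delta> = \<one>\<^bsub>UP (K_cyc \<delta>)\<^esub>" if "\<not> \<delta> dvd lcm m k"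
      by (rule p[THEN conjunct2, THEN conjunct1, THEN mp, OF that, THEN conjunct1])
    show "d_gcd k m \<delta> = 0" if "\<not> \<delta> dvd lcm m k"
      by (rule p[THEN conjunct2, THEN conjunct1, THEN mp, OF that, THEN conjunct2])
    show "int (d_gcd k m \<delta>) = int g - of_bool (\<delta> dvd m) - of_bool (\<delta> dvd k)" if "\<delta> dvd lcm m k"
      by (rule p[THEN conjunct2, THEN conjunct2, THEN mp, OF that, THEN conjunct2])
    show "p_gcd k m \<delta> \<otimes>\<^bsub>UP (K_cyc \<delta>)\<^esub>
             ((up_y \<delta> \<ominus>\<^bsub>UP (K_cyc \<delta>)\<^esub> up_const \<delta> (x_cls \<delta>))
                [^]\<^bsub>UP (K_cyc \<delta>)\<^esub> (of_bool (\<delta> dvd k) :: nat) \<otimes>\<^bsub>UP (K_cyc \<delta>)\<^esub>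
              (up_y \<delta> \<ominus>\<^bsub>UP (K_cyc \<delta>)\<^esub> up_const \<delta> (inv\<^bsub>K_cyc \<delta>\<^esub> x_cls \<delta>))
                [^]\<^bsub>UP (K_cyc \<delta>)\<^esub> (of_bool (\<delta> dvd m) :: nat))
           = up_y \<delta> [^]\<^bsub>UP (K_cyc \<delta>)\<^esub> g
               \<ominus>\<^bsub>UP (K_cyc \<delta>)\<^esub> up_const \<delta> (x_cls \<delta> [^]\<^bsub>K_cyc \<delta>\<^esub> e)" if "\<delta> dvd lcm m k"
      by (rule p[THEN conjunct2, THEN conjunct2, THEN mp, OF that, THEN conjunct1])
  next
    show "(Rxy Quot I) \<simeq> RDirProd_list (map (\<lambda>\<delta>. UP (K_cyc \<delta>) Quot (PIdl\<^bsub>UP (K_cyc \<delta>)\<^esub> (p_gcd k m \<delta>)))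
            (sorted_list_of_set D))" if "D \<noteq> {}" by (rule iso[OF that])
    show "ring.dimension (Rxy Quot I)
          (\<Sum>\<delta>\<in>D. d_gcd k m \<delta> * Polynomial.degree (cyclotomic (2 * \<delta>)))
          (rat_scalars I) (carrier (Rxy Quot I))" by (rule dim)
  qed
qed

end
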